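(* (i) Let $\mathcal{B}$ be a manifest behavior and let $\Sigma$ be an LPV-SSA which satisfies the regularity certificate (RC) and which is a realization of $\mathcal{B}$. If $\mathcal{B}$ is controllable, then $\Sigma$ is a minimal realization of $\mathcal{B}$ if and only if $\Sigma$ is span-reachable from the zero initial state and observable. (ii) Conversely, if $\Sigma$ is an LPV-SSA which satisfies RC and is span-reachable from the zero initial state, then its manifest behavior $\mathcal{B}(\Sigma)$ is controllable.
   Context: Time axis: $\mathbb{T}=[0,+\infty)$ in continuous time (CT) and $\mathbb{T}=\mathbb{N}=\{0,1,2,\ldots\}$ in discrete time (DT); everything is considered for each of the two cases. Intervals such as $[0,t]$ are understood as subsets of $\mathbb{T}$. The operator $\xi$ is $(\xi z)(t)=\frac{d}{dt}z(t)$ in CT and $(\xi z)(t)=z(t+1)$ in DT. LPV-SSA: given $\mathbb{P}\subseteq\mathbb{R}^{n_{\mathrm p}}$ and matrices $A_i\in\mathbb{R}^{n_{\mathrm x}\times n_{\mathrm x}}$, $B_i\in\mathbb{R}^{n_{\mathrm x}\times n_{\mathrm u}}$, $C_i\in\mathbb{R}^{n_{\mathrm y}\times n_{\mathrm x}}$, $D_i\in\mathbb{R}^{n_{\mathrm y}\times n_{\mathrm u}}$, $i=0,\ldots,n_{\mathrm p}$, put $A(\mathbf{p})=A_0+\sum_{i=1}^{n_{\mathrm p}}A_i\mathbf{p}_i$ for $\mathbf{p}\in\mathbb{P}$, and similarly $B(\mathbf p),C(\mathbf p),D(\mathbf p)$. The LPV-SSA $\Sigma=(\mathbb{P},\{A_i,B_i,C_i,D_i\}_{i=0}^{n_{\mathrm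 p}})$ is the system $$\xi x(t)=A(p(t))x(t)+B(p(t))u(t),\qquad y(t)=C(p(t))x(t)+D(p(t))u(t).$$ Its state dimension is $\dim\Sigma=n_{\mathrm x}$ ($n_{\mathrm x}=0$ is allowed). Signal spaces: in DT, $\mathcal{X},\mathcal{Y},\mathcal{U},\mathcal{P}$ are the sets of all functions from $\mathbb{N}$ to $\mathbb{R}^{n_{\mathrm x}},\mathbb{R}^{n_{\mathrm y}},\mathbb{R}^{n_{\mathrm u}},\mathbb{P}$. In CT, $\mathcal{X}$ is the set of absolutely continuous functions $[0,\infty)\to\mathbb{R}^{n_{\mathrm x}}$, and $\mathcal{Y},\mathcal{U},\mathcal{P}$ are the sets of piecewise-continuous functions from $[0,\infty)$ to $\mathbb{R}^{n_{\mathrm y}},\mathbb{R}^{n_{\mathrm u}},\mathbb{P}$; in CT, output functions that agree almost everywhere are identified. A solution of $\Sigma$ is a tuple $(x,y,u,p)\in\mathcal{X}\times\mathcal{Y}\times\mathcal{U}\times\mathcal{P}$ satisfying the equations for almost all $t\in\mathbb{T}$ (CT), respectively all $t\in\mathbb{T}$ (DT). For each $(u,p)\in\mathcal{U}\times\mathcal{P}$ and $x_{\mathrm o}\in\mathbb{R}^{n_{\mathrm x}}$ there is a unique solution with $x(0)=x_{\mathrm o}$. Manifest behavior: $\mathcal{B}(\Sigma)=\{(y,u,p)\in\mathcal{Y}\times\mathcal{U}\times\mathcal{P}\mid \exists x\in\mathcal{X}: (x,y,u,p)\text{ is a solution of }\Sigma\}$. A manifest behavior is any subset $\mathcal{B}\subseteq\mathcal{Y}\times\mathcal{U}\times\mathcal{P}$;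 $\Sigma$ is a realization of $\mathcal{B}$ if $\mathcal{B}=\mathcal{B}(\Sigma)$. $\Sigma$ is a minimal realization of $\mathcal{B}$ if it is a realization of $\mathcal{B}$ and $\dim\Sigma\le\dim\Sigma'$ for every LPV-SSA $\Sigma'$ that is a realization of $\mathcal{B}$. Controllability of a behavior: $\mathcal{B}$ is controllable if for any two elements $(y_1,u_1,p_1),(y_2,u_2,p_2)\in\mathcal{B}$ and any $t\in\mathbb{T}$ there exist $(y,u,p)\in\mathcal{B}$ and $\tau\in\mathbb{T}$, $\tau>0$, such that $(y|_{[0,t]},u|_{[0,t]},p|_{[0,t]})=(y_1|_{[0,t]},u_1|_{[0,t]},p_1|_{[0,t]})$ and $(y(s),u(s),p(s))=(y_2(s-t-\tau),u_2(s-t-\tau),p_2(s-t-\tau))$ for all $s\in\mathbb{T}$, $s\ge t+\tau$. Span-reachability: $\Sigma$ is span-reachable from $x_{\mathrm o}$ if the linear span of $\{x(t)\mid t\in\mathbb{T},\ (x,y,u,p)\text{ is a solution of }\Sigma\text{ with }x(0)=x_{\mathrm o}\}$ equals $\mathbb{R}^{n_{\mathrm x}}$. Observability: let $\mathfrak{Y}_{\Sigma,x_{\mathrm o}}:\mathcal{U}\times\mathcal{P}\to\mathcal{Y}$ map $(u,p)$ to the output $y$ of the solution $(x,y,u,p)$ with $x(0)=x_{\mathrm o}$. $\Sigma$ is observable if for all $x_1,x_2\in\mathbb{R}^{n_{\mathrm x}}$, $x_1\neq x_2$ implies $\mathfrak{Y}_{\Sigma,x_1}\neq\mathfrak{Y}_{\Sigma,x_2}$.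 Regularity certificate (RC): $\Sigma$ satisfies RC if (1) $\mathbb{P}$ is convex with non-empty interior, and (2) in the DT case, $A(\mathbf{p})$ is invertible for all $\mathbf{p}\in\mathbb{P}$. *)

theory Defs
  imports "HOL-Analysis.Analysis" "Jordan_Normal_Form.VS_Connect"
begin

unbundle no vec_syntax
unbundle no inner_syntax

section \<open>Systems\<close>

text \<open>
  The number of states varies between the realizations of one behavior and may be 0, so all
  dimensions are natural numbers and \<open>\<real>\<^sup>n\<close> is \<^term>\<open>carrier_vec n :: real vec set\<close>.
\<close>

record lpv_ssa =
  nx :: nat
  nu :: nat
  ny :: nat
  np :: nat
  sched :: "real vec set"
  Amat :: "nat \<Rightarrow> real mat"
  Bmat :: "nat \<Rightarrow> real mat"
  Cmat :: "nat \<Rightarrow> real mat"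
  Dmat :: "nat \<Rightarrow> real mat"

definition is_lpv_ssa :: "lpv_ssa \<Rightarrow> bool" where
  "is_lpv_ssa \<Sigma> \<longleftrightarrow>
     sched \<Sigma> \<subseteq> carrier_vec (np \<Sigma>) \<and>
     (\<forall>i\<le>np \<Sigma>.
        Amat \<Sigma> i \<in> carrier_mat (nx \<Sigma>) (nx \<Sigma>) \<and>
        Bmat \<Sigma> i \<in> carrier_mat (nx \<Sigma>) (nu \<Sigma>) \<and>
        Cmat \<Sigma> i \<in> carrier_mat (ny \<Sigma>) (nx \<Sigma>) \<and>
        Dmat \<Sigma> i \<in> carrier_mat (ny \<Sigma>) (nu \<Sigma>))"

text \<open>
  \<open>M 0 + (\<Sum>i=1..n. p\<^sub>i M i)\<close>, written entrywise because there is no finite sum over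
  \<^typ>\<open>real mat\<close>. Vectors are indexed from 0, so \<open>p\<^sub>i\<close> is \<^term>\<open>p $ (i - 1)\<close>.
\<close>

definition affine_mat :: "nat \<Rightarrow> nat \<Rightarrow> nat \<Rightarrow> (nat \<Rightarrow> real mat) \<Rightarrow> real vec \<Rightarrow> real mat" where
  "affine_mat nr nc n M p =
     mat nr nc (\<lambda>jk. M 0 $$ jk + (\<Sum>i=1..n. p $ (i - 1) * M i $$ jk))"

definition Aof :: "lpv_ssa \<Rightarrow> real vec \<Rightarrow> real mat" where
  "Aof \<Sigma> = affine_mat (nx \<Sigma>) (nx \<Sigma>) (np \<Sigma>) (Amat \<Sigma>)"

definition Bof :: "lpv_ssa \<Rightarrow> real vec \<Rightarrow> real mat" where
  "Bof \<Sigma> = affine_mat (nx \<Sigma>) (nu \<Sigma>) (np \<Sigma>) (Bmat \<Sigma>)"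

definition Cof :: "lpv_ssa \<Rightarrow> real vec \<Rightarrow> real mat" where
  "Cof \<Sigma> = affine_mat (ny \<Sigma>) (nx \<Sigma>) (np \<Sigma>) (Cmat \<Sigma>)"

definition Dof :: "lpv_ssa \<Rightarrow> real vec \<Rightarrow> real mat" where
  "Dof \<Sigma> = affine_mat (ny \<Sigma>) (nu \<Sigma>) (np \<Sigma>) (Dmat \<Sigma>)"

section \<open>Signals\<close>

text \<open>
  Time is \<^typ>\<open>real\<close> restricted to \<^term>\<open>{0::real..}\<close> in continuous time and \<^typ>\<open>nat\<close> in
  discrete time. Continuous-time signals are extensional functions on \<^term>\<open>{0::real..}\<close>, so
  that equality of signals does not look at negative times.
\<close>

type_synonym 't signal = "'t \<Rightarrow> real vec"

definition piecewise_continuous :: "(real \<Rightarrow> real) \<Rightarrow> bool" where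
  "piecewise_continuous f \<longleftrightarrow>
     (\<forall>b. finite {t \<in> {0..b}. \<not> continuous (at t within {0..}) f}) \<and>
     (\<forall>t\<ge>0. \<exists>l. (f \<longlongrightarrow> l) (at_right t)) \<and>
     (\<forall>t>0. \<exists>l. (f \<longlongrightarrow> l) (at_left t))"

text \<open>
  Absolute continuity on the unbounded interval \<open>[0,\<infinity>)\<close> is meant on every compact
  subinterval; otherwise not even \<open>x' = x\<close> would have its solutions among the state signals.
\<close>

definition absolutely_continuous_on :: "real \<Rightarrow> real \<Rightarrow> (real \<Rightarrow> real) \<Rightarrow> bool" where
  "absolutely_continuous_on a b f \<longleftrightarrow>
     (\<forall>\<epsilon>>0. \<exists>\<delta>>0. \<forall>I :: (real \<times> real) set.
        finite I \<and> (\<forall>(r, s)\<in>I. a \<le> r \<and> r \<le> s \<and> s \<le> b) \<and>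
        disjoint_family_on (\<lambda>(r, s). {r<..<s}) I \<and> (\<Sum>(r, s)\<in>I. s - r) < \<delta>
        \<longrightarrow> (\<Sum>(r, s)\<in>I. \<bar>f s - f r\<bar>) < \<epsilon>)"

definition ct_state_signals :: "nat \<Rightarrow> real signal set" where
  "ct_state_signals n =
     {x \<in> {0..} \<rightarrow>\<^sub>E carrier_vec n. \<forall>i<n. \<forall>b. absolutely_continuous_on 0 b (\<lambda>t. x t $ i)}"

definition ct_signals :: "nat \<Rightarrow> real vec set \<Rightarrow> real signal set" where
  "ct_signals n V = {w \<in> {0..} \<rightarrow>\<^sub>E V. \<forall>i<n. piecewise_continuous (\<lambda>t. w t $ i)}"

abbreviation ct_almost_all :: "(real \<Rightarrow> bool) \<Rightarrow> bool" where
  "ct_almost_all Q \<equiv> (AE t in lebesgue. Q t)"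

section \<open>Solutions\<close>

definition ct_solutions ::
  "lpv_ssa \<Rightarrow> (real signal \<times> real signal \<times> real signal \<times> real signal) set" where
  "ct_solutions \<Sigma> =
     {(x, y, u, p).
        x \<in> ct_state_signals (nx \<Sigma>) \<and>
        y \<in> ct_signals (ny \<Sigma>) (carrier_vec (ny \<Sigma>)) \<and>
        u \<in> ct_signals (nu \<Sigma>) (carrier_vec (nu \<Sigma>)) \<and>
        p \<in> ct_signals (np \<Sigma>) (sched \<Sigma>) \<and>
        ct_almost_all (\<lambda>t. t \<ge> 0 \<longrightarrow>
          (\<forall>i<nx \<Sigma>. ((\<lambda>s. x s $ i) has_real_derivative
             (Aof \<Sigma> (p t) *\<^sub>v x t + Bof \<Sigma> (p t) *\<^sub>v u t) $ i) (at t within {0..})) \<and>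
          y t = Cof \<Sigma> (p t) *\<^sub>v x t + Dof \<Sigma> (p t) *\<^sub>v u t)}"

definition dt_solutions ::
  "lpv_ssa \<Rightarrow> (nat signal \<times> nat signal \<times> nat signal \<times> nat signal) set" where
  "dt_solutions \<Sigma> =
     {(x, y, u, p).
        x \<in> UNIV \<rightarrow> carrier_vec (nx \<Sigma>) \<and>
        y \<in> UNIV \<rightarrow> carrier_vec (ny \<Sigma>) \<and>
        u \<in> UNIV \<rightarrow> carrier_vec (nu \<Sigma>) \<and>
        p \<in> UNIV \<rightarrow> sched \<Sigma> \<and>
        (\<forall>t. x (t + 1) = Aof \<Sigma> (p t) *\<^sub>v x t + Bof \<Sigma> (p t) *\<^sub>v u t \<and>
             y t = Cof \<Sigma> (p t) *\<^sub>v x t + Dof \<Sigma> (p t) *\<^sub>v u t)}"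

section \<open>Behaviors and realizations\<close>

text \<open>
  The notions below that make sense on both time axes take the solution map
  (\<^const>\<open>ct_solutions\<close> or \<^const>\<open>dt_solutions\<close>) as a parameter \<open>sols\<close>.
\<close>

type_synonym 't behavior = "('t signal \<times> 't signal \<times> 't signal) set"
type_synonym 't solution_map =
  "lpv_ssa \<Rightarrow> ('t signal \<times> 't signal \<times> 't signal \<times> 't signal) set"

text \<open>
  Identifying outputs that agree almost everywhere means that a continuous-time behavior is a
  set closed under changing the output on a null set.
\<close>

definition is_ct_behavior :: "nat \<Rightarrow> nat \<Rightarrow> nat \<Rightarrow> real vec set \<Rightarrow> real behavior \<Rightarrow> bool" where
  "is_ct_behavior l m k P \<B> \<longleftrightarrow>
     \<B> \<subseteq> ct_signals l (carrier_vec l) \<times> ct_signals m (carrier_vec m) \<times> ct_signals k P \<and>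
     (\<forall>(y, u, p)\<in>\<B>. \<forall>y'\<in>ct_signals l (carrier_vec l).
        ct_almost_all (\<lambda>t. t \<ge> 0 \<longrightarrow> y' t = y t) \<longrightarrow> (y', u, p) \<in> \<B>)"

definition is_dt_behavior :: "nat \<Rightarrow> nat \<Rightarrow> real vec set \<Rightarrow> nat behavior \<Rightarrow> bool" where
  "is_dt_behavior l m P \<B> \<longleftrightarrow>
     \<B> \<subseteq> (UNIV \<rightarrow> carrier_vec l) \<times> (UNIV \<rightarrow> carrier_vec m) \<times> (UNIV \<rightarrow> P)"

definition manifest_behavior :: "'t solution_map \<Rightarrow> lpv_ssa \<Rightarrow> 't behavior" where
  "manifest_behavior sols \<Sigma> = {(y, u, p). \<exists>x. (x, y, u, p) \<in> sols \<Sigma>}"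

definition realization :: "'t solution_map \<Rightarrow> lpv_ssa \<Rightarrow> 't behavior \<Rightarrow> bool" where
  "realization sols \<Sigma> \<B> \<longleftrightarrow> is_lpv_ssa \<Sigma> \<and> \<B> = manifest_behavior sols \<Sigma>"

definition minimal_realization :: "'t solution_map \<Rightarrow> lpv_ssa \<Rightarrow> 't behavior \<Rightarrow> bool" where
  "minimal_realization sols \<Sigma> \<B> \<longleftrightarrow>
     realization sols \<Sigma> \<B> \<and> (\<forall>\<Sigma>'. realization sols \<Sigma>' \<B> \<longrightarrow> nx \<Sigma> \<le> nx \<Sigma>')"

text \<open>
  \<open>ae\<close> is \<^term>\<open>ct_almost_all\<close> in continuous time and \<^term>\<open>All\<close> in discrete time; it is
  applied to outputs only, inputs and scheduling signals have to agree everywhere.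
\<close>

definition controllable ::
  "(('t::linordered_semidom \<Rightarrow> bool) \<Rightarrow> bool) \<Rightarrow> 't behavior \<Rightarrow> bool" where
  "controllable ae \<B> \<longleftrightarrow>
     (\<forall>(y1, u1, p1)\<in>\<B>. \<forall>(y2, u2, p2)\<in>\<B>. \<forall>t\<ge>0. \<exists>(y, u, p)\<in>\<B>. \<exists>\<tau>>0.
        ae (\<lambda>s. s \<in> {0..t} \<longrightarrow> y s = y1 s) \<and>
        (\<forall>s\<in>{0..t}. u s = u1 s \<and> p s = p1 s) \<and>
        ae (\<lambda>s. s \<ge> t + \<tau> \<longrightarrow> y s = y2 (s - t - \<tau>)) \<and>
        (\<forall>s\<ge>t + \<tau>. u s = u2 (s - t - \<tau>) \<and> p s = p2 (s - t - \<tau>)))"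

definition span_reachable ::
  "'t::linordered_semidom solution_map \<Rightarrow> lpv_ssa \<Rightarrow> real vec \<Rightarrow> bool" where
  "span_reachable sols \<Sigma> x0 \<longleftrightarrow>
     LinearCombinations.module.span class_ring (module_vec TYPE(real) (nx \<Sigma>))
       {x t | x y u p t. t \<ge> 0 \<and> (x, y, u, p) \<in> sols \<Sigma> \<and> x 0 = x0} = carrier_vec (nx \<Sigma>)"

text \<open>
  The output for input \<open>u\<close> and scheduling \<open>p\<close> from initial state \<open>x0\<close>, as the set of its
  representatives: a full class of outputs agreeing almost everywhere in continuous time, a
  singleton in discrete time. Outside the input and scheduling spaces it is empty, so comparing
  two output maps as total functions compares them on these spaces.
\<close>

definition output_map ::
  "'t::linordered_semidom solution_map \<Rightarrow> lpv_ssa \<Rightarrow> real vec \<Rightarrow>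
   't signal \<times> 't signal \<Rightarrow> 't signal set" where
  "output_map sols \<Sigma> x0 = (\<lambda>(u, p). {y. \<exists>x. (x, y, u, p) \<in> sols \<Sigma> \<and> x 0 = x0})"

definition observable :: "'t::linordered_semidom solution_map \<Rightarrow> lpv_ssa \<Rightarrow> bool" where
  "observable sols \<Sigma> \<longleftrightarrow>
     (\<forall>x1\<in>carrier_vec (nx \<Sigma>). \<forall>x2\<in>carrier_vec (nx \<Sigma>).
        x1 \<noteq> x2 \<longrightarrow> output_map sols \<Sigma> x1 \<noteq> output_map sols \<Sigma> x2)"

section \<open>Regularity certificate\<close>

text \<open>
  \<^typ>\<open>real vec\<close> carries no topology or vector space class, so convexity and the existence of an
  interior point (the centre \<open>c\<close> of a Euclidean ball inside the set) are spelled out.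
\<close>

definition regular_schedule :: "nat \<Rightarrow> real vec set \<Rightarrow> bool" where
  "regular_schedule k P \<longleftrightarrow>
     (\<forall>p\<in>P. \<forall>q\<in>P. \<forall>a\<in>{0..1}. a \<cdot>\<^sub>v p + (1 - a) \<cdot>\<^sub>v q \<in> P) \<and>
     (\<exists>c\<in>P. \<exists>r>0. \<forall>q\<in>carrier_vec k. (q - c) \<bullet> (q - c) < r\<^sup>2 \<longrightarrow> q \<in> P)"

definition ct_RC :: "lpv_ssa \<Rightarrow> bool" where
  "ct_RC \<Sigma> \<longleftrightarrow> regular_schedule (np \<Sigma>) (sched \<Sigma>)"

definition dt_RC :: "lpv_ssa \<Rightarrow> bool" where
  "dt_RC \<Sigma> \<longleftrightarrow>
     regular_schedule (np \<Sigma>) (sched \<Sigma>) \<and> (\<forall>p\<in>sched \<Sigma>. invertible_mat (Aof \<Sigma> p))"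

end

theory Submission
  imports Defs
begin

text \<open>
  For a fixed schedule the states reachable from zero form a subspace. Prepending a schedule \<open>q\<close> to
  \<open>p\<close> adds to the subspace of \<open>p\<close> the states reached under \<open>q\<close> and transported along \<open>p\<close>, and the
  transport is injective. Hence, for a schedule whose subspace has maximal dimension, span-reachability
  makes it the whole space: one schedule steers between any two states, which is controllability.
  Dually, observability yields one schedule under which the state is determined by the output of the
  unforced system. That schedule embeds the state space into that of any other realization, so
  observable realizations are minimal. Conversely an unobservable subspace can be factored out. If the
  behavior is controllable and the system observable, steering from the zero trajectory along the
  observing schedule shows that every trajectory starts in a reachable state, so a minimal realization
  is span-reachable.
\<close>

section \<open>Subspaces and matrices\<close>

text \<open>Another realization is tied to \<Sigma> only through common trajectories, and
  superposition holds only along a common schedule. Hence the comparison of initial states and the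
  reachability of all states must be settled along one schedule, although observability and
  span-reachability allow a different schedule for every direction. The two maximality arguments
  close this gap. They concatenate arbitrary schedules, which both signal spaces permit because
  jumps are allowed. RC supplies a schedule to begin with and, in discrete time, the injectivity of
  the transport; in continuous time linear flows are reversible. Reduced systems must again be
  affine in the scheduling parameter, so they are built with constant matrices from subspaces
  invariant under every \<open>Aof \<Sigma> q\<close>, and this invariance is read off from
  trajectories with constant schedule. Both time axes are instances of one locale of trajectory
  properties. In continuous time the equations hold only almost everywhere, so states are handled by
  an integral equation and outputs by a filter.\<close>

definition vec_subspace :: "nat \<Rightarrow> real vec set \<Rightarrow> bool" where
  "vec_subspace n W \<longleftrightarrow> W \<subseteq> carrier_vec n \<and> 0\<^sub>v n \<in> W \<and>
     (\<forall>a b. \<forall>x\<in>W. \<forall>y\<in>W. a \<cdot>\<^sub>v x + b \<cdot>\<^sub>v y \<in> W)"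

lemma vec_subspaceI:
  assumes "W \<subseteq> carrier_vec n" "0\<^sub>v n \<in> W"
    and "\<And>a b x y. x \<in> W \<Longrightarrow> y \<in> W \<Longrightarrow> a \<cdot>\<^sub>v x + b \<cdot>\<^sub>v y \<in> W"
  shows "vec_subspace n W"
  using assms by (auto simp: vec_subspace_def)

lemma vec_subspace_carrier: "vec_subspace n W \<Longrightarrow> x \<in> W \<Longrightarrow> x \<in> carrier_vec n"
  by (auto simp: vec_subspace_def)

lemma vec_subspace_zero: "vec_subspace n W \<Longrightarrow> 0\<^sub>v n \<in> W"
  by (auto simp: vec_subspace_def)

lemma vec_subspace_lincomb:
  "vec_subspace n W \<Longrightarrow> x \<in> W \<Longrightarrow> y \<in> W \<Longrightarrow> a \<cdot>\<^sub>v x + b \<cdot>\<^sub>v y \<in> W"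
  by (auto simp: vec_subspace_def)

lemma smult_one_plus_zero: "(x :: real vec) \<in> carrier_vec n \<Longrightarrow> y \<in> carrier_vec n \<Longrightarrow> a \<cdot>\<^sub>v x + 0 \<cdot>\<^sub>v y = a \<cdot>\<^sub>v x"
  by (rule eq_vecI) auto

lemma vec_subspace_smult:
  assumes "vec_subspace n W" "x \<in> W" shows "a \<cdot>\<^sub>v x \<in> W"
  using vec_subspace_lincomb[OF assms(1,2,2), of a 0] vec_subspace_carrier[OF assms]
  by (simp add: smult_one_plus_zero)

lemma vec_subspace_add:
  assumes "vec_subspace n W" "x \<in> W" "y \<in> W" shows "x + y \<in> W"
  using vec_subspace_lincomb[OF assms, of 1 1] by simp

lemma vec_subspace_minus:
  assumes "vec_subspace n W" "x \<in> W" "y \<in> W" shows "x - y \<in> W"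
proof -
  have "1 \<cdot>\<^sub>v x + (-1) \<cdot>\<^sub>v y = x - y"
    using vec_subspace_carrier[OF assms(1)] assms by (intro eq_vecI) auto
  then show ?thesis using vec_subspace_lincomb[OF assms, of 1 "-1"] by simp
qed

lemma scalar_prod_self_eq_zero:
  fixes x :: "real vec"
  assumes "x \<in> carrier_vec n" "x \<bullet> x = 0"
  shows "x = 0\<^sub>v n"
proof -
  have "\<forall>i\<in>{0..<n}. x $ i * x $ i = 0"
    using assms by (subst sum_nonneg_eq_0_iff[symmetric]) (auto simp: scalar_prod_def)
  then show ?thesis using assms by (intro eq_vecI) auto
qed

lemma mult_mat_zero_vec: "(M :: real mat) \<in> carrier_mat m n \<Longrightarrow> M *\<^sub>v 0\<^sub>v n = 0\<^sub>v m"
  by (intro eq_vecI) auto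

lemma zero_mat_mult_vec: "0\<^sub>m m n *\<^sub>v v = (0\<^sub>v m :: real vec)" if "v \<in> carrier_vec n"
  using that by (intro eq_vecI) auto

lemma mult_mat_vec_lincomb:
  fixes M :: "real mat"
  assumes "M \<in> carrier_mat m n" "x \<in> carrier_vec n" "y \<in> carrier_vec n"
  shows "M *\<^sub>v (a \<cdot>\<^sub>v x + b \<cdot>\<^sub>v y) = a \<cdot>\<^sub>v (M *\<^sub>v x) + b \<cdot>\<^sub>v (M *\<^sub>v y)"
  using assms by (simp add: mult_add_distrib_mat_vec mult_mat_vec)

section \<open>Injective matrices as a measure of dimension\<close>

definition inj_mat :: "nat \<Rightarrow> nat \<Rightarrow> real mat \<Rightarrow> bool" where
  "inj_mat n k M \<longleftrightarrow> M \<in> carrier_mat n k \<and> (\<forall>v\<in>carrier_vec k. M *\<^sub>v v = 0\<^sub>v n \<longrightarrow> v = 0\<^sub>v k)"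

text \<open>Padding with zero rows to a square matrix keeps the kernel, and a zero row makes the
  determinant vanish. All dimension bounds below come down to this inequality.\<close>

lemma inj_mat_le:
  assumes "inj_mat n k M" shows "k \<le> n"
proof (rule ccontr)
  assume nk: "\<not> k \<le> n"
  define A where "A = mat k k (\<lambda>(i,j). if i < n then M $$ (i,j) else 0)"
  have A: "A \<in> carrier_mat k k" by (simp add: A_def)
  have M: "M \<in> carrier_mat n k" using assms by (simp add: inj_mat_def)
  have "A\<^sup>T *\<^sub>v unit_vec k n = 0\<^sub>v k"
    using nk by (intro eq_vecI) (auto simp: A_def scalar_prod_right_unit)
  moreover have "unit_vec k n \<noteq> (0\<^sub>v k :: real vec)"
    using nk by (metis index_unit_vec(1) index_zero_vec(1) not_le one_neq_zero)
  ultimately have "det A\<^sup>T = 0"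
    using det_0_iff_vec_prod_zero[of "A\<^sup>T" k] A by (metis transpose_carrier_mat unit_vec_carrier)
  then have "det A = 0" using det_transpose[OF A] by simp
  then obtain v where v: "v \<in> carrier_vec k" "v \<noteq> 0\<^sub>v k" "A *\<^sub>v v = 0\<^sub>v k"
    using det_0_iff_vec_prod_zero[OF A] by blast
  have "M *\<^sub>v v = 0\<^sub>v n"
  proof (rule eq_vecI)
    fix i assume i: "i < dim_vec (0\<^sub>v n :: real vec)"
    have "(M *\<^sub>v v) $ i = (A *\<^sub>v v) $ i"
      using i nk M v(1) by (auto simp: A_def scalar_prod_def intro!: sum.cong)
    then show "(M *\<^sub>v v) $ i = 0\<^sub>v n $ i" using v(3) i nk by simp
  qed (use M in auto)
  then show False using assms v by (auto simp: inj_mat_def)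
qed

lemma inj_mat_square_inverse:
  assumes "inj_mat n n M"
  obtains S where "S \<in> carrier_mat n n" "S * M = 1\<^sub>m n" "M * S = 1\<^sub>m n"
proof -
  have M: "M \<in> carrier_mat n n" using assms by (simp add: inj_mat_def)
  have "det M \<noteq> 0"
    using det_0_iff_vec_prod_zero[OF M] assms by (auto simp: inj_mat_def)
  from det_non_zero_imp_unit[OF M this] show ?thesis
    using that by (auto simp: Units_def ring_mat_def)
qed

text \<open>The witness is the inverse of the Gram matrix \<open>T\<^sup>T * T\<close>, times
  \<open>T\<^sup>T\<close>. The Gram matrix is injective because \<open>v\<close> paired with its
  image is the squared length of \<open>T *\<^sub>v v\<close>. The last property says that
  \<open>T * S\<close> is the orthogonal projection onto the column space.\<close>

lemma inj_mat_left_inverse: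
  assumes "inj_mat n k T"
  obtains S where "S \<in> carrier_mat k n" "S * T = 1\<^sub>m k"
    "\<And>x. x \<in> carrier_vec n \<Longrightarrow> T\<^sup>T *\<^sub>v (x - T *\<^sub>v (S *\<^sub>v x)) = 0\<^sub>v k"
proof -
  have T: "T \<in> carrier_mat n k" using assms by (simp add: inj_mat_def)
  have TT: "T\<^sup>T \<in> carrier_mat k n" using T by simp
  have "inj_mat k k (T\<^sup>T * T)"
    unfolding inj_mat_def
  proof (intro conjI ballI impI)
    show "T\<^sup>T * T \<in> carrier_mat k k" using T TT by simp
    fix v :: "real vec" assume v: "v \<in> carrier_vec k" "T\<^sup>T * T *\<^sub>v v = 0\<^sub>v k"
    have "(T *\<^sub>v v) \<bullet> (T *\<^sub>v v) = v \<bullet> (T\<^sup>T *\<^sub>v (T *\<^sub>v v))"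
      using transpose_vec_mult_scalar[OF T v(1), of "T *\<^sub>v v"] T v
      by (smt (verit) comm_scalar_prod mult_mat_vec_carrier TT)
    also have "\<dots> = 0" using v assoc_mult_mat_vec[OF TT T v(1)] by simp
    finally have "T *\<^sub>v v = 0\<^sub>v n"
      using T v(1) by (intro scalar_prod_self_eq_zero) auto
    then show "v = 0\<^sub>v k" using assms v by (simp add: inj_mat_def)
  qed
  then obtain G where G: "G \<in> carrier_mat k k" "G * (T\<^sup>T * T) = 1\<^sub>m k" "(T\<^sup>T * T) * G = 1\<^sub>m k"
    by (rule inj_mat_square_inverse)
  show ?thesis
  proof (rule that)
    show "G * T\<^sup>T \<in> carrier_mat k n" using G TT by simp
    show "G * T\<^sup>T * T = 1\<^sub>m k" using G TT T by (simp add: assoc_mult_mat[of _ k k _ n _ k])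
    fix x :: "real vec" assume x: "x \<in> carrier_vec n"
    have "T\<^sup>T *\<^sub>v (T *\<^sub>v ((G * T\<^sup>T) *\<^sub>v x)) = (T\<^sup>T * T) *\<^sub>v (G *\<^sub>v (T\<^sup>T *\<^sub>v x))"
      using T TT G(1) x by (simp add: assoc_mult_mat_vec)
    also have "\<dots> = (T\<^sup>T * T * G) *\<^sub>v (T\<^sup>T *\<^sub>v x)"
      using assoc_mult_mat_vec[of "T\<^sup>T * T" k k G k "T\<^sup>T *\<^sub>v x"] T TT G(1) x by simp
    also have "\<dots> = T\<^sup>T *\<^sub>v x" using G(3) TT x by simp
    finally show "T\<^sup>T *\<^sub>v (x - T *\<^sub>v ((G * T\<^sup>T) *\<^sub>v x)) = 0\<^sub>v k"
      using T TT G(1) x by (subst mult_minus_distrib_mat_vec[of _ k n]) auto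
  qed
qed

definition add_col :: "real mat \<Rightarrow> nat \<Rightarrow> nat \<Rightarrow> real vec \<Rightarrow> real mat" where
  "add_col M n k x = mat n (Suc k) (\<lambda>(i,j). if j < k then M $$ (i,j) else x $ i)"

lemma add_col_carrier: "add_col M n k x \<in> carrier_mat n (Suc k)"
  by (simp add: add_col_def)

lemma add_col_mult:
  assumes "M \<in> carrier_mat n k" "x \<in> carrier_vec n" "v \<in> carrier_vec (Suc k)"
  shows "add_col M n k x *\<^sub>v v = M *\<^sub>v vec k (\<lambda>i. v $ i) + v $ k \<cdot>\<^sub>v x"
  using assms by (intro eq_vecI) (auto simp: add_col_def scalar_prod_def mult.commute)

lemma vec_Suc_eq_zero:
  assumes "v \<in> carrier_vec (Suc k)" "vec k (\<lambda>i. v $ i) = 0\<^sub>v k" "v $ k = (0::real)"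
  shows "v = 0\<^sub>v (Suc k)"
proof (rule eq_vecI)
  fix i assume "i < dim_vec (0\<^sub>v (Suc k) :: real vec)"
  then consider "i < k" | "i = k" by fastforce
  then show "v $ i = 0\<^sub>v (Suc k) $ i"
    using assms by cases (auto dest: arg_cong[where f="\<lambda>w. w $ i"])
qed (use assms in auto)

section \<open>Bases, defining equations and linear relations\<close>

lemma greatest_bounded_nat:
  assumes "P (k0::nat)" "\<And>k. P k \<Longrightarrow> k \<le> n"
  shows "\<exists>k. P k \<and> (\<forall>j. P j \<longrightarrow> j \<le> k)"
  using assms GreatestI_nat[of P k0 n] Greatest_le_nat[of P _ n] by blast

lemma inj_mat_empty: "inj_mat n 0 (0\<^sub>m n 0)"
  by (auto simp: inj_mat_def)

text \<open>A relation with nonzero last coefficient could be solved for \<open>x\<close> and would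
  put it into \<open>W\<close>. This is the step that contradicts maximality, here in
  \<open>vec_subspace_basis\<close> and later in \<open>steering_schedule\<close>.\<close>

lemma inj_mat_add_col_subspace:
  assumes W: "vec_subspace n W" and M: "inj_mat n k M" "\<And>v. v \<in> carrier_vec k \<Longrightarrow> M *\<^sub>v v \<in> W"
    and x: "x \<in> carrier_vec n" "x \<notin> W"
  shows "inj_mat n (Suc k) (add_col M n k x)"
  unfolding inj_mat_def
proof (intro conjI ballI impI add_col_carrier)
  fix v :: "real vec" assume v: "v \<in> carrier_vec (Suc k)" "add_col M n k x *\<^sub>v v = 0\<^sub>v n"
  let ?w = "vec k (\<lambda>i. v $ i)"
  have Mc: "M \<in> carrier_mat n k" using M by (simp add: inj_mat_def)
  have e: "M *\<^sub>v ?w + v $ k \<cdot>\<^sub>v x = 0\<^sub>v n" using add_col_mult[OF Mc x(1) v(1)] v(2) by simp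
  have k0: "v $ k = 0"
  proof (rule ccontr)
    assume c: "v $ k \<noteq> 0"
    have "x = (- 1 / v $ k) \<cdot>\<^sub>v (M *\<^sub>v ?w)"
    proof (rule eq_vecI)
      fix i assume "i < dim_vec ((- 1 / v $ k) \<cdot>\<^sub>v (M *\<^sub>v ?w))"
      then have i: "i < n" using Mc by simp
      have "(M *\<^sub>v ?w) $ i + v $ k * x $ i = 0"
        using arg_cong[OF e, of "\<lambda>u. u $ i"] i Mc x by simp
      then show "x $ i = ((- 1 / v $ k) \<cdot>\<^sub>v (M *\<^sub>v ?w)) $ i"
        using c i Mc by (simp add: field_simps)
    qed (use x Mc in auto)
    then show False using vec_subspace_smult[OF W M(2)[of ?w]] x(2) by simp
  qed
  have "M *\<^sub>v ?w = 0\<^sub>v n" using e k0 Mc x smult_one_plus_zero[of "M *\<^sub>v ?w" n x 1] by simp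
  then show "v = 0\<^sub>v (Suc k)" using M(1) k0 v(1) by (intro vec_Suc_eq_zero) (auto simp: inj_mat_def)
qed

text \<open>An injective matrix with columns in \<open>W\<close> and a maximal number of them spans
  \<open>W\<close>, since a missing vector could be added as a column. Its left inverse
  \<open>S\<close> gives the coordinates.\<close>

lemma vec_subspace_basis:
  assumes W: "vec_subspace n W"
  obtains k T S where "T \<in> carrier_mat n k" "S \<in> carrier_mat k n" "S * T = 1\<^sub>m k"
    "W = (\<lambda>v. T *\<^sub>v v) ` carrier_vec k" "k \<le> n" "W \<noteq> carrier_vec n \<Longrightarrow> k < n"
    "\<And>x. x \<in> carrier_vec n \<Longrightarrow> T\<^sup>T *\<^sub>v (x - T *\<^sub>v (S *\<^sub>v x)) = 0\<^sub>v k"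
proof -
  let ?P = "\<lambda>k. \<exists>M. inj_mat n k M \<and> (\<forall>v\<in>carrier_vec k. M *\<^sub>v v \<in> W)"
  have "?P 0"
    using inj_mat_empty[of n] vec_subspace_zero[OF W]
    by (intro exI[of _ "0\<^sub>m n 0"]) (auto simp: zero_mat_mult_vec)
  moreover have "k \<le> n" if "?P k" for k using that inj_mat_le by blast
  ultimately have "\<exists>k. ?P k \<and> (\<forall>j. ?P j \<longrightarrow> j \<le> k)" by (rule greatest_bounded_nat)
  then obtain k where k: "?P k" "\<And>j. ?P j \<Longrightarrow> j \<le> k" by blast
  then obtain T where T: "inj_mat n k T" "\<And>v. v \<in> carrier_vec k \<Longrightarrow> T *\<^sub>v v \<in> W" by blast
  have Tc: "T \<in> carrier_mat n k" using T by (simp add: inj_mat_def)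
  obtain S where S: "S \<in> carrier_mat k n" "S * T = 1\<^sub>m k"
    "\<And>x. x \<in> carrier_vec n \<Longrightarrow> T\<^sup>T *\<^sub>v (x - T *\<^sub>v (S *\<^sub>v x)) = 0\<^sub>v k"
    using inj_mat_left_inverse[OF T(1)] by metis
  let ?I = "(\<lambda>v. T *\<^sub>v v) ` carrier_vec k"
  have sub: "vec_subspace n ?I"
  proof (rule vec_subspaceI)
    show "0\<^sub>v n \<in> ?I" using Tc by (intro image_eqI[of _ _ "0\<^sub>v k"]) auto
    fix a b x y assume "x \<in> ?I" "y \<in> ?I"
    then obtain v w where "v \<in> carrier_vec k" "w \<in> carrier_vec k" "x = T *\<^sub>v v" "y = T *\<^sub>v w" by blast
    then show "a \<cdot>\<^sub>v x + b \<cdot>\<^sub>v y \<in> ?I"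
      using mult_mat_vec_lincomb[OF Tc, of v w a b]
      by (intro image_eqI[of _ _ "a \<cdot>\<^sub>v v + b \<cdot>\<^sub>v w"]) auto
  qed (use Tc in auto)
  have "x \<in> ?I" if x: "x \<in> W" for x
  proof (rule ccontr)
    assume nx: "x \<notin> ?I"
    have xc: "x \<in> carrier_vec n" using vec_subspace_carrier[OF W x] .
    have "inj_mat n (Suc k) (add_col T n k x)"
      by (rule inj_mat_add_col_subspace[OF sub T(1) _ xc nx]) auto
    moreover have "add_col T n k x *\<^sub>v v \<in> W" if "v \<in> carrier_vec (Suc k)" for v
      unfolding add_col_mult[OF Tc xc that]
      by (intro vec_subspace_add[OF W] vec_subspace_smult[OF W] T(2) x) auto
    ultimately have "Suc k \<le> k" using k(2) by blast
    then show False by simp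
  qed
  then have eq: "W = ?I" using T(2) by blast
  \<comment> \<open>With as many columns as rows the left inverse is two-sided and the columns span
    everything, so a proper subspace has \<open>k < n\<close>.\<close>
  have full: "W = carrier_vec n" if kn: "k = n"
  proof -
    have "T * S = 1\<^sub>m n" using mat_mult_left_right_inverse[OF _ _ S(2)] S(1) Tc kn by auto
    then have "x = T *\<^sub>v (S *\<^sub>v x)" if "x \<in> carrier_vec n" for x
      using assoc_mult_mat_vec[OF Tc S(1) that] that by simp
    then have "carrier_vec n \<subseteq> ?I" using S(1) by (auto intro!: image_eqI)
    then show ?thesis using eq Tc by auto
  qed
  show ?thesis
    by (rule that[OF Tc S(1,2) eq]) (use inj_mat_le[OF T(1)] full S(3) in auto)
qed

text \<open>The dual description, by equations instead of generators: the rows of \<open>Q\<close>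
  are a basis of the orthogonal complement of \<open>N\<close>. It serves as the quotient map by
  \<open>N\<close> and as a linear test for membership in \<open>N\<close>.\<close>

lemma vec_subspace_kernel:
  assumes N: "vec_subspace n N"
  obtains k Q R where "Q \<in> carrier_mat k n" "R \<in> carrier_mat n k" "Q * R = 1\<^sub>m k"
    "\<And>x. x \<in> carrier_vec n \<Longrightarrow> Q *\<^sub>v x = 0\<^sub>v k \<longleftrightarrow> x \<in> N" "N \<noteq> {0\<^sub>v n} \<Longrightarrow> k < n"
proof -
  obtain m T S where T: "T \<in> carrier_mat n m" and S: "S \<in> carrier_mat m n"
    and NT: "N = (\<lambda>v. T *\<^sub>v v) ` carrier_vec m"
    and orth: "\<And>x. x \<in> carrier_vec n \<Longrightarrow> T\<^sup>T *\<^sub>v (x - T *\<^sub>v (S *\<^sub>v x)) = 0\<^sub>v m"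
    using vec_subspace_basis[OF N] by metis
  define P where "P = {y \<in> carrier_vec n. T\<^sup>T *\<^sub>v y = 0\<^sub>v m}"
  have TTc: "T\<^sup>T \<in> carrier_mat m n" using T by simp
  have P: "vec_subspace n P"
    unfolding P_def
    using TTc mult_mat_vec_lincomb[OF TTc] by (intro vec_subspaceI) auto
  obtain k U V where U: "U \<in> carrier_mat n k" and V: "V \<in> carrier_mat k n"
    and VU: "V * U = 1\<^sub>m k" and PU: "P = (\<lambda>v. U *\<^sub>v v) ` carrier_vec k"
    and kn: "k \<le> n" "P \<noteq> carrier_vec n \<Longrightarrow> k < n"
    using vec_subspace_basis[OF P] by metis
  have UT: "U\<^sup>T \<in> carrier_mat k n" using U by simp
  have orthN: "y \<bullet> x = 0" if xN: "x \<in> N" and yP: "y \<in> P" for x y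
  proof -
    obtain v where v: "v \<in> carrier_vec m" "x = T *\<^sub>v v" using NT xN by blast
    have "(T\<^sup>T *\<^sub>v y) \<bullet> v = y \<bullet> (T *\<^sub>v v)"
      using transpose_vec_mult_scalar[OF T v(1), of y] yP by (simp add: P_def)
    then show ?thesis using yP v by (simp add: P_def)
  qed
  have ker: "U\<^sup>T *\<^sub>v x = 0\<^sub>v k \<longleftrightarrow> x \<in> N" if x: "x \<in> carrier_vec n" for x
  proof
    assume z: "U\<^sup>T *\<^sub>v x = 0\<^sub>v k"
    \<comment> \<open>\<open>?t\<close> is the orthogonal projection of \<open>x\<close> to
      \<open>N\<close>. The remainder lies in \<open>P\<close>; it is orthogonal to \<open>x\<close>
      by \<open>z\<close> and to \<open>?t\<close> by \<open>orthN\<close>, hence to itself.\<close>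
    let ?t = "T *\<^sub>v (S *\<^sub>v x)"
    have tN: "?t \<in> N" using NT S x by auto
    then have tc: "?t \<in> carrier_vec n" using vec_subspace_carrier[OF N] by blast
    have dO: "x - ?t \<in> P" using orth[OF x] x tc by (simp add: P_def)
    then obtain v where v: "v \<in> carrier_vec k" "x - ?t = U *\<^sub>v v" using PU by blast
    have "(x - ?t) \<bullet> x = (U *\<^sub>v v) \<bullet> x" using v by simp
    also have "\<dots> = x \<bullet> (U *\<^sub>v v)" using U v x by (intro comm_scalar_prod) auto
    also have "\<dots> = (U\<^sup>T *\<^sub>v x) \<bullet> v" using transpose_vec_mult_scalar[OF U v(1) x] by simp
    also have "\<dots> = 0" using z v by simp
    finally have "(x - ?t) \<bullet> x = 0" .
    moreover have "(x - ?t) \<bullet> ?t = 0" using orthN[OF tN dO] .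
    ultimately have "(x - ?t) \<bullet> (x - ?t) = 0"
      using x tc scalar_prod_minus_distrib[of "x - ?t" n x ?t] by simp
    then have d0: "x - ?t = 0\<^sub>v n"
      using x tc by (intro scalar_prod_self_eq_zero) auto
    have "x = ?t"
    proof (rule eq_vecI)
      fix i assume "i < dim_vec ?t"
      then have i: "i < n" using T by simp
      then have "(x - ?t) $ i = 0" using d0 by simp
      moreover have "(x - ?t) $ i = x $ i - ?t $ i" by (rule index_minus_vec(1)) (use i T in auto)
      ultimately show "x $ i = ?t $ i" by linarith
    qed (use x T in auto)
    then show "x \<in> N" using tN by simp
  next
    assume xN: "x \<in> N"
    show "U\<^sup>T *\<^sub>v x = 0\<^sub>v k"
    proof (rule eq_vecI)
      fix i assume "i < dim_vec (0\<^sub>v k :: real vec)"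
      then have i: "i < k" by simp
      have "U *\<^sub>v unit_vec k i \<in> P" using PU i by auto
      moreover have "U *\<^sub>v unit_vec k i = col U i" using U i by (intro eq_vecI) (auto simp: scalar_prod_right_unit)
      ultimately have "col U i \<in> P" by simp
      from orthN[OF xN this] show "(U\<^sup>T *\<^sub>v x) $ i = 0\<^sub>v k $ i" using i U by simp
    qed (use U in auto)
  qed
  show ?thesis
  proof (rule that[OF UT _ _ ker])
    show "V\<^sup>T \<in> carrier_mat n k" using V by simp
    show "U\<^sup>T * V\<^sup>T = 1\<^sub>m k" using transpose_mult[OF V U] VU by simp
    assume "N \<noteq> {0\<^sub>v n}"
    then obtain x where x: "x \<in> N" "x \<noteq> 0\<^sub>v n" using vec_subspace_zero[OF N] by blast
    have xc: "x \<in> carrier_vec n" using vec_subspace_carrier[OF N x(1)] .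
    have "x \<notin> P"
    proof
      assume "x \<in> P"
      then have "x \<bullet> x = 0" using orthN x by blast
      then have "x = 0\<^sub>v n" using xc by (intro scalar_prod_self_eq_zero) auto
      then show False using x by simp
    qed
    then show "k < n" using kn xc by blast
  qed
qed

text \<open>The relation need not be single-valued: values are chosen on the unit vectors only, and
  linearity of \<open>L\<close> carries the choice to all vectors. This matters when one initial
  state corresponds to several states of an unobservable realization.\<close>

lemma linear_relation_matrix:
  fixes L :: "(real vec \<times> real vec) set"
  assumes L: "L \<subseteq> carrier_vec n \<times> carrier_vec m"
    and zero: "(0\<^sub>v n, 0\<^sub>v m) \<in> L"
    and lin: "\<And>a b x y x' y'. (x, x') \<in> L \<Longrightarrow> (y, y') \<in> L \<Longrightarrow>
        (a \<cdot>\<^sub>v x + b \<cdot>\<^sub>v y, a \<cdot>\<^sub>v x' + b \<cdot>\<^sub>v y') \<in> L"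
    and tot: "\<And>x. x \<in> carrier_vec n \<Longrightarrow> \<exists>x'. (x, x') \<in> L"
  obtains M where "M \<in> carrier_mat m n" "\<And>x. x \<in> carrier_vec n \<Longrightarrow> (x, M *\<^sub>v x) \<in> L"
proof -
  obtain f where f: "\<And>x. x \<in> carrier_vec n \<Longrightarrow> (x, f x) \<in> L" using tot by metis
  define M where "M = mat m n (\<lambda>(i,j). f (unit_vec n j) $ i)"
  have M: "M \<in> carrier_mat m n" by (simp add: M_def)
  have "(x, M *\<^sub>v x) \<in> L" if x: "x \<in> carrier_vec n" for x
  proof -
    \<comment> \<open>The first \<open>k\<close> coordinates of \<open>x\<close>; each induction
      step adds one multiple of a unit vector.\<close>
    let ?c = "\<lambda>k. vec n (\<lambda>i. if i < k then x $ i else 0)"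
    have "(?c k, M *\<^sub>v ?c k) \<in> L" if "k \<le> n" for k
      using that
    proof (induction k)
      case 0
      have "?c 0 = 0\<^sub>v n" by auto
      then show ?case using zero mult_mat_zero_vec[OF M] by metis
    next
      case (Suc k)
      then have k: "k < n" "(?c k, M *\<^sub>v ?c k) \<in> L" by auto
      let ?e = "unit_vec n k :: real vec"
      have fe: "(?e, f ?e) \<in> L" using f by simp
      then have fc: "f ?e \<in> carrier_vec m" using L by auto
      have Me: "M *\<^sub>v ?e = f ?e"
        using k fc by (intro eq_vecI) (auto simp: M_def scalar_prod_right_unit)
      have c: "?c (Suc k) = 1 \<cdot>\<^sub>v ?c k + x $ k \<cdot>\<^sub>v ?e"
        using k by (intro eq_vecI) (auto simp: less_Suc_eq)
      have "M *\<^sub>v ?c (Suc k) = 1 \<cdot>\<^sub>v (M *\<^sub>v ?c k) + x $ k \<cdot>\<^sub>v f ?e"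
        unfolding c by (subst mult_mat_vec_lincomb[OF M]) (auto simp: Me)
      then show ?case using lin[OF k(2) fe, of 1 "x $ k"] c by simp
    qed
    from this[of n] have "(?c n, M *\<^sub>v ?c n) \<in> L" by simp
    moreover have "?c n = x" using x by (intro eq_vecI) auto
    ultimately show ?thesis by simp
  qed
  then show ?thesis using that M by blast
qed

section \<open>Time axes\<close>

abbreviation vec_span :: "nat \<Rightarrow> real vec set \<Rightarrow> real vec set" where
  "vec_span n \<equiv> LinearCombinations.module.span class_ring (module_vec TYPE(real) n)"

text \<open>The span is used below only as the least subspace containing \<open>S\<close>.\<close>

lemma vec_span:
  assumes "S \<subseteq> carrier_vec n"
  shows vec_subspace_span: "vec_subspace n (vec_span n S)"
    and subset_vec_span: "S \<subseteq> vec_span n S"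
    and vec_span_minimal: "vec_subspace n W \<Longrightarrow> S \<subseteq> W \<Longrightarrow> vec_span n S \<subseteq> W"
proof -
  interpret vec_space "TYPE(real)" n .
  have sm: "submodule class_ring (span S) V" using assms by (intro span_is_submodule) simp
  then show "vec_subspace n (span S)"
    by (intro vec_subspaceI) (auto simp: submodule_def module_vec_simps class_ring_simps)
  show "S \<subseteq> span S" using assms by (intro in_own_span) simp
  assume W: "vec_subspace n W" "S \<subseteq> W"
  have "submodule class_ring W V"
  proof
    show "W \<subseteq> carrier V" using W by (auto simp: vec_subspace_def)
  qed (use W in \<open>auto simp: module_vec_simps intro: vec_subspace_add vec_subspace_smult vec_subspace_zero\<close>)
  then show "span S \<subseteq> W" using W by (intro span_is_subset)
qed

lemma mat_eq_on_vecI: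
  fixes A B :: "real mat"
  assumes A: "A \<in> carrier_mat m n" and B: "B \<in> carrier_mat m n"
    and eq: "\<And>v. v \<in> carrier_vec n \<Longrightarrow> A *\<^sub>v v = B *\<^sub>v v"
  shows "A = B"
proof (rule eq_matI)
  fix i j assume "i < dim_row B" "j < dim_col B"
  then have ij: "i < m" "j < n" using B by auto
  have "(A *\<^sub>v unit_vec n j) $ i = (B *\<^sub>v unit_vec n j) $ i" using eq by simp
  then show "A $$ (i, j) = B $$ (i, j)" using A B ij by (simp add: scalar_prod_right_unit)
qed (use A B in auto)

section \<open>Affine matrix families and reduction of the state space\<close>

lemma affine_mat_carrier: "affine_mat r c n M p \<in> carrier_mat r c"
  by (simp add: affine_mat_def)

lemma Aof_carrier: "Aof \<Sigma> p \<in> carrier_mat (nx \<Sigma>) (nx \<Sigma>)"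
  and Bof_carrier: "Bof \<Sigma> p \<in> carrier_mat (nx \<Sigma>) (nu \<Sigma>)"
  and Cof_carrier: "Cof \<Sigma> p \<in> carrier_mat (ny \<Sigma>) (nx \<Sigma>)"
  and Dof_carrier: "Dof \<Sigma> p \<in> carrier_mat (ny \<Sigma>) (nu \<Sigma>)"
  by (simp_all add: Aof_def Bof_def Cof_def Dof_def affine_mat_carrier)

text \<open>Entries are linear in the coefficient matrices, so a constant factor moves through the
  sum over the scheduling parameters. This keeps a reduced system affine in them.\<close>

lemma affine_mat_mult_left:
  assumes L: "L \<in> carrier_mat k r" and M: "\<And>i. i \<le> n \<Longrightarrow> M i \<in> carrier_mat r c"
  shows "affine_mat k c n (\<lambda>i. L * M i) p = L * affine_mat r c n M p"
proof (rule eq_matI)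
  fix i j assume "i < dim_row (L * affine_mat r c n M p)" "j < dim_col (L * affine_mat r c n M p)"
  then have ij: "i < k" "j < c" using L by (auto simp: affine_mat_def)
  have entry: "(L * M m) $$ (i, j) = (\<Sum>l<r. L $$ (i, l) * M m $$ (l, j))" if "m \<le> n" for m
    using ij L M[OF that] by (auto simp: scalar_prod_def lessThan_atLeast0 intro!: sum.cong)
  have "affine_mat k c n (\<lambda>i. L * M i) p $$ (i, j) =
      (L * M 0) $$ (i, j) + (\<Sum>m=1..n. p $ (m - 1) * (L * M m) $$ (i, j))"
    using ij by (simp add: affine_mat_def)
  also have "\<dots> = (\<Sum>l<r. L $$ (i, l) * M 0 $$ (l, j)) +
      (\<Sum>m=1..n. p $ (m - 1) * (\<Sum>l<r. L $$ (i, l) * M m $$ (l, j)))"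
    by (simp add: entry)
  also have "(\<Sum>m=1..n. p $ (m - 1) * (\<Sum>l<r. L $$ (i, l) * M m $$ (l, j))) =
      (\<Sum>l<r. \<Sum>m=1..n. L $$ (i, l) * (p $ (m - 1) * M m $$ (l, j)))"
    by (subst sum.swap) (simp add: sum_distrib_left mult.left_commute)
  also have "(\<Sum>l<r. L $$ (i, l) * M 0 $$ (l, j)) + \<dots> = (\<Sum>l<r. L $$ (i, l) * affine_mat r c n M p $$ (l, j))"
    using ij by (simp add: affine_mat_def sum.distrib distrib_left sum_distrib_left)
  also have "\<dots> = (L * affine_mat r c n M p) $$ (i, j)"
    using ij L by (auto simp: affine_mat_def scalar_prod_def lessThan_atLeast0 intro!: sum.cong)
  finally show "affine_mat k c n (\<lambda>i. L * M i) p $$ (i, j) = (L * affine_mat r c n M p) $$ (i, j)" .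
qed (use L in \<open>auto simp: affine_mat_def\<close>)

lemma affine_mat_mult_right:
  assumes R: "R \<in> carrier_mat c k" and M: "\<And>i. i \<le> n \<Longrightarrow> M i \<in> carrier_mat r c"
  shows "affine_mat r k n (\<lambda>i. M i * R) p = affine_mat r c n M p * R"
proof (rule eq_matI)
  fix i j assume "i < dim_row (affine_mat r c n M p * R)" "j < dim_col (affine_mat r c n M p * R)"
  then have ij: "i < r" "j < k" using R by (auto simp: affine_mat_def)
  have entry: "(M m * R) $$ (i, j) = (\<Sum>l<c. M m $$ (i, l) * R $$ (l, j))" if "m \<le> n" for m
    using ij R M[OF that] by (auto simp: scalar_prod_def lessThan_atLeast0 intro!: sum.cong)
  have "affine_mat r k n (\<lambda>i. M i * R) p $$ (i, j) =
      (M 0 * R) $$ (i, j) + (\<Sum>m=1..n. p $ (m - 1) * (M m * R) $$ (i, j))"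
    using ij by (simp add: affine_mat_def)
  also have "\<dots> = (\<Sum>l<c. M 0 $$ (i, l) * R $$ (l, j)) +
      (\<Sum>m=1..n. p $ (m - 1) * (\<Sum>l<c. M m $$ (i, l) * R $$ (l, j)))"
    by (simp add: entry)
  also have "(\<Sum>m=1..n. p $ (m - 1) * (\<Sum>l<c. M m $$ (i, l) * R $$ (l, j))) =
      (\<Sum>l<c. \<Sum>m=1..n. p $ (m - 1) * M m $$ (i, l) * R $$ (l, j))"
    by (subst sum.swap) (simp add: sum_distrib_left mult.assoc)
  also have "(\<Sum>l<c. M 0 $$ (i, l) * R $$ (l, j)) + \<dots> = (\<Sum>l<c. affine_mat r c n M p $$ (i, l) * R $$ (l, j))"
    using ij by (simp add: affine_mat_def sum.distrib distrib_right sum_distrib_right)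
  also have "\<dots> = (affine_mat r c n M p * R) $$ (i, j)"
    using ij R by (auto simp: affine_mat_def scalar_prod_def lessThan_atLeast0 intro!: sum.cong)
  finally show "affine_mat r k n (\<lambda>i. M i * R) p $$ (i, j) = (affine_mat r c n M p * R) $$ (i, j)" .
qed (use R in \<open>auto simp: affine_mat_def\<close>)

text \<open>\<open>L\<close> maps old states to new ones and \<open>R\<close> goes back;
  \<open>L * R\<close> is the identity in both uses. If \<open>L\<close> has kernel
  \<open>unobs\<close>, this is the quotient by \<open>unobs\<close>; if the image of
  \<open>R\<close> is the span of \<open>reachable\<close>, it is the restriction to that
  span.\<close>

definition compress :: "nat \<Rightarrow> real mat \<Rightarrow> real mat \<Rightarrow> lpv_ssa \<Rightarrow> lpv_ssa" where
  "compress k L R \<Sigma> = \<Sigma>\<lparr>nx := k, Amat := \<lambda>i. L * Amat \<Sigma> i * R, Bmat := \<lambda>i. L * Bmat \<Sigma> i,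
     Cmat := \<lambda>i. Cmat \<Sigma> i * R\<rparr>"

lemma compress_sel [simp]:
  "nx (compress k L R \<Sigma>) = k" "nu (compress k L R \<Sigma>) = nu \<Sigma>" "ny (compress k L R \<Sigma>) = ny \<Sigma>"
  "np (compress k L R \<Sigma>) = np \<Sigma>" "sched (compress k L R \<Sigma>) = sched \<Sigma>"
  by (simp_all add: compress_def)

lemma
  assumes \<Sigma>: "is_lpv_ssa \<Sigma>" and L: "L \<in> carrier_mat k (nx \<Sigma>)" and R: "R \<in> carrier_mat (nx \<Sigma>) k"
  shows is_lpv_ssa_compress: "is_lpv_ssa (compress k L R \<Sigma>)"
    and Aof_compress: "Aof (compress k L R \<Sigma>) p = L * Aof \<Sigma> p * R"
    and Bof_compress: "Bof (compress k L R \<Sigma>) p = L * Bof \<Sigma> p"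
    and Cof_compress: "Cof (compress k L R \<Sigma>) p = Cof \<Sigma> p * R"
    and Dof_compress: "Dof (compress k L R \<Sigma>) p = Dof \<Sigma> p"
proof -
  have c: "Amat \<Sigma> i \<in> carrier_mat (nx \<Sigma>) (nx \<Sigma>)" "Bmat \<Sigma> i \<in> carrier_mat (nx \<Sigma>) (nu \<Sigma>)"
    "Cmat \<Sigma> i \<in> carrier_mat (ny \<Sigma>) (nx \<Sigma>)" "Dmat \<Sigma> i \<in> carrier_mat (ny \<Sigma>) (nu \<Sigma>)"
    if "i \<le> np \<Sigma>" for i using \<Sigma> that by (auto simp: is_lpv_ssa_def)
  have LA: "L * Amat \<Sigma> i \<in> carrier_mat k (nx \<Sigma>)" if "i \<le> np \<Sigma>" for i
    using c[OF that] L by simp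
  show "is_lpv_ssa (compress k L R \<Sigma>)"
    using \<Sigma> c LA L R mult_carrier_mat[OF c(3) R] by (auto simp: is_lpv_ssa_def compress_def)
  show "Aof (compress k L R \<Sigma>) p = L * Aof \<Sigma> p * R"
    using affine_mat_mult_right[OF R LA, of "np \<Sigma>" "\<lambda>i. i" p]
      affine_mat_mult_left[OF L c(1), of "np \<Sigma>" "\<lambda>i. i" p]
    by (simp add: Aof_def compress_def)
  show "Bof (compress k L R \<Sigma>) p = L * Bof \<Sigma> p"
    using affine_mat_mult_left[OF L c(2), of "np \<Sigma>" "\<lambda>i. i" p] by (simp add: Bof_def compress_def)
  show "Cof (compress k L R \<Sigma>) p = Cof \<Sigma> p * R"
    using affine_mat_mult_right[OF R c(3), of "np \<Sigma>" "\<lambda>i. i" p] by (simp add: Cof_def compress_def)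
  show "Dof (compress k L R \<Sigma>) p = Dof \<Sigma> p" by (simp add: Dof_def compress_def)
qed

section \<open>Operations on signals over either time axis\<close>

abbreviation ext :: "('t::linordered_semidom \<Rightarrow> 'a) \<Rightarrow> 't \<Rightarrow> 'a" where
  "ext f \<equiv> restrict f {0..}"

definition const_signal :: "'a \<Rightarrow> 't::linordered_semidom \<Rightarrow> 'a" where
  "const_signal v = ext (\<lambda>_. v)"

definition shift :: "'t::linordered_semidom \<Rightarrow> ('t \<Rightarrow> 'a) \<Rightarrow> 't \<Rightarrow> 'a" where
  "shift s f = ext (\<lambda>t. f (t + s))"

text \<open>The switching instant belongs to the second piece, so in discrete time exactly the
  \<open>s\<close> samples before it come from the first. For states the pieces have to match in the
  sense \<open>g 0 = f s\<close>.\<close>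

definition concat_at :: "'t::linordered_semidom \<Rightarrow> ('t \<Rightarrow> 'a) \<Rightarrow> ('t \<Rightarrow> 'a) \<Rightarrow> 't \<Rightarrow> 'a" where
  "concat_at s f g = ext (\<lambda>t. if t < s then f t else g (t - s))"

definition lincomb_signal :: "real \<Rightarrow> ('t::linordered_semidom \<Rightarrow> real vec) \<Rightarrow> real \<Rightarrow> ('t \<Rightarrow> real vec) \<Rightarrow>
    't \<Rightarrow> real vec" where
  "lincomb_signal a f b g = ext (\<lambda>t. a \<cdot>\<^sub>v f t + b \<cdot>\<^sub>v g t)"

lemma const_signal_apply [simp]: "t \<ge> 0 \<Longrightarrow> const_signal v t = v"
  by (simp add: const_signal_def)

lemma shift_apply: "t \<ge> 0 \<Longrightarrow> shift s f t = f (t + s)"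
  by (simp add: shift_def)

lemma lincomb_signal_apply: "t \<ge> 0 \<Longrightarrow> lincomb_signal a f b g t = a \<cdot>\<^sub>v f t + b \<cdot>\<^sub>v g t"
  by (simp add: lincomb_signal_def)

lemma semidom_diff_nonneg: "(s::'t::linordered_semidom) \<le> t \<Longrightarrow> 0 \<le> t - s"
  by (metis add_le_cancel_left add.right_neutral le_add_diff_inverse)

lemma concat_at_less: "0 \<le> t \<Longrightarrow> t < s \<Longrightarrow> concat_at s f g t = f t"
  by (simp add: concat_at_def)

lemma concat_at_ge: "0 \<le> s \<Longrightarrow> s \<le> t \<Longrightarrow> concat_at s f g t = g (t - s)"
  by (auto simp: concat_at_def)

lemma concat_at_add: "0 \<le> s \<Longrightarrow> 0 \<le> t \<Longrightarrow> concat_at s f g (s + t) = g t"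
  by (simp add: concat_at_ge)

lemma concat_at_const: "0 \<le> s \<Longrightarrow> concat_at s (const_signal v) (const_signal v) = const_signal v"
  by (auto simp: concat_at_def const_signal_def fun_eq_iff semidom_diff_nonneg)

lemma concat_at_init:
  assumes "0 \<le> s" "g 0 = f s" shows "concat_at s f g 0 = f 0"
  using assms by (cases "s = 0") (auto simp: concat_at_def)

text \<open>The first piece has to agree with \<open>f'\<close> only before \<open>s\<close>. In
  this way \<open>sol_causal\<close> exchanges the past of a signal without changing the
  signal.\<close>

lemma concat_at_shift:
  assumes "0 \<le> s" "ext f' = f'" "\<And>t. 0 \<le> t \<Longrightarrow> t < s \<Longrightarrow> f t = f' t"
  shows "concat_at s f (shift s f') = f'"
proof
  fix t
  show "concat_at s f (shift s f') t = f' t"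
  proof (cases "0 \<le> t")
    case True
    then show ?thesis
      using assms(1,3) by (auto simp: concat_at_def shift_def semidom_diff_nonneg not_less)
  next
    case False
    then have "f' t = undefined" using assms(2) by (metis atLeast_iff restrict_apply)
    then show ?thesis using False by (simp add: concat_at_def)
  qed
qed

lemma lincomb_signal_const_zero:
  "lincomb_signal a (const_signal (0\<^sub>v m)) b (const_signal (0\<^sub>v m)) = const_signal (0\<^sub>v m)"
  by (auto simp: lincomb_signal_def const_signal_def fun_eq_iff)

text \<open>
  \<open>F\<close> is the filter of the sets containing almost all times: the almost-everywhere filter of
  Lebesgue measure in continuous time, the top filter in discrete time.
\<close>

locale lpv_axis =
  fixes sols :: "'t::linordered_semidom solution_map"
    and F :: "'t filter"
    and sig :: "nat \<Rightarrow> real vec set \<Rightarrow> 't signal set"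
    and RC :: "lpv_ssa \<Rightarrow> bool"
  assumes sol_signals: "is_lpv_ssa \<Sigma> \<Longrightarrow> (x, y, u, p) \<in> sols \<Sigma> \<Longrightarrow>
        y \<in> sig (ny \<Sigma>) (carrier_vec (ny \<Sigma>)) \<and> u \<in> sig (nu \<Sigma>) (carrier_vec (nu \<Sigma>)) \<and>
        p \<in> sig (np \<Sigma>) (sched \<Sigma>) \<and> (\<forall>t\<ge>0. x t \<in> carrier_vec (nx \<Sigma>))"
    and sig_ext: "w \<in> sig n V \<Longrightarrow> ext w = w"
    and sig_value: "w \<in> sig n V \<Longrightarrow> t \<ge> 0 \<Longrightarrow> w t \<in> V"
    and sig_const: "v \<in> V \<Longrightarrow> const_signal v \<in> sig n V"
    and sig_concat: "w \<in> sig n V \<Longrightarrow> w' \<in> sig n V \<Longrightarrow> s \<ge> 0 \<Longrightarrow> concat_at s w w' \<in> sig n V"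
    and sol_exists: "is_lpv_ssa \<Sigma> \<Longrightarrow> u \<in> sig (nu \<Sigma>) (carrier_vec (nu \<Sigma>)) \<Longrightarrow>
        p \<in> sig (np \<Sigma>) (sched \<Sigma>) \<Longrightarrow> x0 \<in> carrier_vec (nx \<Sigma>) \<Longrightarrow>
        \<exists>x y. (x, y, u, p) \<in> sols \<Sigma> \<and> x 0 = x0"
    and sol_unique: "is_lpv_ssa \<Sigma> \<Longrightarrow> (x, y, u, p) \<in> sols \<Sigma> \<Longrightarrow> (x', y', u, p) \<in> sols \<Sigma> \<Longrightarrow>
        x 0 = x' 0 \<Longrightarrow> x = x' \<and> (\<forall>\<^sub>F t in F. t \<ge> 0 \<longrightarrow> y t = y' t)"
    and sol_output_cong: "is_lpv_ssa \<Sigma> \<Longrightarrow> (x, y, u, p) \<in> sols \<Sigma> \<Longrightarrow>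
        y' \<in> sig (ny \<Sigma>) (carrier_vec (ny \<Sigma>)) \<Longrightarrow> \<forall>\<^sub>F t in F. t \<ge> 0 \<longrightarrow> y' t = y t \<Longrightarrow>
        (x, y', u, p) \<in> sols \<Sigma>"
    and sol_lincomb: "is_lpv_ssa \<Sigma> \<Longrightarrow> (x, y, u, p) \<in> sols \<Sigma> \<Longrightarrow> (x', y', u', p) \<in> sols \<Sigma> \<Longrightarrow>
        (lincomb_signal a x b x', lincomb_signal a y b y', lincomb_signal a u b u', p) \<in> sols \<Sigma>"
    and sol_shift: "is_lpv_ssa \<Sigma> \<Longrightarrow> (x, y, u, p) \<in> sols \<Sigma> \<Longrightarrow> s \<ge> 0 \<Longrightarrow>
        (shift s x, shift s y, shift s u, shift s p) \<in> sols \<Sigma>"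
    and sol_concat: "is_lpv_ssa \<Sigma> \<Longrightarrow> (x, y, u, p) \<in> sols \<Sigma> \<Longrightarrow> (x', y', u', p') \<in> sols \<Sigma> \<Longrightarrow>
        s \<ge> 0 \<Longrightarrow> x' 0 = x s \<Longrightarrow>
        (concat_at s x x', concat_at s y y', concat_at s u u', concat_at s p p') \<in> sols \<Sigma>"
    and sol_intertwine: "is_lpv_ssa \<Sigma> \<Longrightarrow> is_lpv_ssa \<Sigma>' \<Longrightarrow> nu \<Sigma>' = nu \<Sigma> \<Longrightarrow> ny \<Sigma>' = ny \<Sigma> \<Longrightarrow>
        np \<Sigma>' = np \<Sigma> \<Longrightarrow> sched \<Sigma>' = sched \<Sigma> \<Longrightarrow> T \<in> carrier_mat (nx \<Sigma>') (nx \<Sigma>) \<Longrightarrow>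
        (\<And>q. q \<in> sched \<Sigma> \<Longrightarrow> Aof \<Sigma>' q * T = T * Aof \<Sigma> q \<and> Bof \<Sigma>' q = T * Bof \<Sigma> q \<and>
           Cof \<Sigma>' q * T = Cof \<Sigma> q \<and> Dof \<Sigma>' q = Dof \<Sigma> q) \<Longrightarrow>
        (x, y, u, p) \<in> sols \<Sigma> \<Longrightarrow> (ext (\<lambda>t. T *\<^sub>v x t), y, u, p) \<in> sols \<Sigma>'"
    and sol_backward: "is_lpv_ssa \<Sigma> \<Longrightarrow> RC \<Sigma> \<Longrightarrow> (x, y, u, p) \<in> sols \<Sigma> \<Longrightarrow>
        (x', y', u, p) \<in> sols \<Sigma> \<Longrightarrow> s \<ge> 0 \<Longrightarrow> x s = x' s \<Longrightarrow> x 0 = x' 0"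
    and sol_const_generator: "is_lpv_ssa \<Sigma> \<Longrightarrow> vec_subspace (nx \<Sigma>) W \<Longrightarrow>
        (x, y, const_signal v, const_signal q) \<in> sols \<Sigma> \<Longrightarrow> (\<And>t. t \<ge> 0 \<Longrightarrow> x t \<in> W) \<Longrightarrow>
        Aof \<Sigma> q *\<^sub>v x 0 + Bof \<Sigma> q *\<^sub>v v \<in> W"
    and sol_const_output: "is_lpv_ssa \<Sigma> \<Longrightarrow>
        (x, y, const_signal (0\<^sub>v (nu \<Sigma>)), const_signal q) \<in> sols \<Sigma> \<Longrightarrow>
        \<forall>\<^sub>F t in F. t \<ge> 0 \<longrightarrow> y t = 0\<^sub>v (ny \<Sigma>) \<Longrightarrow> Cof \<Sigma> q *\<^sub>v x 0 = 0\<^sub>v (ny \<Sigma>)"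
    and RC_sched: "RC \<Sigma> \<Longrightarrow> sched \<Sigma> \<noteq> {}"
    and F_shift: "s \<ge> 0 \<Longrightarrow> \<forall>\<^sub>F t in F. t \<ge> s \<longrightarrow> P (t - s) \<Longrightarrow> \<forall>\<^sub>F t in F. t \<ge> 0 \<longrightarrow> P t"
    and F_exhaust: "(\<And>s. \<forall>\<^sub>F t in F. 0 \<le> t \<and> t < s \<longrightarrow> P t) \<Longrightarrow> \<forall>\<^sub>F t in F. t \<ge> 0 \<longrightarrow> P t"

section \<open>Observability\<close>

lemma zero_lincomb: "(x :: real vec) \<in> carrier_vec m \<Longrightarrow> 0 \<cdot>\<^sub>v x + 0 \<cdot>\<^sub>v x = 0\<^sub>v m"
  by (rule eq_vecI) auto

lemma add_smult_zero_vec: "(x :: real vec) \<in> carrier_vec m \<Longrightarrow> x + c \<cdot>\<^sub>v 0\<^sub>v m = x"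
  by (rule eq_vecI) auto

lemma add_minus_cancel_vec:
  "(x :: real vec) \<in> carrier_vec m \<Longrightarrow> y \<in> carrier_vec m \<Longrightarrow> (x + y) - y = x"
  by (rule eq_vecI) auto

locale lpv_axis_system = lpv_axis sols F sig RC
  for sols :: "'t::linordered_semidom solution_map" and F sig RC +
  fixes \<Sigma> :: lpv_ssa
  assumes lpv: "is_lpv_ssa \<Sigma>"
begin

abbreviation "n \<equiv> nx \<Sigma>"
abbreviation "sol x y u p \<equiv> (x, y, u, p) \<in> sols \<Sigma>"
abbreviation "inputs \<equiv> sig (nu \<Sigma>) (carrier_vec (nu \<Sigma>))"
abbreviation "schedules \<equiv> sig (np \<Sigma>) (sched \<Sigma>)"
abbreviation "no_input \<equiv> const_signal (0\<^sub>v (nu \<Sigma>))"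

lemma no_input: "no_input \<in> inputs"
  by (rule sig_const) simp

lemma sol_state: "sol x y u p \<Longrightarrow> t \<ge> 0 \<Longrightarrow> x t \<in> carrier_vec n"
  using sol_signals[OF lpv] by blast

lemma sol_sched: "sol x y u p \<Longrightarrow> p \<in> schedules"
  using sol_signals[OF lpv] by blast

lemma sol_input: "sol x y u p \<Longrightarrow> u \<in> inputs"
  using sol_signals[OF lpv] by blast

lemma sol_output: "sol x y u p \<Longrightarrow> y \<in> sig (ny \<Sigma>) (carrier_vec (ny \<Sigma>))"
  using sol_signals[OF lpv] by blast

lemma sol_output_value: "sol x y u p \<Longrightarrow> t \<ge> 0 \<Longrightarrow> y t \<in> carrier_vec (ny \<Sigma>)"
  using sol_output sig_value by blast

lemma free_sol:
  assumes "p \<in> schedules" "x0 \<in> carrier_vec n"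
  obtains x y where "sol x y no_input p" "x 0 = x0"
  using sol_exists[OF lpv no_input assms] by blast

lemma free_sol_lincomb:
  "sol x y no_input p \<Longrightarrow> sol x' y' no_input p \<Longrightarrow>
    sol (lincomb_signal a x b x') (lincomb_signal a y b y') no_input p"
  using sol_lincomb[OF lpv, of x y no_input p x' y' no_input a b] by (simp add: lincomb_signal_const_zero)

text \<open>Any unforced solution, scaled by 0, provides the zero trajectory with an output that
  vanishes at every time and not just almost everywhere.\<close>

lemma zero_sol:
  assumes "p \<in> schedules"
  shows "sol (const_signal (0\<^sub>v n)) (const_signal (0\<^sub>v (ny \<Sigma>))) no_input p"
proof -
  obtain x y where xy: "sol x y no_input p" using free_sol[OF assms zero_carrier_vec] by blast
  have *: "lincomb_signal 0 f 0 f = const_signal (0\<^sub>v m)"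
    if "\<And>t. t \<ge> 0 \<Longrightarrow> f t \<in> carrier_vec m" for f :: "'t \<Rightarrow> real vec" and m
    using that by (auto simp: lincomb_signal_def const_signal_def fun_eq_iff zero_lincomb)
  have "lincomb_signal 0 x 0 x = const_signal (0\<^sub>v n)" by (rule *[OF sol_state[OF xy]])
  moreover have "lincomb_signal 0 y 0 y = const_signal (0\<^sub>v (ny \<Sigma>))" by (rule *[OF sol_output_value[OF xy]])
  ultimately show ?thesis using free_sol_lincomb[OF xy xy, of 0 0] by simp
qed

lemma backward_zero:
  assumes "RC \<Sigma>" "sol x y no_input p" "s \<ge> 0" "x s = 0\<^sub>v n"
  shows "x 0 = 0\<^sub>v n"
  using sol_backward[OF lpv assms(1,2) zero_sol assms(3)] assms sol_sched by simp

text \<open>Restarting the second solution at time \<open>s\<close> with the state of the first one reproduces it.\<close>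

lemma sol_causal:
  assumes s1: "sol x y u p" and s2: "sol x' y' u' p'" and x0: "x 0 = x' 0" and s: "s \<ge> 0"
    and eq: "\<And>t. 0 \<le> t \<Longrightarrow> t < s \<Longrightarrow> u t = u' t \<and> p t = p' t"
  shows "\<forall>\<^sub>F t in F. 0 \<le> t \<and> t < s \<longrightarrow> y t = y' t"
proof -
  have sh: "sol (shift s x') (shift s y') (shift s u') (shift s p')" by (rule sol_shift[OF lpv s2 s])
  obtain w v where w: "sol w v (shift s u') (shift s p')" "w 0 = x s"
    using sol_exists[OF lpv sol_input[OF sh] sol_sched[OF sh] sol_state[OF s1 s]] by blast
  have u: "concat_at s u (shift s u') = u'" and p: "concat_at s p (shift s p') = p'"
    using eq s sig_ext[OF sol_input[OF s2]] sig_ext[OF sol_sched[OF s2]] by (auto intro!: concat_at_shift)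
  have c: "sol (concat_at s x w) (concat_at s y v) u' p'"
    using sol_concat[OF lpv s1 w(1) s w(2)] u p by simp
  have "concat_at s x w 0 = x' 0" using concat_at_init[OF s, of w x] w(2) x0 by simp
  then have "\<forall>\<^sub>F t in F. t \<ge> 0 \<longrightarrow> concat_at s y v t = y' t"
    using sol_unique[OF lpv c s2] by simp
  then show ?thesis by (rule eventually_mono) (auto simp: concat_at_less)
qed

text \<open>The window is half-open, so that windows of lengths \<open>s\<close> and
  \<open>r\<close> fit together under concatenation without overlap, and \<open>s = 0\<close>
  imposes no condition on the output.\<close>

definition unobs_under :: "'t signal \<Rightarrow> 't \<Rightarrow> real vec set" where
  "unobs_under p s = {x0. \<exists>x y. sol x y no_input p \<and> x 0 = x0 \<and>
     (\<forall>\<^sub>F t in F. 0 \<le> t \<and> t < s \<longrightarrow> y t = 0\<^sub>v (ny \<Sigma>))}"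

text \<open>By uniqueness the solution that witnesses membership speaks for every other one from the
  same state.\<close>

lemma unobs_underD:
  assumes "sol x y no_input p" "x 0 \<in> unobs_under p s"
  shows "\<forall>\<^sub>F t in F. 0 \<le> t \<and> t < s \<longrightarrow> y t = 0\<^sub>v (ny \<Sigma>)"
proof -
  obtain x' y' where *: "sol x' y' no_input p" "x' 0 = x 0"
    "\<forall>\<^sub>F t in F. 0 \<le> t \<and> t < s \<longrightarrow> y' t = 0\<^sub>v (ny \<Sigma>)"
    using assms(2) by (auto simp: unobs_under_def)
  have "\<forall>\<^sub>F t in F. t \<ge> 0 \<longrightarrow> y t = y' t"
    using sol_unique[OF lpv assms(1) *(1)] *(2) by simp
  with *(3) show ?thesis by eventually_elim auto
qed

lemma unobs_under_subspace:
  assumes p: "p \<in> schedules" shows "vec_subspace n (unobs_under p s)"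
proof (rule vec_subspaceI)
  show "unobs_under p s \<subseteq> carrier_vec n" using sol_state by (auto simp: unobs_under_def)
  show "0\<^sub>v n \<in> unobs_under p s"
    unfolding unobs_under_def using zero_sol[OF p]
    by (intro CollectI exI[of _ "const_signal (0\<^sub>v n)"] exI[of _ "const_signal (0\<^sub>v (ny \<Sigma>))"]) simp
  fix a b x0 x0' assume "x0 \<in> unobs_under p s" "x0' \<in> unobs_under p s"
  then obtain x y x' y' where *: "sol x y no_input p" "x 0 = x0" "sol x' y' no_input p" "x' 0 = x0'"
    "\<forall>\<^sub>F t in F. 0 \<le> t \<and> t < s \<longrightarrow> y t = 0\<^sub>v (ny \<Sigma>)"
    "\<forall>\<^sub>F t in F. 0 \<le> t \<and> t < s \<longrightarrow> y' t = 0\<^sub>v (ny \<Sigma>)"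
    by (auto simp: unobs_under_def)
  have "\<forall>\<^sub>F t in F. 0 \<le> t \<and> t < s \<longrightarrow> lincomb_signal a y b y' t = 0\<^sub>v (ny \<Sigma>)"
    using *(5,6) by eventually_elim (auto simp: lincomb_signal_apply)
  then show "a \<cdot>\<^sub>v x0 + b \<cdot>\<^sub>v x0' \<in> unobs_under p s"
    unfolding unobs_under_def using free_sol_lincomb[OF *(1,3), of a b] *(2,4)
    by (intro CollectI exI[of _ "lincomb_signal a x b x'"] exI[of _ "lincomb_signal a y b y'"])
      (simp add: lincomb_signal_apply)
qed

text \<open>An output that vanishes on the joint window vanishes on both pieces, and the second
  piece is the output of the solution restarted in \<open>x s\<close>. So prolonging a schedule
  shrinks its unobservable subspace, and the transport carries the smaller subspace into that of the
  continuation.\<close>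

lemma unobs_under_concat:
  assumes p: "p \<in> schedules" and q: "q \<in> schedules" and s: "s \<ge> 0" and r: "r \<ge> 0"
    and x: "sol x y no_input p" "x 0 \<in> unobs_under (concat_at s p q) (s + r)"
  shows "x 0 \<in> unobs_under p s" "x s \<in> unobs_under q r"
proof -
  obtain w v where w: "sol w v no_input q" "w 0 = x s"
    using free_sol[OF q sol_state[OF x(1) s]] by blast
  have c: "sol (concat_at s x w) (concat_at s y v) no_input (concat_at s p q)"
    using sol_concat[OF lpv x(1) w(1) s w(2)] by (simp add: concat_at_const[OF s])
  have "concat_at s x w 0 = x 0" using concat_at_init[OF s, of w x] w(2) by simp
  then have z: "\<forall>\<^sub>F t in F. 0 \<le> t \<and> t < s + r \<longrightarrow> concat_at s y v t = 0\<^sub>v (ny \<Sigma>)"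
    using unobs_underD[OF c] x(2) by simp
  have "\<forall>\<^sub>F t in F. 0 \<le> t \<and> t < s \<longrightarrow> y t = 0\<^sub>v (ny \<Sigma>)"
    using z
  proof (rule eventually_mono, intro impI)
    fix t assume h: "0 \<le> t \<and> t < s + r \<longrightarrow> concat_at s y v t = 0\<^sub>v (ny \<Sigma>)" and t: "0 \<le> t \<and> t < s"
    have "t < s + r" using t r by (metis add.right_neutral add_less_le_mono)
    then show "y t = 0\<^sub>v (ny \<Sigma>)" using h t by (simp add: concat_at_less)
  qed
  then show "x 0 \<in> unobs_under p s" unfolding unobs_under_def using x(1) by blast
  have "\<forall>\<^sub>F t in F. t \<ge> s \<longrightarrow> (t - s < r \<longrightarrow> v (t - s) = 0\<^sub>v (ny \<Sigma>))"
    using z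
  proof (rule eventually_mono, intro impI)
    fix t assume h: "0 \<le> t \<and> t < s + r \<longrightarrow> concat_at s y v t = 0\<^sub>v (ny \<Sigma>)" and t: "s \<le> t" "t - s < r"
    have "t = s + (t - s)" using t by simp
    then have "t < s + r" using t(2) by (metis add_strict_left_mono)
    moreover have "0 \<le> t" using s t by simp
    ultimately show "v (t - s) = 0\<^sub>v (ny \<Sigma>)" using h t s by (simp add: concat_at_ge)
  qed
  from F_shift[OF s this] have "\<forall>\<^sub>F t in F. 0 \<le> t \<and> t < r \<longrightarrow> v t = 0\<^sub>v (ny \<Sigma>)"
    by (rule eventually_mono) auto
  then show "x s \<in> unobs_under q r" unfolding unobs_under_def using w by blast
qed

definition unobs :: "real vec set" where
  "unobs = {x0 \<in> carrier_vec n. \<forall>q\<in>schedules. \<forall>s\<ge>0. x0 \<in> unobs_under q s}"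

lemma unobs_subspace: "vec_subspace n unobs"
  using vec_subspace_zero[OF unobs_under_subspace] vec_subspace_lincomb[OF unobs_under_subspace]
    vec_subspace_carrier[OF unobs_under_subspace]
  by (intro vec_subspaceI) (auto simp: unobs_def)

text \<open>\<open>unobs\<close> speaks of bounded windows, while solutions live on the whole axis;
  the windows exhaust it, and \<open>F_exhaust\<close> collects the exceptional times.\<close>

lemma unobs_output:
  assumes "sol x y no_input p" "x 0 \<in> unobs"
  shows "\<forall>\<^sub>F t in F. t \<ge> 0 \<longrightarrow> y t = 0\<^sub>v (ny \<Sigma>)"
proof (rule F_exhaust)
  fix s :: 't
  show "\<forall>\<^sub>F t in F. 0 \<le> t \<and> t < s \<longrightarrow> y t = 0\<^sub>v (ny \<Sigma>)"
  proof (cases "s \<ge> 0")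
    case True
    then show ?thesis using unobs_underD[OF assms(1)] assms sol_sched by (auto simp: unobs_def)
  next
    case False
    show ?thesis
    proof (rule always_eventually, intro allI impI)
      fix t assume "0 \<le> t \<and> t < s"
      then show "y t = 0\<^sub>v (ny \<Sigma>)" using False by (meson less_imp_le order_trans)
    qed
  qed
qed

text \<open>Superposing a multiple of the unforced solution from \<open>w\<close> leaves input and
  schedule as they are and changes the output only at exceptional times. Hence
  \<open>sol_output_cong\<close> readmits the old representative \<open>y\<close>.\<close>

lemma output_map_add_unobs:
  assumes y: "y \<in> output_map sols \<Sigma> x0 (u, p)" and w: "w \<in> unobs"
  shows "y \<in> output_map sols \<Sigma> (x0 + c \<cdot>\<^sub>v w) (u, p)"
proof -
  obtain x where x: "sol x y u p" "x 0 = x0" using y by (auto simp: output_map_def)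
  have wc: "w \<in> carrier_vec n" using w by (simp add: unobs_def)
  obtain v z where v: "sol v z no_input p" "v 0 = w" using free_sol[OF sol_sched[OF x(1)] wc] by blast
  let ?u = "lincomb_signal 1 u c no_input"
  have u: "?u = u"
  proof
    fix t show "?u t = u t"
    proof (cases "t \<ge> 0")
      case True
      then have "u t \<in> carrier_vec (nu \<Sigma>)" using sig_value[OF sol_input[OF x(1)]] by blast
      then show ?thesis using True by (simp add: lincomb_signal_apply add_smult_zero_vec)
    next
      case False
      then show ?thesis using sig_ext[OF sol_input[OF x(1)]]
        by (metis atLeast_iff lincomb_signal_def restrict_apply)
    qed
  qed
  have s: "sol (lincomb_signal 1 x c v) (lincomb_signal 1 y c z) u p"
    using sol_lincomb[OF lpv x(1) v(1), of 1 c] u by simp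
  have "\<forall>\<^sub>F t in F. t \<ge> 0 \<longrightarrow> y t = lincomb_signal 1 y c z t"
    using unobs_output[OF v(1)] w v(2)
    by (auto elim!: eventually_mono simp: lincomb_signal_apply add_smult_zero_vec[OF sol_output_value[OF x(1)]])
  then have "sol (lincomb_signal 1 x c v) y u p" by (rule sol_output_cong[OF lpv s sol_output[OF x(1)]])
  moreover have "lincomb_signal 1 x c v 0 = x0 + c \<cdot>\<^sub>v w" using x v by (simp add: lincomb_signal_apply)
  ultimately show ?thesis unfolding output_map_def by blast
qed

text \<open>Superposition removes the input from the definition: two states with equal output maps
  differ by a state whose unforced output is zero. Observability thereby becomes a condition on a
  subspace.\<close>

lemma observable_iff_unobs: "observable sols \<Sigma> \<longleftrightarrow> unobs = {0\<^sub>v n}"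
proof
  assume obs: "observable sols \<Sigma>"
  have "w = 0\<^sub>v n" if w: "w \<in> unobs" for w
  proof (rule ccontr)
    assume ne: "w \<noteq> 0\<^sub>v n"
    have wc: "w \<in> carrier_vec n" using w by (simp add: unobs_def)
    have e: "0\<^sub>v n + 1 \<cdot>\<^sub>v w = w" "w + (-1) \<cdot>\<^sub>v w = 0\<^sub>v n" using wc by auto
    have "output_map sols \<Sigma> w (u, p) = output_map sols \<Sigma> (0\<^sub>v n) (u, p)" for u p
      using output_map_add_unobs[OF _ w, of _ w u p "-1"] output_map_add_unobs[OF _ w, of _ "0\<^sub>v n" u p 1] e
      by auto
    then have "output_map sols \<Sigma> w = output_map sols \<Sigma> (0\<^sub>v n)" by (auto simp: fun_eq_iff)
    then show False using obs wc ne unfolding observable_def by (metis zero_carrier_vec)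
  qed
  then show "unobs = {0\<^sub>v n}" using vec_subspace_zero[OF unobs_subspace] by blast
next
  assume un: "unobs = {0\<^sub>v n}"
  show "observable sols \<Sigma>"
    unfolding observable_def
  proof (intro ballI impI notI)
    fix x1 x2 assume x: "x1 \<in> carrier_vec n" "x2 \<in> carrier_vec n" "x1 \<noteq> x2"
      and eq: "output_map sols \<Sigma> x1 = output_map sols \<Sigma> x2"
    have e: "1 \<cdot>\<^sub>v x1 + (-1) \<cdot>\<^sub>v x2 = x1 - x2" using x by (intro eq_vecI) auto
    have "x1 - x2 \<in> unobs_under q s" if q: "q \<in> schedules" for q s
    proof -
      obtain w y where w: "sol w y no_input q" "w 0 = x1" using free_sol[OF q x(1)] by blast
      then have "y \<in> output_map sols \<Sigma> x2 (no_input, q)" unfolding eq[symmetric] by (auto simp: output_map_def)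
      then obtain w' where w': "sol w' y no_input q" "w' 0 = x2" by (auto simp: output_map_def)
      \<comment> \<open>Both solutions are taken with the same representative \<open>y\<close>, so
        the difference vanishes everywhere.\<close>
      have "lincomb_signal 1 y (-1) y t = 0\<^sub>v (ny \<Sigma>)" if "t \<ge> 0" for t
        using sol_output_value[OF w(1) that] that by (auto simp: lincomb_signal_apply)
      then show ?thesis
        unfolding unobs_under_def using free_sol_lincomb[OF w(1) w'(1), of 1 "-1"] w(2) w'(2) e
        by (intro CollectI exI[of _ "lincomb_signal 1 w (-1) w'"] exI[of _ "lincomb_signal 1 y (-1) y"])
          (simp add: lincomb_signal_apply)
    qed
    then have "x1 - x2 \<in> unobs" using x by (simp add: unobs_def)
    then have z: "x1 - x2 = 0\<^sub>v n" using un by simp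
    have "x1 = x2"
    proof (rule eq_vecI)
      fix i assume "i < dim_vec x2"
      then show "x1 $ i = x2 $ i" using arg_cong[OF z, of "\<lambda>v. v $ i"] x by simp
    qed (use x in auto)
    then show False using x by simp
  qed
qed

text \<open>Among all schedules choose one whose unobservable subspace meets the column space of an
  injective matrix with a maximal number of columns trivially. Continuing it by \<open>q\<close> cannot make the
  subspace smaller, so it is carried into the unobservable subspace of every \<open>q\<close>.\<close>

lemma observing_schedule:
  assumes rc: "RC \<Sigma>" and un: "unobs = {0\<^sub>v n}"
  obtains p s where "p \<in> schedules" "s \<ge> 0" "unobs_under p s = {0\<^sub>v n}"
proof -
  \<comment> \<open>The columns of \<open>M\<close> are independent modulo
    \<open>unobs_under p s\<close>, so the largest such \<open>k\<close> is the codimension of an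
    unobservable subspace of least dimension.\<close>
  let ?P = "\<lambda>k. \<exists>p\<in>schedules. \<exists>s\<ge>0. \<exists>M\<in>carrier_mat n k.
     \<forall>v\<in>carrier_vec k. M *\<^sub>v v \<in> unobs_under p s \<longrightarrow> v = 0\<^sub>v k"
  obtain q0 where "q0 \<in> sched \<Sigma>" using RC_sched[OF rc] by blast
  then have "const_signal q0 \<in> schedules" by (rule sig_const)
  moreover have "\<forall>v\<in>carrier_vec 0. 0\<^sub>m n 0 *\<^sub>v v \<in> unobs_under (const_signal q0) 0 \<longrightarrow> v = 0\<^sub>v 0"
    by auto
  ultimately have "?P 0" using order_refl[of "0::'t"] zero_carrier_mat[of n 0] by blast
  moreover have "k \<le> n" if "?P k" for k
  proof -
    obtain p s M where M: "p \<in> schedules" "M \<in> carrier_mat n k"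
      "\<forall>v\<in>carrier_vec k. M *\<^sub>v v \<in> unobs_under p s \<longrightarrow> v = 0\<^sub>v k"
      using \<open>?P k\<close> by blast
    then have "inj_mat n k M"
      using vec_subspace_zero[OF unobs_under_subspace[OF M(1)], of s] by (auto simp: inj_mat_def)
    then show ?thesis by (rule inj_mat_le)
  qed
  ultimately have "\<exists>k. ?P k \<and> (\<forall>j. ?P j \<longrightarrow> j \<le> k)" by (rule greatest_bounded_nat)
  then obtain k where k: "?P k" "\<And>j. ?P j \<Longrightarrow> j \<le> k" by blast
  then obtain p s M where p: "p \<in> schedules" and s: "s \<ge> 0" and M: "M \<in> carrier_mat n k"
    "\<forall>v\<in>carrier_vec k. M *\<^sub>v v \<in> unobs_under p s \<longrightarrow> v = 0\<^sub>v k" by blast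
  have "x0 = 0\<^sub>v n" if x0: "x0 \<in> unobs_under p s" for x0
  proof -
    have x0c: "x0 \<in> carrier_vec n" using vec_subspace_carrier[OF unobs_under_subspace[OF p] x0] .
    obtain x y where x: "sol x y no_input p" "x 0 = x0" using free_sol[OF p x0c] by blast
    have "x s \<in> unobs_under q r" if q: "q \<in> schedules" and r: "r \<ge> 0" for q r
    proof (rule unobs_under_concat(2)[OF p q s r x(1)], rule ccontr)
      let ?W = "unobs_under (concat_at s p q) (s + r)"
      have pq: "concat_at s p q \<in> schedules" by (rule sig_concat[OF p q s])
      have W: "vec_subspace n ?W" by (rule unobs_under_subspace[OF pq])
      assume nW: "x 0 \<notin> ?W"
      have Wp: "x' \<in> unobs_under p s" if x': "x' \<in> ?W" for x'
      proof -
        obtain w z where w: "sol w z no_input p" "w 0 = x'"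
          using free_sol[OF p vec_subspace_carrier[OF W x']] by blast
        then show ?thesis using unobs_under_concat(1)[OF p q s r w(1)] x' by simp
      qed
      \<comment> \<open>As \<open>x0\<close> lies in \<open>unobs_under p s\<close>, so does the
        \<open>M\<close> part of the combination, which vanishes by the choice of \<open>M\<close>.
        A nonzero multiple of \<open>x0\<close> in \<open>?W\<close> would then contradict
        \<open>nW\<close>.\<close>
      have "v = 0\<^sub>v (Suc k)" if v: "v \<in> carrier_vec (Suc k)" "add_col M n k x0 *\<^sub>v v \<in> ?W" for v
      proof -
        let ?w = "vec k (\<lambda>i. v $ i)"
        have e: "M *\<^sub>v ?w + v $ k \<cdot>\<^sub>v x0 \<in> ?W" using add_col_mult[OF M(1) x0c v(1)] v(2) by simp
        have Mw: "M *\<^sub>v ?w \<in> carrier_vec n" using M(1) by simp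
        have "(M *\<^sub>v ?w + v $ k \<cdot>\<^sub>v x0) - v $ k \<cdot>\<^sub>v x0 \<in> unobs_under p s"
          using unobs_under_subspace[OF p, of s]
          by (intro vec_subspace_minus[OF _ Wp[OF e]] vec_subspace_smult[OF _ x0]) auto
        moreover have "(M *\<^sub>v ?w + v $ k \<cdot>\<^sub>v x0) - v $ k \<cdot>\<^sub>v x0 = M *\<^sub>v ?w"
          using Mw x0c by (intro add_minus_cancel_vec) auto
        ultimately have w0: "?w = 0\<^sub>v k" using M(2) by simp
        have vk: "v $ k = 0"
        proof (rule ccontr)
          assume c: "v $ k \<noteq> 0"
          have "v $ k \<cdot>\<^sub>v x0 \<in> ?W" using e w0 mult_mat_zero_vec[OF M(1)] x0c by simp
          then have "(1 / v $ k) \<cdot>\<^sub>v (v $ k \<cdot>\<^sub>v x0) \<in> ?W" by (rule vec_subspace_smult[OF W])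
          then show False using nW c x(2) by (simp add: smult_smult_assoc)
        qed
        show ?thesis by (rule vec_Suc_eq_zero[OF v(1) w0 vk])
      qed
      moreover have "s + r \<ge> 0" using s r by simp
      ultimately have "?P (Suc k)" using pq add_col_carrier[of M n k x0] by blast
      then have "Suc k \<le> k" by (rule k(2))
      then show False by simp
    qed
    then have "x s \<in> unobs" using sol_state[OF x(1) s] by (simp add: unobs_def)
    then have "x s = 0\<^sub>v n" using un by simp
    then show ?thesis using backward_zero[OF rc x(1) s] x(2) by simp
  qed
  then have "unobs_under p s = {0\<^sub>v n}" using vec_subspace_zero[OF unobs_under_subspace[OF p]] by blast
  then show ?thesis using that p s by blast
qed

text \<open>Initial states of the two systems with a common unforced output along the observing
  schedule form a total linear relation. A matrix inside it is injective: a state related to zero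
  has zero output along that schedule and is therefore zero.\<close>

lemma observable_imp_dim_le:
  assumes rc: "RC \<Sigma>" and obs: "observable sols \<Sigma>" and lpv': "is_lpv_ssa \<Sigma>'"
    and eq: "manifest_behavior sols \<Sigma> = manifest_behavior sols \<Sigma>'"
  shows "n \<le> nx \<Sigma>'"
proof -
  interpret S': lpv_axis_system sols F sig RC \<Sigma>' by unfold_locales (rule lpv')
  have un: "unobs = {0\<^sub>v n}" using obs observable_iff_unobs by simp
  obtain p s where p: "p \<in> schedules" "s \<ge> 0" "unobs_under p s = {0\<^sub>v n}"
    by (rule observing_schedule[OF rc un])
  define L where "L = {(x 0, x' 0) | x x' y. sol x y no_input p \<and> (x', y, no_input, p) \<in> sols \<Sigma>'}"
  have tot: "\<exists>x0'. (x0, x0') \<in> L" if x0: "x0 \<in> carrier_vec n" for x0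
  proof -
    obtain x y where x: "sol x y no_input p" "x 0 = x0" using free_sol[OF p(1) x0] by blast
    then have "(y, no_input, p) \<in> manifest_behavior sols \<Sigma>'"
      unfolding eq[symmetric] by (auto simp: manifest_behavior_def)
    then show ?thesis using x by (auto simp: manifest_behavior_def L_def)
  qed
  then obtain x y x' where ex: "sol x y no_input p" "(x', y, no_input, p) \<in> sols \<Sigma>'"
    using tot[OF zero_carrier_vec] unfolding L_def by blast
  \<comment> \<open>The signal dimensions of \<Sigma>' are not prescribed; they are read off from
    the values of a common trajectory at time 0.\<close>
  have "(no_input :: 't signal) 0 \<in> carrier_vec (nu \<Sigma>')" using sig_value[OF S'.sol_input[OF ex(2)] order_refl] by simp
  then have nu: "nu \<Sigma>' = nu \<Sigma>" by (metis carrier_vecD const_signal_apply index_zero_vec(2) order_refl)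
  have ny: "ny \<Sigma>' = ny \<Sigma>"
    using sol_output_value[OF ex(1), of 0] S'.sol_output_value[OF ex(2), of 0] by (metis carrier_vecD order_refl)
  have Lc: "L \<subseteq> carrier_vec n \<times> carrier_vec (nx \<Sigma>')"
    using sol_state S'.sol_state by (auto simp: L_def)
  have lin: "(a \<cdot>\<^sub>v x + b \<cdot>\<^sub>v z, a \<cdot>\<^sub>v x' + b \<cdot>\<^sub>v z') \<in> L" if L: "(x, x') \<in> L" "(z, z') \<in> L" for a b x z x' z'
  proof -
    obtain X X' Y Z Z' Y' where *: "sol X Y no_input p" "(X', Y, no_input, p) \<in> sols \<Sigma>'"
      "sol Z Y' no_input p" "(Z', Y', no_input, p) \<in> sols \<Sigma>'" "x = X 0" "x' = X' 0" "z = Z 0" "z' = Z' 0"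
      using L by (auto simp: L_def)
    have "(lincomb_signal a X b Z 0, lincomb_signal a X' b Z' 0) \<in> L"
      unfolding L_def using free_sol_lincomb[OF *(1,3), of a b]
        S'.free_sol_lincomb[unfolded nu, OF *(2,4), of a b] by blast
    then show ?thesis using * by (simp add: lincomb_signal_apply)
  qed
  have zero: "(0\<^sub>v n, 0\<^sub>v (nx \<Sigma>')) \<in> L"
  proof -
    have "(0 \<cdot>\<^sub>v x 0 + 0 \<cdot>\<^sub>v x 0, 0 \<cdot>\<^sub>v x' 0 + 0 \<cdot>\<^sub>v x' 0) \<in> L"
      using ex by (intro lin) (auto simp: L_def)
    moreover have "0 \<cdot>\<^sub>v x 0 + 0 \<cdot>\<^sub>v x 0 = 0\<^sub>v n" "0 \<cdot>\<^sub>v x' 0 + 0 \<cdot>\<^sub>v x' 0 = 0\<^sub>v (nx \<Sigma>')"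
      using zero_lincomb[OF sol_state[OF ex(1) order_refl]] zero_lincomb[OF S'.sol_state[OF ex(2) order_refl]] by simp_all
    ultimately show ?thesis by simp
  qed
  obtain M where M: "M \<in> carrier_mat (nx \<Sigma>') n" "\<And>v. v \<in> carrier_vec n \<Longrightarrow> (v, M *\<^sub>v v) \<in> L"
    using linear_relation_matrix[OF Lc zero lin tot] by blast
  have "inj_mat (nx \<Sigma>') n M"
    unfolding inj_mat_def
  proof (intro conjI M ballI impI)
    fix v assume v: "v \<in> carrier_vec n" "M *\<^sub>v v = 0\<^sub>v (nx \<Sigma>')"
    obtain X X' Y where *: "sol X Y no_input p" "(X', Y, no_input, p) \<in> sols \<Sigma>'" "X 0 = v" "X' 0 = 0\<^sub>v (nx \<Sigma>')"
      using M(2)[OF v(1)] v(2) by (auto simp: L_def)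
    have "\<forall>\<^sub>F t in F. t \<ge> 0 \<longrightarrow> Y t = const_signal (0\<^sub>v (ny \<Sigma>)) t"
      using sol_unique[OF lpv' *(2) S'.zero_sol[unfolded nu ny]] S'.sol_sched[OF *(2)] *(4) by simp
    then have "\<forall>\<^sub>F t in F. 0 \<le> t \<and> t < s \<longrightarrow> Y t = 0\<^sub>v (ny \<Sigma>)"
      by (rule eventually_mono) auto
    then have "v \<in> unobs_under p s" unfolding unobs_under_def using *(1,3) by blast
    then show "v = 0\<^sub>v n" using p(3) by simp
  qed
  then show ?thesis by (rule inj_mat_le)
qed

end

section \<open>Reachability and controllability\<close>

context lpv_axis_system
begin

definition reach_under :: "'t signal \<Rightarrow> 't \<Rightarrow> real vec set" where
  "reach_under p s = {x s | x y u. sol x y u p \<and> x 0 = 0\<^sub>v n}"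

text \<open>Superposition requires a common schedule and a common time, which is why both are fixed
  here, unlike in \<open>reachable\<close>.\<close>

lemma reach_under_subspace:
  assumes p: "p \<in> schedules" and s: "s \<ge> 0" shows "vec_subspace n (reach_under p s)"
proof (rule vec_subspaceI)
  show "reach_under p s \<subseteq> carrier_vec n" using sol_state s by (auto simp: reach_under_def)
  have "const_signal (0\<^sub>v n) s \<in> reach_under p s"
    unfolding reach_under_def using zero_sol[OF p] const_signal_apply[OF order_refl, of "0\<^sub>v n"] by blast
  then show "0\<^sub>v n \<in> reach_under p s" using s by simp
  fix a b v w assume "v \<in> reach_under p s" "w \<in> reach_under p s"
  then obtain x y u x' y' u' where *: "sol x y u p" "x 0 = 0\<^sub>v n" "v = x s"
    "sol x' y' u' p" "x' 0 = 0\<^sub>v n" "w = x' s" by (auto simp: reach_under_def)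
  have "lincomb_signal a x b x' 0 = 0\<^sub>v n"
    using *(2,5) by (simp add: lincomb_signal_apply add_smult_zero_vec) (rule eq_vecI; simp)
  then have "lincomb_signal a x b x' s \<in> reach_under p s"
    unfolding reach_under_def using sol_lincomb[OF lpv *(1,4), of a b] by blast
  then show "a \<cdot>\<^sub>v v + b \<cdot>\<^sub>v w \<in> reach_under p s" using * s by (simp add: lincomb_signal_apply)
qed

definition reachable :: "real vec set" where
  "reachable = {x t | x y u p t. t \<ge> 0 \<and> sol x y u p \<and> x 0 = 0\<^sub>v n}"

lemma reachable_carrier: "reachable \<subseteq> carrier_vec n"
  using sol_state by (auto simp: reachable_def)

lemma span_reachable_iff: "span_reachable sols \<Sigma> (0\<^sub>v n) \<longleftrightarrow> vec_span n reachable = carrier_vec n"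
  by (simp add: span_reachable_def reachable_def)

lemma free_concat:
  assumes q: "sol x y u q" and r: "r \<ge> 0" and w: "sol w v u' p" "w 0 = x r"
  shows "sol (concat_at r x w) (concat_at r y v) (concat_at r u u') (concat_at r q p)"
    and "s \<ge> 0 \<Longrightarrow> concat_at r x w (r + s) = w s"
    and "concat_at r x w 0 = x 0"
  using sol_concat[OF lpv q w(1) r w(2)] concat_at_add[OF r] concat_at_init[OF r, of w x] w(2) by auto

text \<open>Dually to \<open>observing_schedule\<close>, prepending \<open>q\<close> to a schedule \<open>p\<close> with maximal reachable
  subspace adds the states steered through \<open>q\<close> and transported along \<open>p\<close>, so these are reachable
  under \<open>p\<close> already. As the transport is injective, all states are.\<close>

lemma steering_schedule:
  assumes rc: "RC \<Sigma>" and span: "vec_span n reachable = carrier_vec n"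
  obtains p s where "p \<in> schedules" "s \<ge> 0" "reach_under p s = carrier_vec n"
proof -
  let ?P = "\<lambda>k. \<exists>p\<in>schedules. \<exists>s\<ge>0. \<exists>M. inj_mat n k M \<and> (\<forall>v\<in>carrier_vec k. M *\<^sub>v v \<in> reach_under p s)"
  obtain q0 where "q0 \<in> sched \<Sigma>" using RC_sched[OF rc] by blast
  then have q0: "const_signal q0 \<in> schedules" by (rule sig_const)
  have "\<forall>v\<in>carrier_vec 0. 0\<^sub>m n 0 *\<^sub>v v \<in> reach_under (const_signal q0) 0"
    using vec_subspace_zero[OF reach_under_subspace[OF q0 order_refl]] by (auto simp: zero_mat_mult_vec)
  then have "?P 0" using q0 order_refl[of "0::'t"] inj_mat_empty[of n] by blast
  moreover have "k \<le> n" if "?P k" for k using that inj_mat_le by blast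
  ultimately have "\<exists>k. ?P k \<and> (\<forall>j. ?P j \<longrightarrow> j \<le> k)" by (rule greatest_bounded_nat)
  then obtain k where k: "?P k" "\<And>j. ?P j \<Longrightarrow> j \<le> k" by blast
  then obtain p s M where p: "p \<in> schedules" and s: "s \<ge> 0" and M: "inj_mat n k M"
    "\<And>v. v \<in> carrier_vec k \<Longrightarrow> M *\<^sub>v v \<in> reach_under p s" by blast
  have Mc: "M \<in> carrier_mat n k" using M(1) by (simp add: inj_mat_def)
  have R: "vec_subspace n (reach_under p s)" by (rule reach_under_subspace[OF p s])
  \<comment> \<open>The preimage of \<open>reach_under p s\<close> under the transport along
    \<open>p\<close>. By uniqueness it makes no difference whether one solution or all of them are
    tested, which is \<open>WI\<close>.\<close>
  define W where "W = {x0 \<in> carrier_vec n. \<forall>x y. sol x y no_input p \<longrightarrow> x 0 = x0 \<longrightarrow> x s \<in> reach_under p s}"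
  have WI: "x0 \<in> W" if x: "sol x y no_input p" "x 0 = x0" "x s \<in> reach_under p s" for x y x0
    unfolding W_def
  proof (intro CollectI conjI allI impI)
    show "x0 \<in> carrier_vec n" using sol_state[OF x(1) order_refl] x(2) by simp
    fix x' y' assume x': "sol x' y' no_input p" "x' 0 = x0"
    then have "x = x'" using sol_unique[OF lpv x(1) x'(1)] x(2) by simp
    then show "x' s \<in> reach_under p s" using x(3) by simp
  qed
  have W: "vec_subspace n W"
  proof (rule vec_subspaceI)
    show "W \<subseteq> carrier_vec n" by (auto simp: W_def)
    show "0\<^sub>v n \<in> W" by (rule WI[OF zero_sol[OF p]]) (use s vec_subspace_zero[OF R] in auto)
    fix a b v w assume v: "v \<in> W" and w: "w \<in> W"
    obtain x y where x: "sol x y no_input p" "x 0 = v" using free_sol[OF p] v by (auto simp: W_def)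
    obtain x' y' where x': "sol x' y' no_input p" "x' 0 = w" using free_sol[OF p] w by (auto simp: W_def)
    have "x s \<in> reach_under p s" "x' s \<in> reach_under p s" using v w x x' by (auto simp: W_def)
    then have "lincomb_signal a x b x' s \<in> reach_under p s"
      using vec_subspace_lincomb[OF R] s by (simp add: lincomb_signal_apply)
    then show "a \<cdot>\<^sub>v v + b \<cdot>\<^sub>v w \<in> W"
      using x x' by (intro WI[OF free_sol_lincomb[OF x(1) x'(1), of a b]]) (simp_all add: lincomb_signal_apply)
  qed
  have "reachable \<subseteq> W"
  proof
    fix v assume "v \<in> reachable"
    then obtain x y u q r where x: "r \<ge> 0" "sol x y u q" "x 0 = 0\<^sub>v n" "v = x r"
      by (auto simp: reachable_def)
    have vc: "v \<in> carrier_vec n" using sol_state[OF x(2,1)] x(4) by simp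
    have q: "q \<in> schedules" by (rule sol_sched[OF x(2)])
    obtain w z where w: "sol w z no_input p" "w 0 = v" using free_sol[OF p vc] by blast
    have wr: "w 0 = x r" using w x by simp
    show "v \<in> W"
    proof (rule WI[OF w], rule ccontr)
      assume nw: "w s \<notin> reach_under p s"
      let ?q = "concat_at r q p"
      have qp: "?q \<in> schedules" by (rule sig_concat[OF q p x(1)])
      have rs: "r + s \<ge> 0" using x(1) s by simp
      have R': "vec_subspace n (reach_under ?q (r + s))" by (rule reach_under_subspace[OF qp rs])
      have "concat_at r x w (r + s) \<in> reach_under ?q (r + s)"
        unfolding reach_under_def using free_concat(1,3)[OF x(2,1) w(1) wr] x(3) by (metis (mono_tags, lifting) mem_Collect_eq)
      then have ws: "w s \<in> reach_under ?q (r + s)" using free_concat(2)[OF x(2,1) w(1) wr s] by simp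
      \<comment> \<open>Resting at zero while \<open>q\<close> runs and steering afterwards reaches
        everything that is reachable under \<open>p\<close> alone.\<close>
      have sub: "reach_under p s \<subseteq> reach_under ?q (r + s)"
      proof
        fix v' assume "v' \<in> reach_under p s"
        then obtain x' y' u' where x': "sol x' y' u' p" "x' 0 = 0\<^sub>v n" "v' = x' s" by (auto simp: reach_under_def)
        have x0: "x' 0 = const_signal (0\<^sub>v n) r" using x' x(1) by simp
        note c = free_concat[OF zero_sol[OF q] x(1) x'(1) x0]
        have "concat_at r (const_signal (0\<^sub>v n)) x' 0 = 0\<^sub>v n" using c(3) by simp
        then have "concat_at r (const_signal (0\<^sub>v n)) x' (r + s) \<in> reach_under ?q (r + s)"
          unfolding reach_under_def using c(1) by blast
        then show "v' \<in> reach_under ?q (r + s)" using c(2)[OF s] x'(3) by simp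
      qed
      have wc: "w s \<in> carrier_vec n" by (rule sol_state[OF w(1) s])
      have "inj_mat n (Suc k) (add_col M n k (w s))"
        by (rule inj_mat_add_col_subspace[OF R M wc nw])
      moreover have "add_col M n k (w s) *\<^sub>v v \<in> reach_under ?q (r + s)" if "v \<in> carrier_vec (Suc k)" for v
        unfolding add_col_mult[OF Mc wc that]
        using M(2) sub by (intro vec_subspace_add[OF R'] vec_subspace_smult[OF R' ws]) auto
      ultimately have "?P (Suc k)" using qp rs by blast
      then have "Suc k \<le> k" by (rule k(2))
      then show False by simp
    qed
  qed
  then have Wfull: "W = carrier_vec n"
    using vec_span_minimal[OF reachable_carrier W] span by (auto simp: W_def)
  \<comment> \<open>The transport along \<open>p\<close> as a relation. Its matrix \<open>N\<close>
    is square and injective by \<open>backward_zero\<close>, hence surjective; since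
    \<open>W\<close> is everything, every state is then reachable under \<open>p\<close>.\<close>
  define L where "L = {(x 0, x s) | x y. sol x y no_input p}"
  have Lc: "L \<subseteq> carrier_vec n \<times> carrier_vec n" using sol_state s by (auto simp: L_def)
  have LI: "(x 0, x s) \<in> L" if "sol x y no_input p" for x y using that by (auto simp: L_def)
  have zero: "(0\<^sub>v n, 0\<^sub>v n) \<in> L" using LI[OF zero_sol[OF p]] s by simp
  have lin: "(a \<cdot>\<^sub>v x + b \<cdot>\<^sub>v z, a \<cdot>\<^sub>v x' + b \<cdot>\<^sub>v z') \<in> L" if L: "(x, x') \<in> L" "(z, z') \<in> L" for a b x z x' z'
  proof -
    obtain X Y Z Y' where *: "sol X Y no_input p" "sol Z Y' no_input p" "x = X 0" "x' = X s" "z = Z 0" "z' = Z s"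
      using L by (auto simp: L_def)
    have "(lincomb_signal a X b Z 0, lincomb_signal a X b Z s) \<in> L"
      by (rule LI[OF free_sol_lincomb[OF *(1,2)]])
    then show ?thesis using * s by (simp add: lincomb_signal_apply)
  qed
  have tot: "\<exists>x'. (x, x') \<in> L" if "x \<in> carrier_vec n" for x
    using free_sol[OF p that] unfolding L_def by blast
  obtain N where N: "N \<in> carrier_mat n n" "\<And>x. x \<in> carrier_vec n \<Longrightarrow> (x, N *\<^sub>v x) \<in> L"
    using linear_relation_matrix[OF Lc zero lin tot] by blast
  have "inj_mat n n N"
    unfolding inj_mat_def
  proof (intro conjI N ballI impI)
    fix v assume v: "v \<in> carrier_vec n" "N *\<^sub>v v = 0\<^sub>v n"
    obtain x y where "sol x y no_input p" "x 0 = v" "x s = 0\<^sub>v n"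
      using N(2)[OF v(1)] v(2) by (auto simp: L_def)
    then show "v = 0\<^sub>v n" using backward_zero[OF rc _ s] by blast
  qed
  then obtain N' where N': "N' \<in> carrier_mat n n" "N * N' = 1\<^sub>m n" using inj_mat_square_inverse by metis
  have "v \<in> reach_under p s" if v: "v \<in> carrier_vec n" for v
  proof -
    have "N' *\<^sub>v v \<in> carrier_vec n" using N' v by simp
    then have "(N' *\<^sub>v v, N *\<^sub>v (N' *\<^sub>v v)) \<in> L" by (rule N(2))
    moreover have "N *\<^sub>v (N' *\<^sub>v v) = v"
      using assoc_mult_mat_vec[OF N(1) N'(1) v] N'(2) v by simp
    ultimately obtain x y where x: "sol x y no_input p" "x 0 = N' *\<^sub>v v" "x s = v" by (auto simp: L_def)
    have "x 0 \<in> W" using Wfull sol_state[OF x(1) order_refl] by simp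
    then show ?thesis using x by (auto simp: W_def)
  qed
  then have "reach_under p s = carrier_vec n" using vec_subspace_carrier[OF R] by blast
  then show ?thesis by (rule that[OF p s])
qed

text \<open>The connecting trajectory follows the first one up to \<open>t + 1\<close> and then the
  steering schedule for time \<open>s\<close>. There a solution from zero is added to the free
  response, chosen so that the sum ends in the initial state of the second trajectory.\<close>

lemma span_reachable_imp_controllable:
  assumes rc: "RC \<Sigma>" and span: "span_reachable sols \<Sigma> (0\<^sub>v n)"
  shows "controllable (\<lambda>Q. eventually Q F) (manifest_behavior sols \<Sigma>)"
proof -
  obtain p s where p: "p \<in> schedules" "s \<ge> 0" "reach_under p s = carrier_vec n"
    using steering_schedule[OF rc] span unfolding span_reachable_iff by blast
  have main: "\<exists>(y, u, p)\<in>manifest_behavior sols \<Sigma>. \<exists>\<tau>>0.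
        (\<forall>\<^sub>F r in F. r \<in> {0..t} \<longrightarrow> y r = y1 r) \<and> (\<forall>r\<in>{0..t}. u r = u1 r \<and> p r = p1 r) \<and>
        (\<forall>\<^sub>F r in F. r \<ge> t + \<tau> \<longrightarrow> y r = y2 (r - t - \<tau>)) \<and>
        (\<forall>r\<ge>t + \<tau>. u r = u2 (r - t - \<tau>) \<and> p r = p2 (r - t - \<tau>))"
    if s1: "sol x1 y1 u1 p1" and s2: "sol x2 y2 u2 p2" and t: "t \<ge> 0" for x1 y1 u1 p1 x2 y2 u2 p2 t
  proof -
    \<comment> \<open>The extra unit of time keeps the closed interval up to \<open>t\<close> inside
      the first piece, which excludes its right end, and makes \<open>\<tau> = 1 + s\<close>
      positive even if \<open>s = 0\<close>.\<close>
    have t1: "t + 1 \<ge> 0" using t by simp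
    have lt: "r < t + 1" if "r \<in> {0..t}" for r
      using that less_add_one[of t] by (auto intro: le_less_trans)
    obtain w z where w: "sol w z no_input p" "w 0 = x1 (t + 1)"
      using free_sol[OF p(1) sol_state[OF s1 t1]] by blast
    have wc: "w s \<in> carrier_vec n" and x2c: "x2 0 \<in> carrier_vec n"
      using sol_state[OF w(1) p(2)] sol_state[OF s2 order_refl] by auto
    have "x2 0 - w s \<in> reach_under p s" using p(3) wc x2c by simp
    then obtain x3 y3 u3 where s3: "sol x3 y3 u3 p" "x3 0 = 0\<^sub>v n" "x3 s = x2 0 - w s"
      unfolding reach_under_def by (auto dest: sym)
    let ?x = "lincomb_signal 1 w 1 x3" and ?y = "lincomb_signal 1 z 1 y3" and ?u = "lincomb_signal 1 no_input 1 u3"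
    have m: "sol ?x ?y ?u p" by (rule sol_lincomb[OF lpv w(1) s3(1)])
    have m0: "?x 0 = x1 (t + 1)" using w(2) s3(2) sol_state[OF s1 t1] by (simp add: lincomb_signal_apply)
    have "w s + (x2 0 - w s) = x2 0" using wc x2c by (intro eq_vecI) auto
    then have ms: "x2 0 = ?x s" using p(2) s3(3) by (simp add: lincomb_signal_apply)
    note c1 = free_concat[OF m p(2) s2 ms]
    have e: "concat_at s ?x x2 0 = x1 (t + 1)" using c1(3) m0 by simp
    note c2 = free_concat(1)[OF s1 t1 c1(1) e]
    have in_B: "(concat_at (t + 1) y1 (concat_at s ?y y2), concat_at (t + 1) u1 (concat_at s ?u u2),
        concat_at (t + 1) p1 (concat_at s p p2)) \<in> manifest_behavior sols \<Sigma>"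
      using c2 by (auto simp: manifest_behavior_def)
    have early: "concat_at (t + 1) f1 g r = f1 r" if "r \<in> {0..t}" for f1 g :: "'t signal" and r
      using that lt[OF that] by (simp add: concat_at_less)
    have late: "concat_at (t + 1) f1 (concat_at s g f2) r = f2 (r - t - (1 + s))"
      if r: "r \<ge> t + (1 + s)" for f1 f2 g :: "'t signal" and r
    proof -
      have r': "(t + 1) + s \<le> r" using r by (simp add: add.assoc)
      have "t + 1 \<le> (t + 1) + s" using p(2) by simp
      then have r1: "t + 1 \<le> r" using r' by (rule order_trans)
      have "s \<le> r - (t + 1)" using r' r1 by (metis add_le_cancel_left le_add_diff_inverse)
      then have "concat_at (t + 1) f1 (concat_at s g f2) r = f2 (r - (t + 1) - s)"
        using r1 t1 p(2) by (simp add: concat_at_ge)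
      then show ?thesis by (simp add: diff_diff_add add.assoc)
    qed
    have pos: "(0::'t) < 1 + s" using p(2) by (simp add: add_pos_nonneg)
    show ?thesis
      using early late pos
      by (intro bexI[OF _ in_B]) (auto intro!: exI[of _ "1 + s"] always_eventually)
  qed
  show ?thesis
    unfolding controllable_def
  proof (intro ballI, clarify)
    fix y1 u1 p1 y2 u2 p2 t
    assume "(y1, u1, p1) \<in> manifest_behavior sols \<Sigma>" "(y2, u2, p2) \<in> manifest_behavior sols \<Sigma>" and t: "(t::'t) \<ge> 0"
    then obtain x1 x2 where s: "sol x1 y1 u1 p1" "sol x2 y2 u2 p2" by (auto simp: manifest_behavior_def)
    show "\<exists>(y, u, p)\<in>manifest_behavior sols \<Sigma>. \<exists>\<tau>>0.
        (\<forall>\<^sub>F r in F. r \<in> {0..t} \<longrightarrow> y r = y1 r) \<and> (\<forall>r\<in>{0..t}. u r = u1 r \<and> p r = p1 r) \<and>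
        (\<forall>\<^sub>F r in F. r \<ge> t + \<tau> \<longrightarrow> y r = y2 (r - t - \<tau>)) \<and>
        (\<forall>r\<ge>t + \<tau>. u r = u2 (r - t - \<tau>) \<and> p r = p2 (r - t - \<tau>))"
      by (rule main[OF s t])
  qed
qed

end

section \<open>Minimality\<close>

lemma vec_eq_of_minus_zero:
  fixes x y :: "real vec"
  assumes "x \<in> carrier_vec m" "y \<in> carrier_vec m" "x - y = 0\<^sub>v m"
  shows "x = y"
proof (rule eq_vecI)
  fix i assume "i < dim_vec y"
  then show "x $ i = y $ i" using arg_cong[OF assms(3), of "\<lambda>v. v $ i"] assms(1,2) by simp
qed (use assms in auto)

context lpv_axis_system
begin

text \<open>Along a constant schedule the unforced solution stays in \<open>unobs\<close>, because
  any schedule may follow after any time. \<open>sol_const_generator\<close> turns this into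
  invariance under \<open>Aof \<Sigma> q\<close>, and \<open>sol_const_output\<close> evaluates the
  vanishing output at time 0.\<close>

lemma unobs_invariant:
  assumes q: "q \<in> sched \<Sigma>" and x0: "x0 \<in> unobs"
  shows "Aof \<Sigma> q *\<^sub>v x0 \<in> unobs" and "Cof \<Sigma> q *\<^sub>v x0 = 0\<^sub>v (ny \<Sigma>)"
proof -
  have cq: "const_signal q \<in> schedules" using q by (rule sig_const)
  have x0c: "x0 \<in> carrier_vec n" using vec_subspace_carrier[OF unobs_subspace x0] .
  obtain x y where x: "sol x y no_input (const_signal q)" "x 0 = x0" using free_sol[OF cq x0c] by blast
  have "x t \<in> unobs" if t: "t \<ge> 0" for t
  proof -
    have "x t \<in> unobs_under q' r" if q': "q' \<in> schedules" and r: "r \<ge> 0" for q' r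
    proof (rule unobs_under_concat(2)[OF cq q' t r x(1)])
      have "concat_at t (const_signal q) q' \<in> schedules" by (rule sig_concat[OF cq q' t])
      then show "x 0 \<in> unobs_under (concat_at t (const_signal q) q') (t + r)"
        using x0 x(2) t r by (simp add: unobs_def)
    qed
    then show ?thesis using sol_state[OF x(1) t] by (simp add: unobs_def)
  qed
  then have "Aof \<Sigma> q *\<^sub>v x 0 + Bof \<Sigma> q *\<^sub>v 0\<^sub>v (nu \<Sigma>) \<in> unobs"
    by (rule sol_const_generator[OF lpv unobs_subspace x(1)])
  then show "Aof \<Sigma> q *\<^sub>v x0 \<in> unobs"
    using x(2) x0c mult_mat_vec_carrier[OF Aof_carrier[of \<Sigma> q] x0c] by (simp add: mult_mat_zero_vec[OF Bof_carrier])
  show "Cof \<Sigma> q *\<^sub>v x0 = 0\<^sub>v (ny \<Sigma>)"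
    using sol_const_output[OF lpv x(1) unobs_output[OF x(1)]] x(2) x0 by simp
qed

text \<open>\<open>Q\<close> is the quotient map by \<open>unobs\<close>. By invariance the system
  matrices descend, so \<open>Q\<close> intertwines \<Sigma> with the compressed system and maps
  solutions to solutions with the same output.\<close>

lemma not_observable_imp_smaller_realization:
  assumes "unobs \<noteq> {0\<^sub>v n}"
  shows "\<exists>\<Sigma>'. is_lpv_ssa \<Sigma>' \<and> nx \<Sigma>' < n \<and> manifest_behavior sols \<Sigma>' = manifest_behavior sols \<Sigma>"
proof -
  obtain k Q R where Q: "Q \<in> carrier_mat k n" and R: "R \<in> carrier_mat n k" and QR: "Q * R = 1\<^sub>m k"
    and ker: "\<And>x. x \<in> carrier_vec n \<Longrightarrow> Q *\<^sub>v x = 0\<^sub>v k \<longleftrightarrow> x \<in> unobs" and k: "k < n"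
    using vec_subspace_kernel[OF unobs_subspace] assms by metis
  define \<Sigma>' where "\<Sigma>' = compress k Q R \<Sigma>"
  have lpv': "is_lpv_ssa \<Sigma>'" unfolding \<Sigma>'_def by (rule is_lpv_ssa_compress[OF lpv Q R])
  have sel: "nx \<Sigma>' = k" "nu \<Sigma>' = nu \<Sigma>" "ny \<Sigma>' = ny \<Sigma>" "np \<Sigma>' = np \<Sigma>" "sched \<Sigma>' = sched \<Sigma>"
    by (simp_all add: \<Sigma>'_def)
  have QRv: "Q *\<^sub>v (R *\<^sub>v v) = v" if "v \<in> carrier_vec k" for v
    using assoc_mult_mat_vec[OF Q R that] QR that by simp
  \<comment> \<open>\<open>R\<close> picks a representative of each class, so replacing
    \<open>v\<close> by \<open>R *\<^sub>v (Q *\<^sub>v v)\<close> changes it by an unobservable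
    state only.\<close>
  have RQ: "v - R *\<^sub>v (Q *\<^sub>v v) \<in> unobs" "R *\<^sub>v (Q *\<^sub>v v) \<in> carrier_vec n" if v: "v \<in> carrier_vec n" for v
  proof -
    have Qv: "Q *\<^sub>v v \<in> carrier_vec k" using Q v by simp
    show c: "R *\<^sub>v (Q *\<^sub>v v) \<in> carrier_vec n" using R Qv by simp
    have "Q *\<^sub>v (v - R *\<^sub>v (Q *\<^sub>v v)) = Q *\<^sub>v v - Q *\<^sub>v (R *\<^sub>v (Q *\<^sub>v v))"
      by (rule mult_minus_distrib_mat_vec[OF Q v c])
    also have "\<dots> = 0\<^sub>v k" using QRv[OF Qv] Qv by simp
    finally show "v - R *\<^sub>v (Q *\<^sub>v v) \<in> unobs" using ker[of "v - R *\<^sub>v (Q *\<^sub>v v)"] v c by simp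
  qed
  have inter: "Aof \<Sigma>' q * Q = Q * Aof \<Sigma> q \<and> Bof \<Sigma>' q = Q * Bof \<Sigma> q \<and>
      Cof \<Sigma>' q * Q = Cof \<Sigma> q \<and> Dof \<Sigma>' q = Dof \<Sigma> q" if q: "q \<in> sched \<Sigma>" for q
  proof (intro conjI)
    note A = Aof_carrier[of \<Sigma> q] and C = Cof_carrier[of \<Sigma> q]
    have QA: "Q * Aof \<Sigma> q \<in> carrier_mat k n" using Q A by simp
    have QAR: "Q * Aof \<Sigma> q * R \<in> carrier_mat k k" using QA R by simp
    show "Aof \<Sigma>' q * Q = Q * Aof \<Sigma> q"
      unfolding \<Sigma>'_def Aof_compress[OF lpv Q R]
    proof (rule mat_eq_on_vecI[OF mult_carrier_mat[OF QAR Q] QA])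
      fix v :: "real vec" assume v: "v \<in> carrier_vec n"
      have Qv: "Q *\<^sub>v v \<in> carrier_vec k" using Q v by simp
      note c = RQ(2)[OF v]
      have Av: "Aof \<Sigma> q *\<^sub>v v \<in> carrier_vec n" "Aof \<Sigma> q *\<^sub>v (R *\<^sub>v (Q *\<^sub>v v)) \<in> carrier_vec n"
        using A v c by auto
      have "Q *\<^sub>v (Aof \<Sigma> q *\<^sub>v (v - R *\<^sub>v (Q *\<^sub>v v))) = 0\<^sub>v k"
        using unobs_invariant(1)[OF q RQ(1)[OF v]] ker vec_subspace_carrier[OF unobs_subspace] by blast
      then have "Q *\<^sub>v (Aof \<Sigma> q *\<^sub>v v) - Q *\<^sub>v (Aof \<Sigma> q *\<^sub>v (R *\<^sub>v (Q *\<^sub>v v))) = 0\<^sub>v k"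
        by (simp add: mult_minus_distrib_mat_vec[OF A v c] mult_minus_distrib_mat_vec[OF Q Av])
      then have "Q *\<^sub>v (Aof \<Sigma> q *\<^sub>v v) = Q *\<^sub>v (Aof \<Sigma> q *\<^sub>v (R *\<^sub>v (Q *\<^sub>v v)))"
        by (rule vec_eq_of_minus_zero[OF mult_mat_vec_carrier[OF Q Av(1)] mult_mat_vec_carrier[OF Q Av(2)]])
      then show "(Q * Aof \<Sigma> q * R * Q) *\<^sub>v v = (Q * Aof \<Sigma> q) *\<^sub>v v"
        unfolding assoc_mult_mat_vec[OF QAR Q v] assoc_mult_mat_vec[OF QA R Qv]
          assoc_mult_mat_vec[OF Q A c] assoc_mult_mat_vec[OF Q A v] by (rule sym)
    qed
    show "Bof \<Sigma>' q = Q * Bof \<Sigma> q" unfolding \<Sigma>'_def by (rule Bof_compress[OF lpv Q R])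
    have CR: "Cof \<Sigma> q * R \<in> carrier_mat (ny \<Sigma>) k" using C R by simp
    show "Cof \<Sigma>' q * Q = Cof \<Sigma> q"
      unfolding \<Sigma>'_def Cof_compress[OF lpv Q R]
    proof (rule mat_eq_on_vecI[OF mult_carrier_mat[OF CR Q] C])
      fix v :: "real vec" assume v: "v \<in> carrier_vec n"
      have Qv: "Q *\<^sub>v v \<in> carrier_vec k" using Q v by simp
      note c = RQ(2)[OF v]
      have "Cof \<Sigma> q *\<^sub>v v - Cof \<Sigma> q *\<^sub>v (R *\<^sub>v (Q *\<^sub>v v)) = 0\<^sub>v (ny \<Sigma>)"
        using unobs_invariant(2)[OF q RQ(1)[OF v]] by (simp add: mult_minus_distrib_mat_vec[OF C v c])
      then have "Cof \<Sigma> q *\<^sub>v v = Cof \<Sigma> q *\<^sub>v (R *\<^sub>v (Q *\<^sub>v v))"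
        by (rule vec_eq_of_minus_zero[OF mult_mat_vec_carrier[OF C v] mult_mat_vec_carrier[OF C c]])
      then show "(Cof \<Sigma> q * R * Q) *\<^sub>v v = Cof \<Sigma> q *\<^sub>v v"
        unfolding assoc_mult_mat_vec[OF CR Q v] assoc_mult_mat_vec[OF C R Qv] by (rule sym)
    qed
    show "Dof \<Sigma>' q = Dof \<Sigma> q" unfolding \<Sigma>'_def by (rule Dof_compress[OF lpv Q R])
  qed
  have Q': "Q \<in> carrier_mat (nx \<Sigma>') n" using Q sel by simp
  have map: "(ext (\<lambda>t. Q *\<^sub>v x t), y, u, p) \<in> sols \<Sigma>'" if "sol x y u p" for x y u p
    by (rule sol_intertwine[OF lpv lpv' sel(2-5) Q' inter that])
  have "manifest_behavior sols \<Sigma>' = manifest_behavior sols \<Sigma>"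
  proof (intro equalityI subsetI; clarify)
    fix y u p assume "(y, u, p) \<in> manifest_behavior sols \<Sigma>"
    then show "(y, u, p) \<in> manifest_behavior sols \<Sigma>'" using map unfolding manifest_behavior_def by blast
  next
    fix y u p assume "(y, u, p) \<in> manifest_behavior sols \<Sigma>'"
    \<comment> \<open>A trajectory of the quotient is lifted by starting \<Sigma> in a
      representative of \<open>z 0\<close>; uniqueness in the quotient identifies the outputs at
      almost all times.\<close>
    then obtain z where z: "(z, y, u, p) \<in> sols \<Sigma>'" by (auto simp: manifest_behavior_def)
    have zs: "y \<in> sig (ny \<Sigma>) (carrier_vec (ny \<Sigma>))" "u \<in> inputs" "p \<in> schedules" "z 0 \<in> carrier_vec k"
      using sol_signals[OF lpv' z] sel by auto
    then have "R *\<^sub>v z 0 \<in> carrier_vec n" using R by simp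
    then obtain x y' where x: "sol x y' u p" "x 0 = R *\<^sub>v z 0" using sol_exists[OF lpv zs(2,3)] by blast
    have "ext (\<lambda>t. Q *\<^sub>v x t) 0 = z 0" using x(2) QRv[OF zs(4)] by simp
    then have "\<forall>\<^sub>F t in F. t \<ge> 0 \<longrightarrow> y t = y' t"
      using sol_unique[OF lpv' z map[OF x(1)]] by simp
    then have "sol x y u p" by (rule sol_output_cong[OF lpv x(1) zs(1)])
    then show "(y, u, p) \<in> manifest_behavior sols \<Sigma>" by (auto simp: manifest_behavior_def)
  qed
  then show ?thesis using lpv' k sel(1) by blast
qed

lemma zero_reachable:
  assumes "q \<in> sched \<Sigma>" shows "0\<^sub>v n \<in> reachable"
proof -
  have "const_signal (0\<^sub>v n) (0::'t) \<in> reachable"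
    unfolding reachable_def using zero_sol[OF sig_const[OF assms]] const_signal_apply[OF order_refl, of "0\<^sub>v n"] by blast
  then show ?thesis by simp
qed

text \<open>A trajectory ending in \<open>v\<close> is prolonged with constant input
  \<open>w\<close> and constant schedule \<open>q\<close>. All further states are reachable, so the
  right-hand side of the state equation at the switch stays in their span.\<close>

lemma reachable_generator:
  assumes q: "q \<in> sched \<Sigma>" and v: "v \<in> reachable" and w: "w \<in> carrier_vec (nu \<Sigma>)"
  shows "Aof \<Sigma> q *\<^sub>v v + Bof \<Sigma> q *\<^sub>v w \<in> vec_span n reachable"
proof -
  obtain x y u p r where x: "r \<ge> 0" "sol x y u p" "x 0 = 0\<^sub>v n" "v = x r" using v by (auto simp: reachable_def)
  obtain x' y' where x': "sol x' y' (const_signal w) (const_signal q)" "x' 0 = x r"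
    using sol_exists[OF lpv sig_const[OF w] sig_const[OF q] sol_state[OF x(2,1)]] by blast
  have "x' t \<in> vec_span n reachable" if t: "t \<ge> 0" for t
  proof -
    note c = free_concat[OF x(2,1) x']
    have "concat_at r x x' 0 = 0\<^sub>v n" using c(3) x(3) by simp
    moreover have "r + t \<ge> 0" using x(1) t by simp
    ultimately have "concat_at r x x' (r + t) \<in> reachable" unfolding reachable_def using c(1) by blast
    then show ?thesis using c(2)[OF t] subset_vec_span[OF reachable_carrier] by auto
  qed
  then have "Aof \<Sigma> q *\<^sub>v x' 0 + Bof \<Sigma> q *\<^sub>v w \<in> vec_span n reachable"
    by (rule sol_const_generator[OF lpv vec_subspace_span[OF reachable_carrier] x'(1)])
  then show ?thesis using x'(2) x(4) by simp
qed

text \<open>Taking the state zero isolates \<open>Bof\<close>, taking the input zero isolates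
  \<open>Aof\<close>. The latter result is extended from \<open>reachable\<close> to its span by a
  preimage subspace.\<close>

lemma reachable_span_invariant:
  assumes q: "q \<in> sched \<Sigma>"
  shows "v \<in> vec_span n reachable \<Longrightarrow> Aof \<Sigma> q *\<^sub>v v \<in> vec_span n reachable"
    and "w \<in> carrier_vec (nu \<Sigma>) \<Longrightarrow> Bof \<Sigma> q *\<^sub>v w \<in> vec_span n reachable"
proof -
  let ?V = "vec_span n reachable"
  note V = vec_subspace_span[OF reachable_carrier]
  note A = Aof_carrier[of \<Sigma> q] and B = Bof_carrier[of \<Sigma> q]
  show "Bof \<Sigma> q *\<^sub>v w \<in> ?V" if w: "w \<in> carrier_vec (nu \<Sigma>)" for w
    using reachable_generator[OF q zero_reachable[OF q] w] mult_mat_zero_vec[OF A]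
      mult_mat_vec_carrier[OF B w] by simp
  define W where "W = {v \<in> carrier_vec n. Aof \<Sigma> q *\<^sub>v v \<in> ?V}"
  have "vec_subspace n W"
    unfolding W_def using vec_subspace_zero[OF V] vec_subspace_lincomb[OF V] mult_mat_zero_vec[OF A]
    by (intro vec_subspaceI) (auto simp: mult_mat_vec_lincomb[OF A])
  moreover have "reachable \<subseteq> W"
  proof
    fix v assume v: "v \<in> reachable"
    then have vc: "v \<in> carrier_vec n" using reachable_carrier by blast
    have "Aof \<Sigma> q *\<^sub>v v \<in> ?V"
      using reachable_generator[OF q v zero_carrier_vec] mult_mat_zero_vec[OF B] mult_mat_vec_carrier[OF A vc] by simp
    then show "v \<in> W" using vc by (simp add: W_def)
  qed
  ultimately have "?V \<subseteq> W" by (rule vec_span_minimal[OF reachable_carrier])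
  then show "Aof \<Sigma> q *\<^sub>v v \<in> ?V" if "v \<in> ?V" using that by (auto simp: W_def)
qed

text \<open>The restriction to the reachable span. It reproduces the trajectories that start in the
  span, hence merely an inclusion of behaviors; controllability supplies such a start for every
  trajectory.\<close>

lemma not_span_reachable_imp_smaller_system:
  assumes "vec_span n reachable \<noteq> carrier_vec n"
  obtains \<Sigma>' where "is_lpv_ssa \<Sigma>'" "nx \<Sigma>' < n" "manifest_behavior sols \<Sigma>' \<subseteq> manifest_behavior sols \<Sigma>"
    "\<And>x y u p. sol x y u p \<Longrightarrow> x 0 \<in> vec_span n reachable \<Longrightarrow> (y, u, p) \<in> manifest_behavior sols \<Sigma>'"
proof -
  let ?V = "vec_span n reachable"
  note V = vec_subspace_span[OF reachable_carrier]
  obtain k T S where T: "T \<in> carrier_mat n k" and S: "S \<in> carrier_mat k n" and ST: "S * T = 1\<^sub>m k"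
    and im: "?V = (\<lambda>v. T *\<^sub>v v) ` carrier_vec k" and k: "k < n"
    using vec_subspace_basis[OF V] assms by metis
  define \<Sigma>' where "\<Sigma>' = compress k S T \<Sigma>"
  have lpv': "is_lpv_ssa \<Sigma>'" unfolding \<Sigma>'_def by (rule is_lpv_ssa_compress[OF lpv S T])
  have sel: "nx \<Sigma>' = k" "nu \<Sigma>' = nu \<Sigma>" "ny \<Sigma>' = ny \<Sigma>" "np \<Sigma>' = np \<Sigma>" "sched \<Sigma>' = sched \<Sigma>"
    by (simp_all add: \<Sigma>'_def)
  have TS: "T *\<^sub>v (S *\<^sub>v x) = x" if x: "x \<in> ?V" for x
  proof -
    obtain v where v: "v \<in> carrier_vec k" "x = T *\<^sub>v v" using x im by blast
    then show ?thesis using assoc_mult_mat_vec[OF S T v(1)] ST by simp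
  qed
  have inter: "Aof \<Sigma> q * T = T * Aof \<Sigma>' q \<and> Bof \<Sigma> q = T * Bof \<Sigma>' q \<and>
      Cof \<Sigma> q * T = Cof \<Sigma>' q \<and> Dof \<Sigma> q = Dof \<Sigma>' q" if "q \<in> sched \<Sigma>'" for q
  proof (intro conjI)
    have q: "q \<in> sched \<Sigma>" using that sel by simp
    note A = Aof_carrier[of \<Sigma> q] and B = Bof_carrier[of \<Sigma> q]
    have SA: "S * Aof \<Sigma> q \<in> carrier_mat k n" using S A by simp
    have SAT: "S * Aof \<Sigma> q * T \<in> carrier_mat k k" using SA T by simp
    show "Aof \<Sigma> q * T = T * Aof \<Sigma>' q"
      unfolding \<Sigma>'_def Aof_compress[OF lpv S T]
    proof (rule mat_eq_on_vecI[OF mult_carrier_mat[OF A T] mult_carrier_mat[OF T SAT]])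
      fix v :: "real vec" assume v: "v \<in> carrier_vec k"
      have Tv: "T *\<^sub>v v \<in> ?V" "T *\<^sub>v v \<in> carrier_vec n" using v im T by auto
      have Av: "Aof \<Sigma> q *\<^sub>v (T *\<^sub>v v) \<in> ?V" by (rule reachable_span_invariant(1)[OF q Tv(1)])
      show "(Aof \<Sigma> q * T) *\<^sub>v v = (T * (S * Aof \<Sigma> q * T)) *\<^sub>v v"
        using TS[OF Av] assoc_mult_mat_vec[OF A T v] assoc_mult_mat_vec[OF T SAT v]
          assoc_mult_mat_vec[OF SA T v] assoc_mult_mat_vec[OF S A Tv(2)] by simp
    qed
    have SB: "S * Bof \<Sigma> q \<in> carrier_mat k (nu \<Sigma>)" using S B by simp
    show "Bof \<Sigma> q = T * Bof \<Sigma>' q"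
      unfolding \<Sigma>'_def Bof_compress[OF lpv S T]
    proof (rule mat_eq_on_vecI[OF B mult_carrier_mat[OF T SB]])
      fix w :: "real vec" assume w: "w \<in> carrier_vec (nu \<Sigma>)"
      show "Bof \<Sigma> q *\<^sub>v w = (T * (S * Bof \<Sigma> q)) *\<^sub>v w"
        using TS[OF reachable_span_invariant(2)[OF q w]] assoc_mult_mat_vec[OF T SB w]
          assoc_mult_mat_vec[OF S B w] by simp
    qed
    show "Cof \<Sigma> q * T = Cof \<Sigma>' q" unfolding \<Sigma>'_def by (rule Cof_compress[OF lpv S T, symmetric])
    show "Dof \<Sigma> q = Dof \<Sigma>' q" unfolding \<Sigma>'_def by (rule Dof_compress[OF lpv S T, symmetric])
  qed
  have T': "T \<in> carrier_mat n (nx \<Sigma>')" using T sel by simp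
  have map: "sol (ext (\<lambda>t. T *\<^sub>v z t)) y u p" if "(z, y, u, p) \<in> sols \<Sigma>'" for z y u p
    by (rule sol_intertwine[OF lpv' lpv sel(2-5)[symmetric] T' inter that])
  show ?thesis
  proof (rule that[OF lpv'])
    show "nx \<Sigma>' < n" using sel k by simp
    show "manifest_behavior sols \<Sigma>' \<subseteq> manifest_behavior sols \<Sigma>"
      using map unfolding manifest_behavior_def by blast
    fix x y u p assume x: "sol x y u p" "x 0 \<in> ?V"
    have "S *\<^sub>v x 0 \<in> carrier_vec (nx \<Sigma>')" using S sol_state[OF x(1) order_refl] sel by simp
    then obtain z y' where z: "(z, y', u, p) \<in> sols \<Sigma>'" "z 0 = S *\<^sub>v x 0"
      using sol_exists[OF lpv', of u p] sol_input[OF x(1)] sol_sched[OF x(1)] unfolding sel by blast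
    have "x 0 = ext (\<lambda>t. T *\<^sub>v z t) 0" using TS[OF x(2)] z(2) by simp
    then have "\<forall>\<^sub>F t in F. t \<ge> 0 \<longrightarrow> y t = y' t"
      using sol_unique[OF lpv x(1) map[OF z(1)]] by simp
    then have "(z, y, u, p) \<in> sols \<Sigma>'"
      using sol_output_cong[OF lpv' z(1)] sol_output[OF x(1)] unfolding sel by blast
    then show "(y, u, p) \<in> manifest_behavior sols \<Sigma>'" by (auto simp: manifest_behavior_def)
  qed
qed

text \<open>Steering from the zero trajectory along an observing schedule forces the initial state to
  be zero, so every trajectory of a controllable behavior continues a reachable state.\<close>

lemma controllable_imp_reachable_start:
  assumes rc: "RC \<Sigma>" and obs: "observable sols \<Sigma>"
    and ctrl: "controllable (\<lambda>Q. eventually Q F) (manifest_behavior sols \<Sigma>)"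
    and s1: "sol x1 y1 u1 p1"
  obtains x where "sol x y1 u1 p1" "x 0 \<in> reachable"
proof -
  have un: "unobs = {0\<^sub>v n}" using obs observable_iff_unobs by simp
  obtain p s where p: "p \<in> schedules" "s \<ge> 0" "unobs_under p s = {0\<^sub>v n}"
    by (rule observing_schedule[OF rc un])
  \<comment> \<open>Controllability is applied with the zero trajectory first, the given one second,
    and agreement up to time \<open>s\<close>, so that the observing schedule runs its full
    length.\<close>
  have b0: "(const_signal (0\<^sub>v (ny \<Sigma>)), no_input, p) \<in> manifest_behavior sols \<Sigma>"
    using zero_sol[OF p(1)] by (auto simp: manifest_behavior_def)
  have b1: "(y1, u1, p1) \<in> manifest_behavior sols \<Sigma>" using s1 by (auto simp: manifest_behavior_def)
  obtain y u p' \<tau> where B: "(y, u, p') \<in> manifest_behavior sols \<Sigma>" and \<tau>: "\<tau> > 0"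
    and y0: "\<forall>\<^sub>F r in F. r \<in> {0..s} \<longrightarrow> y r = const_signal (0\<^sub>v (ny \<Sigma>)) r"
    and u0: "\<forall>r\<in>{0..s}. u r = no_input r \<and> p' r = p r"
    and ylate: "\<forall>\<^sub>F r in F. r \<ge> s + \<tau> \<longrightarrow> y r = y1 (r - s - \<tau>)"
    and ulate: "\<forall>r\<ge>s + \<tau>. u r = u1 (r - s - \<tau>) \<and> p' r = p1 (r - s - \<tau>)"
    using ctrl[unfolded controllable_def, rule_format, OF b0, simplified, rule_format, OF b1, simplified, rule_format, OF p(2)]
    by auto
  obtain x where x: "sol x y u p'" using B by (auto simp: manifest_behavior_def)
  \<comment> \<open>The joined signals agree with \<open>no_input\<close> and \<open>p\<close> only
    up to \<open>s\<close>, whereas \<open>unobs_under\<close> asks for a solution with these on the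
    whole axis. Causality transfers the vanishing output to \<open>w\<close>.\<close>
  obtain w z where w: "sol w z no_input p" "w 0 = x 0"
    using free_sol[OF p(1) sol_state[OF x order_refl]] by blast
  have "\<forall>\<^sub>F t in F. 0 \<le> t \<and> t < s \<longrightarrow> z t = y t"
    by (rule sol_causal[OF w(1) x w(2) p(2)]) (use u0 in auto)
  with y0 have "\<forall>\<^sub>F t in F. 0 \<le> t \<and> t < s \<longrightarrow> z t = 0\<^sub>v (ny \<Sigma>)"
    by eventually_elim auto
  then have "x 0 \<in> unobs_under p s" unfolding unobs_under_def using w by blast
  then have x0: "x 0 = 0\<^sub>v n" using p(3) by simp
  define r where "r = s + \<tau>"
  have r: "r \<ge> 0" using p(2) \<tau> by (simp add: r_def)
  have d: "t + r - s - \<tau> = t" for t by (simp add: r_def diff_diff_add)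
  have ge: "t + r \<ge> s + \<tau>" if "t \<ge> 0" for t using that by (simp add: r_def)
  \<comment> \<open>After the shift by \<open>r\<close> the tail is exactly the second signal, also
    off the time axis, where both are undefined.\<close>
  have shift_eq: "shift r f = f1" if "\<And>t. t \<ge> r \<Longrightarrow> f t = f1 (t - s - \<tau>)" "ext f1 = f1" for f f1 :: "'t signal"
  proof
    fix t
    show "shift r f t = f1 t"
    proof (cases "t \<ge> 0")
      case True
      then have "r \<le> t + r" by simp
      from that(1)[OF this] show ?thesis by (simp only: shift_apply[OF True] d)
    next
      case False
      then have "f1 t = undefined" using that(2) by (metis atLeast_iff restrict_apply)
      then show ?thesis using False by (simp add: shift_def)
    qed
  qed
  have "shift r u = u1"
    by (rule shift_eq[OF _ sig_ext[OF sol_input[OF s1]]]) (use ulate in \<open>simp add: r_def\<close>)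
  moreover have "shift r p' = p1"
    by (rule shift_eq[OF _ sig_ext[OF sol_sched[OF s1]]]) (use ulate in \<open>simp add: r_def\<close>)
  ultimately have sh: "sol (shift r x) (shift r y) u1 p1" using sol_shift[OF lpv x r] by simp
  have "\<forall>\<^sub>F t in F. t \<ge> r \<longrightarrow> (t - r \<ge> 0 \<longrightarrow> y1 (t - r) = shift r y (t - r))"
    using ylate
  proof (rule eventually_mono, intro impI)
    fix t assume h: "s + \<tau> \<le> t \<longrightarrow> y t = y1 (t - s - \<tau>)" and t: "r \<le> t" "0 \<le> t - r"
    show "y1 (t - r) = shift r y (t - r)" using h t by (simp add: shift_def r_def diff_diff_add)
  qed
  from F_shift[OF r this] have "\<forall>\<^sub>F t in F. t \<ge> 0 \<longrightarrow> y1 t = shift r y t"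
    by (rule eventually_mono) auto
  then have "sol (shift r x) y1 u1 p1" by (rule sol_output_cong[OF lpv sh sol_output[OF s1]])
  moreover have "shift r x 0 \<in> reachable"
    unfolding reachable_def shift_def using x x0 r by (auto intro!: exI)
  ultimately show ?thesis by (rule that)
qed

theorem minimal_realization_iff:
  assumes rc: "RC \<Sigma>" and real: "realization sols \<Sigma> \<B>" and ctrl: "controllable (\<lambda>Q. eventually Q F) \<B>"
  shows "minimal_realization sols \<Sigma> \<B> \<longleftrightarrow> span_reachable sols \<Sigma> (0\<^sub>v n) \<and> observable sols \<Sigma>"
proof
  have B: "\<B> = manifest_behavior sols \<Sigma>" using real by (simp add: realization_def)
  assume min: "minimal_realization sols \<Sigma> \<B>"
  have no_smaller: "n \<le> nx \<Sigma>'" if "is_lpv_ssa \<Sigma>'" "manifest_behavior sols \<Sigma>' = manifest_behavior sols \<Sigma>" for \<Sigma>'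
    using min that B by (simp add: minimal_realization_def realization_def)
  have "unobs = {0\<^sub>v n}"
  proof (rule ccontr)
    assume "unobs \<noteq> {0\<^sub>v n}"
    then obtain \<Sigma>' where "is_lpv_ssa \<Sigma>'" "nx \<Sigma>' < n" "manifest_behavior sols \<Sigma>' = manifest_behavior sols \<Sigma>"
      using not_observable_imp_smaller_realization by blast
    then show False using no_smaller[of \<Sigma>'] by simp
  qed
  then have obs: "observable sols \<Sigma>" using observable_iff_unobs by simp
  \<comment> \<open>Observability has to come first, since a reachable start of each trajectory is
    forced by an observing schedule.\<close>
  have "vec_span n reachable = carrier_vec n"
  proof (rule ccontr)
    assume "vec_span n reachable \<noteq> carrier_vec n"
    then obtain \<Sigma>' where S': "is_lpv_ssa \<Sigma>'" "nx \<Sigma>' < n" "manifest_behavior sols \<Sigma>' \<subseteq> manifest_behavior sols \<Sigma>"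
      "\<And>x y u p. sol x y u p \<Longrightarrow> x 0 \<in> vec_span n reachable \<Longrightarrow> (y, u, p) \<in> manifest_behavior sols \<Sigma>'"
      using not_span_reachable_imp_smaller_system by blast
    have "(y, u, p) \<in> manifest_behavior sols \<Sigma>'" if yup: "(y, u, p) \<in> manifest_behavior sols \<Sigma>" for y u p
    proof -
      obtain x1 where x1: "sol x1 y u p" using yup by (auto simp: manifest_behavior_def)
      obtain x where "sol x y u p" "x 0 \<in> reachable"
        using controllable_imp_reachable_start[OF rc obs ctrl[unfolded B] x1] by blast
      then show ?thesis using S'(4) subset_vec_span[OF reachable_carrier] by blast
    qed
    then have "manifest_behavior sols \<Sigma>' = manifest_behavior sols \<Sigma>" using S'(3) by auto
    then show False using no_smaller[OF S'(1)] S'(2) by simp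
  qed
  then show "span_reachable sols \<Sigma> (0\<^sub>v n) \<and> observable sols \<Sigma>" using obs span_reachable_iff by simp
next
  assume "span_reachable sols \<Sigma> (0\<^sub>v n) \<and> observable sols \<Sigma>"
  then have obs: "observable sols \<Sigma>" by simp
  show "minimal_realization sols \<Sigma> \<B>"
    unfolding minimal_realization_def
  proof (intro conjI allI impI real)
    fix \<Sigma>' assume "realization sols \<Sigma>' \<B>"
    then have "is_lpv_ssa \<Sigma>'" "manifest_behavior sols \<Sigma> = manifest_behavior sols \<Sigma>'"
      using real by (simp_all add: realization_def)
    then show "n \<le> nx \<Sigma>'" by (rule observable_imp_dim_le[OF rc obs])
  qed
qed

end

section \<open>Discrete time\<close>

lemma lincomb_add_vec:
  fixes p q v w :: "real vec"
  assumes "p \<in> carrier_vec m" "q \<in> carrier_vec m" "v \<in> carrier_vec m" "w \<in> carrier_vec m"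
  shows "(a \<cdot>\<^sub>v p + b \<cdot>\<^sub>v q) + (a \<cdot>\<^sub>v v + b \<cdot>\<^sub>v w) = a \<cdot>\<^sub>v (p + v) + b \<cdot>\<^sub>v (q + w)"
  using assms by (intro eq_vecI) (auto simp: algebra_simps)

lemma output_eq_lincomb:
  fixes A B :: "real mat"
  assumes A: "A \<in> carrier_mat m n" and B: "B \<in> carrier_mat m k"
    and "x \<in> carrier_vec n" "x' \<in> carrier_vec n" "u \<in> carrier_vec k" "u' \<in> carrier_vec k"
  shows "A *\<^sub>v (a \<cdot>\<^sub>v x + b \<cdot>\<^sub>v x') + B *\<^sub>v (a \<cdot>\<^sub>v u + b \<cdot>\<^sub>v u') =
    a \<cdot>\<^sub>v (A *\<^sub>v x + B *\<^sub>v u) + b \<cdot>\<^sub>v (A *\<^sub>v x' + B *\<^sub>v u')"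
proof -
  show ?thesis
    unfolding mult_mat_vec_lincomb[OF A assms(3,4)] mult_mat_vec_lincomb[OF B assms(5,6)]
    by (rule lincomb_add_vec[of _ m]) (use assms in auto)
qed

lemma intertwine_state:
  fixes A B A' B' T :: "real mat"
  assumes A: "A \<in> carrier_mat n n" and B: "B \<in> carrier_mat n k" and A': "A' \<in> carrier_mat m m"
    and T: "T \<in> carrier_mat m n" and x: "x \<in> carrier_vec n" and u: "u \<in> carrier_vec k"
    and AT: "A' * T = T * A" and BT: "B' = T * B"
  shows "A' *\<^sub>v (T *\<^sub>v x) + B' *\<^sub>v u = T *\<^sub>v (A *\<^sub>v x + B *\<^sub>v u)"
proof -
  have "A *\<^sub>v x \<in> carrier_vec n" "B *\<^sub>v u \<in> carrier_vec n" using assms by auto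
  then have "T *\<^sub>v (A *\<^sub>v x + B *\<^sub>v u) = T *\<^sub>v (A *\<^sub>v x) + T *\<^sub>v (B *\<^sub>v u)"
    by (rule mult_add_distrib_mat_vec[OF T])
  moreover have "A' *\<^sub>v (T *\<^sub>v x) = T *\<^sub>v (A *\<^sub>v x)"
    using assoc_mult_mat_vec[OF A' T x] assoc_mult_mat_vec[OF T A x] AT by simp
  moreover have "B' *\<^sub>v u = T *\<^sub>v (B *\<^sub>v u)" using assoc_mult_mat_vec[OF T B u] BT by simp
  ultimately show ?thesis by simp
qed

lemma regular_schedule_nonempty: "regular_schedule k P \<Longrightarrow> P \<noteq> {}"
  by (auto simp: regular_schedule_def)

lemma invertible_mat_cancel:
  fixes A :: "real mat"
  assumes A: "A \<in> carrier_mat n n" and inv: "invertible_mat A" and x: "x \<in> carrier_vec n" "x' \<in> carrier_vec n"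
    and eq: "A *\<^sub>v x = A *\<^sub>v x'"
  shows "x = x'"
proof -
  obtain B where B: "inverts_mat A B" "inverts_mat B A" using inv by (auto simp: invertible_mat_def)
  \<comment> \<open>\<open>inverts_mat\<close> does not fix the shape of \<open>B\<close>; it
    follows from comparing dimensions in the two products.\<close>
  have BA: "B * A = 1\<^sub>m (dim_row B)" using B(2) by (simp add: inverts_mat_def)
  have AB: "A * B = 1\<^sub>m n" using B(1) A by (simp add: inverts_mat_def)
  have "dim_col (A * B) = dim_col (1\<^sub>m n :: real mat)" by (simp only: AB)
  then have dc: "dim_col B = n" by simp
  have "dim_col (B * A) = dim_col (1\<^sub>m (dim_row B) :: real mat)" by (simp only: BA)
  then have dr: "dim_row B = n" using A by simp
  have Bc: "B \<in> carrier_mat n n" using dc dr by auto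
  have "B *\<^sub>v (A *\<^sub>v z) = z" if "z \<in> carrier_vec n" for z
    using assoc_mult_mat_vec[OF Bc A that] BA dr that by simp
  then show ?thesis using eq x by metis
qed

lemma ext_nat: "ext f = (f :: nat \<Rightarrow> 'a)"
  by (auto simp: fun_eq_iff)

lemma dt_solutions_iff:
  "(x, y, u, p) \<in> dt_solutions \<Sigma> \<longleftrightarrow>
     (\<forall>t. x t \<in> carrier_vec (nx \<Sigma>)) \<and> (\<forall>t. y t \<in> carrier_vec (ny \<Sigma>)) \<and>
     (\<forall>t. u t \<in> carrier_vec (nu \<Sigma>)) \<and> (\<forall>t. p t \<in> sched \<Sigma>) \<and>
     (\<forall>t. x (Suc t) = Aof \<Sigma> (p t) *\<^sub>v x t + Bof \<Sigma> (p t) *\<^sub>v u t) \<and>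
     (\<forall>t. y t = Cof \<Sigma> (p t) *\<^sub>v x t + Dof \<Sigma> (p t) *\<^sub>v u t)"
  by (auto simp: dt_solutions_def Pi_iff)

lemma dt_sol_exists:
  assumes u: "\<And>t. u t \<in> carrier_vec (nu \<Sigma>)" and p: "\<And>t. p t \<in> sched \<Sigma>" and x0: "x0 \<in> carrier_vec (nx \<Sigma>)"
  shows "\<exists>x y. (x, y, u, p) \<in> dt_solutions \<Sigma> \<and> x 0 = x0"
proof -
  define x where "x = rec_nat x0 (\<lambda>t z. Aof \<Sigma> (p t) *\<^sub>v z + Bof \<Sigma> (p t) *\<^sub>v u t)"
  have x: "x 0 = x0" "\<And>t. x (Suc t) = Aof \<Sigma> (p t) *\<^sub>v x t + Bof \<Sigma> (p t) *\<^sub>v u t" by (simp_all add: x_def)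
  have xc: "x t \<in> carrier_vec (nx \<Sigma>)" for t
  proof (induction t)
    case (Suc t)
    then show ?case unfolding x(2)
      using mult_mat_vec_carrier[OF Aof_carrier Suc] mult_mat_vec_carrier[OF Bof_carrier u] by simp
  qed (simp add: x x0)
  have "(x, \<lambda>t. Cof \<Sigma> (p t) *\<^sub>v x t + Dof \<Sigma> (p t) *\<^sub>v u t, u, p) \<in> dt_solutions \<Sigma>"
    unfolding dt_solutions_iff
    using x xc u p mult_mat_vec_carrier[OF Cof_carrier xc] mult_mat_vec_carrier[OF Dof_carrier u] by simp
  then show ?thesis using x(1) by blast
qed

lemma dt_sol_unique:
  assumes "(x, y, u, p) \<in> dt_solutions \<Sigma>" "(x', y', u, p) \<in> dt_solutions \<Sigma>" "x 0 = x' 0"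
  shows "x = x'" "y = y'"
proof -
  have 1: "x (Suc t) = Aof \<Sigma> (p t) *\<^sub>v x t + Bof \<Sigma> (p t) *\<^sub>v u t"
    "y t = Cof \<Sigma> (p t) *\<^sub>v x t + Dof \<Sigma> (p t) *\<^sub>v u t" for t
    using assms(1) unfolding dt_solutions_iff by blast+
  have 2: "x' (Suc t) = Aof \<Sigma> (p t) *\<^sub>v x' t + Bof \<Sigma> (p t) *\<^sub>v u t"
    "y' t = Cof \<Sigma> (p t) *\<^sub>v x' t + Dof \<Sigma> (p t) *\<^sub>v u t" for t
    using assms(2) unfolding dt_solutions_iff by blast+
  have x: "x t = x' t" for t using assms(3) by (induction t) (simp_all add: 1(1) 2(1))
  then show "x = x'" by blast
  show "y = y'" using x by (simp add: fun_eq_iff 1(2) 2(2))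
qed

lemma dt_sol_lincomb:
  assumes 1: "(x, y, u, p) \<in> dt_solutions \<Sigma>" and 2: "(x', y', u', p) \<in> dt_solutions \<Sigma>"
  shows "(\<lambda>t. a \<cdot>\<^sub>v x t + b \<cdot>\<^sub>v x' t, \<lambda>t. a \<cdot>\<^sub>v y t + b \<cdot>\<^sub>v y' t, \<lambda>t. a \<cdot>\<^sub>v u t + b \<cdot>\<^sub>v u' t, p) \<in> dt_solutions \<Sigma>"
proof -
  have c: "x t \<in> carrier_vec (nx \<Sigma>)" "x' t \<in> carrier_vec (nx \<Sigma>)" "u t \<in> carrier_vec (nu \<Sigma>)" "u' t \<in> carrier_vec (nu \<Sigma>)"
    "y t \<in> carrier_vec (ny \<Sigma>)" "y' t \<in> carrier_vec (ny \<Sigma>)" "p t \<in> sched \<Sigma>" for t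
    using 1 2 unfolding dt_solutions_iff by blast+
  have e: "x (Suc t) = Aof \<Sigma> (p t) *\<^sub>v x t + Bof \<Sigma> (p t) *\<^sub>v u t"
    "x' (Suc t) = Aof \<Sigma> (p t) *\<^sub>v x' t + Bof \<Sigma> (p t) *\<^sub>v u' t"
    "y t = Cof \<Sigma> (p t) *\<^sub>v x t + Dof \<Sigma> (p t) *\<^sub>v u t"
    "y' t = Cof \<Sigma> (p t) *\<^sub>v x' t + Dof \<Sigma> (p t) *\<^sub>v u' t" for t
    using 1 2 unfolding dt_solutions_iff by blast+
  show ?thesis
    unfolding dt_solutions_iff
    unfolding output_eq_lincomb[OF Aof_carrier Bof_carrier c(1-4)]
        output_eq_lincomb[OF Cof_carrier Dof_carrier c(1-4)] e[symmetric]
    by (auto intro!: add_carrier_vec smult_carrier_vec c)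
qed

lemma dt_sol_intertwine:
  assumes T: "T \<in> carrier_mat (nx \<Sigma>') (nx \<Sigma>)" and dims: "nu \<Sigma>' = nu \<Sigma>" "ny \<Sigma>' = ny \<Sigma>" "sched \<Sigma>' = sched \<Sigma>"
    and int: "\<And>q. q \<in> sched \<Sigma> \<Longrightarrow> Aof \<Sigma>' q * T = T * Aof \<Sigma> q \<and> Bof \<Sigma>' q = T * Bof \<Sigma> q \<and>
           Cof \<Sigma>' q * T = Cof \<Sigma> q \<and> Dof \<Sigma>' q = Dof \<Sigma> q"
    and s: "(x, y, u, p) \<in> dt_solutions \<Sigma>"
  shows "(\<lambda>t. T *\<^sub>v x t, y, u, p) \<in> dt_solutions \<Sigma>'"
proof -
  have c: "x t \<in> carrier_vec (nx \<Sigma>)" "u t \<in> carrier_vec (nu \<Sigma>)" "y t \<in> carrier_vec (ny \<Sigma>)" "p t \<in> sched \<Sigma>" for t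
    using s unfolding dt_solutions_iff by blast+
  have e: "x (Suc t) = Aof \<Sigma> (p t) *\<^sub>v x t + Bof \<Sigma> (p t) *\<^sub>v u t"
    "y t = Cof \<Sigma> (p t) *\<^sub>v x t + Dof \<Sigma> (p t) *\<^sub>v u t" for t
    using s unfolding dt_solutions_iff by blast+
  have "T *\<^sub>v x (Suc t) = Aof \<Sigma>' (p t) *\<^sub>v (T *\<^sub>v x t) + Bof \<Sigma>' (p t) *\<^sub>v u t" for t
    unfolding e(1)
    using int[OF c(4)] intertwine_state[OF Aof_carrier Bof_carrier Aof_carrier T c(1,2)] by metis
  moreover have "y t = Cof \<Sigma>' (p t) *\<^sub>v (T *\<^sub>v x t) + Dof \<Sigma>' (p t) *\<^sub>v u t" for t
    using e(2)[of t] int[OF c(4)[of t]] assoc_mult_mat_vec[OF Cof_carrier[of \<Sigma>' "p t"] T c(1)[of t]] by simp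
  ultimately show ?thesis
    unfolding dt_solutions_iff using c dims mult_mat_vec_carrier[OF T c(1)] by simp
qed

text \<open>A step is undone by cancelling the common input term and inverting
  \<open>Aof \<Sigma> (p s)\<close>, which RC permits.\<close>

lemma dt_sol_backward:
  assumes rc: "dt_RC \<Sigma>" and 1: "(x, y, u, p) \<in> dt_solutions \<Sigma>" and 2: "(x', y', u, p) \<in> dt_solutions \<Sigma>"
  shows "x s = x' s \<Longrightarrow> x 0 = x' 0"
proof (induction s)
  case (Suc s)
  have c: "x s \<in> carrier_vec (nx \<Sigma>)" "x' s \<in> carrier_vec (nx \<Sigma>)" "u s \<in> carrier_vec (nu \<Sigma>)" "p s \<in> sched \<Sigma>"
    using 1 2 unfolding dt_solutions_iff by blast+
  have "Aof \<Sigma> (p s) *\<^sub>v x s + Bof \<Sigma> (p s) *\<^sub>v u s = Aof \<Sigma> (p s) *\<^sub>v x' s + Bof \<Sigma> (p s) *\<^sub>v u s"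
    using Suc.prems 1 2 unfolding dt_solutions_iff by metis
  then have "Aof \<Sigma> (p s) *\<^sub>v x s = Aof \<Sigma> (p s) *\<^sub>v x' s"
    using mult_mat_vec_carrier[OF Aof_carrier c(1), of "p s"] mult_mat_vec_carrier[OF Aof_carrier c(2), of "p s"]
      mult_mat_vec_carrier[OF Bof_carrier c(3), of "p s"]
    by (metis add_minus_cancel_vec)
  then have "x s = x' s"
    using rc c by (intro invertible_mat_cancel[OF Aof_carrier _ c(1,2)]) (auto simp: dt_RC_def)
  then show ?case by (rule Suc.IH)
qed

lemma dt_sol_concat:
  assumes 1: "(x, y, u, p) \<in> dt_solutions \<Sigma>" and 2: "(x', y', u', p') \<in> dt_solutions \<Sigma>" and eq: "x' 0 = x s"
  shows "(concat_at s x x', concat_at s y y', concat_at s u u', concat_at s p p') \<in> dt_solutions \<Sigma>"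
proof -
  have c: "concat_at s f g t = (if t < s then f t else g (t - s))" for f g :: "nat \<Rightarrow> real vec" and t
    unfolding concat_at_def ext_nat ..
  have f: "x t \<in> carrier_vec (nx \<Sigma>)" "y t \<in> carrier_vec (ny \<Sigma>)" "u t \<in> carrier_vec (nu \<Sigma>)" "p t \<in> sched \<Sigma>"
    "x (Suc t) = Aof \<Sigma> (p t) *\<^sub>v x t + Bof \<Sigma> (p t) *\<^sub>v u t"
    "y t = Cof \<Sigma> (p t) *\<^sub>v x t + Dof \<Sigma> (p t) *\<^sub>v u t" for t
    using 1 unfolding dt_solutions_iff by blast+
  have f': "x' t \<in> carrier_vec (nx \<Sigma>)" "y' t \<in> carrier_vec (ny \<Sigma>)" "u' t \<in> carrier_vec (nu \<Sigma>)" "p' t \<in> sched \<Sigma>"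
    "x' (Suc t) = Aof \<Sigma> (p' t) *\<^sub>v x' t + Bof \<Sigma> (p' t) *\<^sub>v u' t"
    "y' t = Cof \<Sigma> (p' t) *\<^sub>v x' t + Dof \<Sigma> (p' t) *\<^sub>v u' t" for t
    using 2 unfolding dt_solutions_iff by blast+
  have *: "concat_at s x x' (Suc t) = Aof \<Sigma> (concat_at s p p' t) *\<^sub>v concat_at s x x' t +
      Bof \<Sigma> (concat_at s p p' t) *\<^sub>v concat_at s u u' t" for t
  proof -
    consider "Suc t < s" | "Suc t = s" | "s \<le> t" by linarith
    then show ?thesis
    proof cases
      case 1
      then show ?thesis by (simp add: c f(5))
    next
      \<comment> \<open>The last step of the first piece lands on \<open>x s\<close>, which is the
        start of the second.\<close>
      case 2
      then have "t < s" by simp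
      then show ?thesis using 2 eq by (simp add: c f(5)[symmetric])
    next
      case 3
      then show ?thesis by (simp add: c f'(5) Suc_diff_le)
    qed
  qed
  have **: "concat_at s y y' t = Cof \<Sigma> (concat_at s p p' t) *\<^sub>v concat_at s x x' t +
      Dof \<Sigma> (concat_at s p p' t) *\<^sub>v concat_at s u u' t" for t
    by (cases "t < s") (simp_all add: c f(6) f'(6))
  show ?thesis
    unfolding dt_solutions_iff
  proof (intro conjI allI * **)
  qed (use f(1-4) f'(1-4) in \<open>simp_all add: c del: index_mult_mat_vec\<close>)
qed

text \<open>Almost all times are all times here, and the generator at time 0 is simply the state at
  time 1.\<close>

interpretation dt: lpv_axis dt_solutions "top_class.top :: nat filter" "\<lambda>_ V. UNIV \<rightarrow> V" dt_RC
proof (unfold_locales, goal_cases)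
  case (1 \<Sigma> x y u p)
  then show ?case unfolding dt_solutions_iff Pi_iff by blast
next
  case (2 w n V)
  then show ?case by (intro ext_nat)
next
  case (3 w n V t)
  then show ?case by auto
next
  case (4 v V n)
  then show ?case by (auto simp: const_signal_def)
next
  case (5 w n V w' s)
  then show ?case unfolding concat_at_def ext_nat by (simp add: Pi_iff)
next
  case (6 \<Sigma> u p x0)
  then show ?case by (intro dt_sol_exists) auto
next
  case (7 \<Sigma> x y u p x' y')
  then show ?case using dt_sol_unique by (metis (mono_tags, lifting) always_eventually)
next
  case (8 \<Sigma> x y u p y')
  then have "y' = y" by (auto simp: eventually_top)
  then show ?case using 8 by simp
next
  case (9 \<Sigma> x y u p x' y' u' a b)
  then show ?case unfolding lincomb_signal_def ext_nat by (intro dt_sol_lincomb)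
next
  case (10 \<Sigma> x y u p s)
  then show ?case unfolding shift_def ext_nat dt_solutions_iff add_Suc by blast
next
  case (11 \<Sigma> x y u p x' y' u' p' s)
  then show ?case by (intro dt_sol_concat)
next
  case (12 \<Sigma> \<Sigma>' T x y u p)
  then show ?case unfolding ext_nat by (intro dt_sol_intertwine) auto
next
  case (13 \<Sigma> x y u p x' y' s)
  then show ?case using dt_sol_backward by blast
next
  case (14 \<Sigma> W x y v q)
  have "x (Suc 0) \<in> W" by (rule 14(4)) simp
  then show ?case using 14(3) by (simp add: dt_solutions_iff)
next
  case (15 \<Sigma> x y q)
  have "y 0 = Cof \<Sigma> q *\<^sub>v x 0 + Dof \<Sigma> q *\<^sub>v 0\<^sub>v (nu \<Sigma>)" using 15(2) by (simp add: dt_solutions_iff)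
  moreover have "y 0 = 0\<^sub>v (ny \<Sigma>)" using 15(3) by (simp add: eventually_top)
  moreover have "Cof \<Sigma> q *\<^sub>v x 0 \<in> carrier_vec (ny \<Sigma>)"
    using 15(2) mult_mat_vec_carrier[OF Cof_carrier] by (auto simp: dt_solutions_iff)
  ultimately show ?case by (simp add: mult_mat_zero_vec[OF Dof_carrier])
next
  case (16 \<Sigma>)
  then show ?case by (auto simp: dt_RC_def dest: regular_schedule_nonempty)
next
  case (17 s P)
  have "P t" for t using 17(2)[unfolded eventually_top, rule_format, of "t + s"] by simp
  then show ?case by (simp add: eventually_top)
next
  case (18 P)
  have "P t" for t using 18[of "Suc t", unfolded eventually_top, rule_format, of t] by simp
  then show ?case by (simp add: eventually_top)
qed

section \<open>Piecewise and absolutely continuous functions\<close>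

abbreviation discontinuities :: "(real \<Rightarrow> real) \<Rightarrow> real \<Rightarrow> real set" where
  "discontinuities f b \<equiv> {t \<in> {0..b}. \<not> continuous (at t within {0..}) f}"

lemma ex_tendsto_cong:
  "eventually (\<lambda>x. f x = g x) F \<Longrightarrow> \<exists>l. (f \<longlongrightarrow> l) F \<Longrightarrow> \<exists>l. (g \<longlongrightarrow> l) F"
  using tendsto_cong by blast

lemma piecewise_continuousI:
  assumes "\<And>b. finite (discontinuities f b)"
    and "\<And>t. t \<ge> 0 \<Longrightarrow> \<exists>l. (f \<longlongrightarrow> l) (at_right t)"
    and "\<And>t. t > 0 \<Longrightarrow> \<exists>l. (f \<longlongrightarrow> l) (at_left t)"
  shows "piecewise_continuous f"
  using assms by (simp add: piecewise_continuous_def)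

lemma piecewise_continuousD:
  assumes "piecewise_continuous f"
  shows "finite (discontinuities f b)"
    and "t \<ge> 0 \<Longrightarrow> \<exists>l. (f \<longlongrightarrow> l) (at_right t)"
    and "t > 0 \<Longrightarrow> \<exists>l. (f \<longlongrightarrow> l) (at_left t)"
  using assms by (auto simp: piecewise_continuous_def)

lemma piecewise_continuous_binary:
  assumes f: "piecewise_continuous f" and g: "piecewise_continuous g"
    and cont: "\<And>F. continuous F f \<Longrightarrow> continuous F g \<Longrightarrow> continuous F (\<lambda>t. h (f t) (g t))"
    and lim: "\<And>F l m. (f \<longlongrightarrow> l) F \<Longrightarrow> (g \<longlongrightarrow> m) F \<Longrightarrow> ((\<lambda>t. h (f t) (g t)) \<longlongrightarrow> h l m) F"
  shows "piecewise_continuous (\<lambda>t. h (f t) (g t))"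
proof (rule piecewise_continuousI)
  fix b
  have "discontinuities (\<lambda>t. h (f t) (g t)) b \<subseteq> discontinuities f b \<union> discontinuities g b"
    using cont by blast
  then show "finite (discontinuities (\<lambda>t. h (f t) (g t)) b)"
    using piecewise_continuousD(1)[OF f] piecewise_continuousD(1)[OF g] finite_subset by blast
next
  fix t :: real
  show "\<exists>l. ((\<lambda>t. h (f t) (g t)) \<longlongrightarrow> l) (at_right t)" if "t \<ge> 0"
    using piecewise_continuousD(2)[OF f that] piecewise_continuousD(2)[OF g that] lim by meson
  show "\<exists>l. ((\<lambda>t. h (f t) (g t)) \<longlongrightarrow> l) (at_left t)" if "t > 0"
    using piecewise_continuousD(3)[OF f that] piecewise_continuousD(3)[OF g that] lim by meson
qed

lemma piecewise_continuous_add: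
  "piecewise_continuous f \<Longrightarrow> piecewise_continuous g \<Longrightarrow> piecewise_continuous (\<lambda>t. f t + g t)"
  by (rule piecewise_continuous_binary) (auto intro: continuous_add tendsto_add)

lemma piecewise_continuous_mult:
  "piecewise_continuous f \<Longrightarrow> piecewise_continuous g \<Longrightarrow> piecewise_continuous (\<lambda>t. f t * g t)"
  by (rule piecewise_continuous_binary) (auto intro: continuous_mult tendsto_mult)

lemma piecewise_continuous_const: "piecewise_continuous (\<lambda>t. c)"
  by (rule piecewise_continuousI) auto

lemma piecewise_continuous_sum:
  "(\<And>i. i \<in> I \<Longrightarrow> piecewise_continuous (f i)) \<Longrightarrow> piecewise_continuous (\<lambda>t. \<Sum>i\<in>I. f i t)"
  by (induction I rule: infinite_finite_induct)
    (auto intro: piecewise_continuous_add piecewise_continuous_const)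

lemma continuous_on_imp_piecewise_continuous:
  assumes "continuous_on {0..} f"
  shows "piecewise_continuous f"
proof (rule piecewise_continuousI)
  have c: "(f \<longlongrightarrow> f t) (at t within {0..})" if "t \<ge> 0" for t
    using assms that by (auto simp: continuous_on_def)
  show "\<exists>l. (f \<longlongrightarrow> l) (at_right t)" if "t \<ge> 0" for t
    using tendsto_within_subset[OF c[OF that], of "{t<..}"] that by (auto simp: subset_eq)
  show "\<exists>l. (f \<longlongrightarrow> l) (at_left t)" if t: "t > 0" for t
  proof -
    have "at t within {0..} = at t" using t by (intro at_within_interior) (simp add: interior_real_atLeast)
    then show ?thesis using c[of t] t by (metis less_imp_le tendsto_within_subset top_greatest)
  qed
  fix b
  have "discontinuities f b = {}" using c by (auto simp: continuous_within)
  then show "finite (discontinuities f b)" by (simp only: finite.emptyI)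
qed

lemma piecewise_continuous_cong:
  assumes f: "piecewise_continuous f" and eq: "\<And>t. t \<ge> 0 \<Longrightarrow> f t = g t"
  shows "piecewise_continuous g"
proof (rule piecewise_continuousI)
  fix b
  have "discontinuities g b \<subseteq> discontinuities f b"
    using eq by (auto intro: continuous_transform_within[of _ "{0..}" f 1])
  then show "finite (discontinuities g b)" using piecewise_continuousD(1)[OF f] finite_subset by blast
next
  fix t :: real
  show "\<exists>l. (g \<longlongrightarrow> l) (at_right t)" if t: "t \<ge> 0"
  proof -
    have "eventually (\<lambda>x. f x = g x) (at_right t)"
      unfolding eventually_at_right_field using t eq by (intro exI[of _ "t+1"]) auto
    then show ?thesis using piecewise_continuousD(2)[OF f t] by (rule ex_tendsto_cong)
  qed
  show "\<exists>l. (g \<longlongrightarrow> l) (at_left t)" if t: "t > 0"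
  proof -
    have "eventually (\<lambda>x. f x = g x) (at_left t)"
      unfolding eventually_at_left_field using t eq by (intro exI[of _ 0]) auto
    then show ?thesis using piecewise_continuousD(3)[OF f t] by (rule ex_tendsto_cong)
  qed
qed

lemma filterlim_shift_at_right: "filterlim (\<lambda>x. x + s) (at_right (t + s)) (at_right (t::real))"
  unfolding filterlim_at
  by (auto intro!: tendsto_intros simp: eventually_at_right_field intro: exI[of _ "t + 1"])

lemma filterlim_shift_at_left: "filterlim (\<lambda>x. x + s) (at_left (t + s)) (at_left (t::real))"
  unfolding filterlim_at
  by (auto intro!: tendsto_intros simp: eventually_at_left_field intro: exI[of _ "t - 1"])

lemma piecewise_continuous_shift:
  assumes f: "piecewise_continuous f" and s: "s \<ge> 0"
  shows "piecewise_continuous (\<lambda>t. f (t + s))"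
proof (rule piecewise_continuousI)
  fix b
  have "discontinuities (\<lambda>t. f (t + s)) b \<subseteq> (\<lambda>t. t - s) ` discontinuities f (b + s)"
  proof
    fix t assume t: "t \<in> discontinuities (\<lambda>t. f (t + s)) b"
    have "\<not> continuous (at (t + s) within {0..}) f"
    proof
      assume "continuous (at (t + s) within {0..}) f"
      then have "continuous (at (t + s) within ((\<lambda>t. t + s) ` {0..})) f"
        using s by (auto intro: continuous_within_subset)
      then have "continuous (at t within {0..}) (f \<circ> (\<lambda>t. t + s))"
        by (intro continuous_within_compose) (auto intro: continuous_intros)
      then show False using t by (simp add: comp_def)
    qed
    then show "t \<in> (\<lambda>t. t - s) ` discontinuities f (b + s)"
      using t s by (intro image_eqI[of _ _ "t + s"]) auto
  qed
  then show "finite (discontinuities (\<lambda>t. f (t + s)) b)"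
    using piecewise_continuousD(1)[OF f] finite_subset by blast
next
  fix t :: real
  show "\<exists>l. ((\<lambda>t. f (t + s)) \<longlongrightarrow> l) (at_right t)" if "t \<ge> 0"
    using piecewise_continuousD(2)[OF f, of "t + s"] that s
      filterlim_compose[OF _ filterlim_shift_at_right[of s t]] by (metis add_nonneg_nonneg)
  show "\<exists>l. ((\<lambda>t. f (t + s)) \<longlongrightarrow> l) (at_left t)" if "t > 0"
    using piecewise_continuousD(3)[OF f, of "t + s"] that s
      filterlim_compose[OF _ filterlim_shift_at_left[of s t]] by (metis add_pos_nonneg)
qed

lemma piecewise_continuous_concat:
  assumes f: "piecewise_continuous f" and g: "piecewise_continuous g" and s: "s \<ge> 0"
  shows "piecewise_continuous (\<lambda>t. if t < s then f t else g (t - s))" (is "piecewise_continuous ?h")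
proof (rule piecewise_continuousI)
  fix b
  \<comment> \<open>The switch at \<open>s\<close> is the only new candidate; the others come from
    \<open>f\<close> before \<open>s\<close> and, shifted, from \<open>g\<close> after it.\<close>
  have "discontinuities ?h b \<subseteq> discontinuities f b \<union> {s} \<union> (\<lambda>t. t + s) ` discontinuities g b"
  proof
    fix t assume t: "t \<in> discontinuities ?h b"
    consider "t < s" | "t = s" | "t > s" by linarith
    then show "t \<in> discontinuities f b \<union> {s} \<union> (\<lambda>t. t + s) ` discontinuities g b"
    proof cases
      case 1
      have "\<not> continuous (at t within {0..}) f"
      proof
        assume "continuous (at t within {0..}) f"
        then have "continuous (at t within {0..}) ?h"
          by (rule continuous_transform_within[where \<delta>="s - t"]) (use 1 t in \<open>auto simp: dist_real_def\<close>)
        then show False using t by simp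
      qed
      then show ?thesis using t by auto
    next
      case 3
      have "\<not> continuous (at (t - s) within {0..}) g"
      proof
        assume "continuous (at (t - s) within {0..}) g"
        then have "continuous (at (t - s) within ((\<lambda>t. t - s) ` {s..})) g"
          by (rule continuous_within_subset) auto
        then have "continuous (at t within {s..}) (g \<circ> (\<lambda>t. t - s))"
          by (intro continuous_within_compose) (auto intro: continuous_intros)
        moreover have "at t within {s..} = at t within {0..}"
          by (rule at_within_nhd[of _ "{s<..}"]) (use 3 s in auto)
        ultimately have "continuous (at t within {0..}) (\<lambda>t. g (t - s))" by (simp add: comp_def)
        then have "continuous (at t within {0..}) ?h"
          by (rule continuous_transform_within[where \<delta>="t - s"]) (use 3 t in \<open>auto simp: dist_real_def\<close>)
        then show False using t by simp
      qed
      then show ?thesis using t 3 s by (auto intro!: image_eqI[of _ _ "t - s"])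
    qed auto
  qed
  then show "finite (discontinuities ?h b)"
    by (rule finite_subset)
      (intro finite_UnI finite_imageI finite.insertI finite.emptyI piecewise_continuousD(1) f g)
next
  fix t :: real
  show "\<exists>l. (?h \<longlongrightarrow> l) (at_right t)" if t: "t \<ge> 0"
  proof (cases "t < s")
    case True
    then have "eventually (\<lambda>x. f x = ?h x) (at_right t)"
      unfolding eventually_at_right_field by (intro exI[of _ s]) auto
    then show ?thesis using piecewise_continuousD(2)[OF f t] by (rule ex_tendsto_cong)
  next
    case False
    then have "eventually (\<lambda>x. g (x - s) = ?h x) (at_right t)"
      unfolding eventually_at_right_field by (intro exI[of _ "t + 1"]) auto
    moreover have "\<exists>l. ((\<lambda>x. g (x - s)) \<longlongrightarrow> l) (at_right t)"
      using piecewise_continuousD(2)[OF g, of "t - s"] False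
        filterlim_compose[OF _ filterlim_shift_at_right[of "-s" t]] by fastforce
    ultimately show ?thesis by (rule ex_tendsto_cong)
  qed
  show "\<exists>l. (?h \<longlongrightarrow> l) (at_left t)" if t: "t > 0"
  proof (cases "t \<le> s")
    case True
    then have "eventually (\<lambda>x. f x = ?h x) (at_left t)"
      unfolding eventually_at_left_field by (intro exI[of _ "t - 1"]) auto
    then show ?thesis using piecewise_continuousD(3)[OF f t] by (rule ex_tendsto_cong)
  next
    case False
    then have "eventually (\<lambda>x. g (x - s) = ?h x) (at_left t)"
      unfolding eventually_at_left_field by (intro exI[of _ s]) auto
    moreover have "\<exists>l. ((\<lambda>x. g (x - s)) \<longlongrightarrow> l) (at_left t)"
      using piecewise_continuousD(3)[OF g, of "t - s"] False
        filterlim_compose[OF _ filterlim_shift_at_left[of "-s" t]] by fastforce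
    ultimately show ?thesis by (rule ex_tendsto_cong)
  qed
qed

text \<open>One-sided limits bound \<open>f\<close> near every point, and Bolzano bisection glues
  the local bounds together.\<close>

lemma piecewise_continuous_bounded:
  assumes f: "piecewise_continuous f"
  obtains K where "K \<ge> 0" "\<And>t. 0 \<le> t \<Longrightarrow> t \<le> b \<Longrightarrow> \<bar>f t\<bar> \<le> K"
proof (cases "0 \<le> b")
  case True
  let ?P = "\<lambda>a b. \<exists>K. \<forall>t\<in>{a..b} \<inter> {0..}. \<bar>f t\<bar> \<le> K"
  have "?P 0 b"
  proof (rule Bolzano[where P = ?P, OF True])
    fix a b c assume trans: "?P a b" "?P b c" "a \<le> b" "b \<le> c"
    then obtain K L where "\<forall>t\<in>{a..b} \<inter> {0..}. \<bar>f t\<bar> \<le> K" "\<forall>t\<in>{b..c} \<inter> {0..}. \<bar>f t\<bar> \<le> L" by blast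
    then have "\<bar>f t\<bar> \<le> max K L" if "t \<in> {a..c} \<inter> {0..}" for t
      using that by (cases "t \<le> b") (force simp: le_max_iff_disj)+
    then show "?P a c" by blast
  next
    fix x assume local: "0 \<le> x" "x \<le> b"
    have loc: "\<exists>K. eventually (\<lambda>y. \<bar>f y\<bar> \<le> K) F" if lim: "\<exists>l. (f \<longlongrightarrow> l) F" for F
    proof -
      obtain l where "(f \<longlongrightarrow> l) F" using lim by blast
      then have "eventually (\<lambda>y. dist (f y) l < 1) F" by (rule tendstoD) simp
      then have "eventually (\<lambda>y. \<bar>f y\<bar> \<le> \<bar>l\<bar> + 1) F"
        by (rule eventually_mono) (auto simp: dist_real_def)
      then show ?thesis by blast
    qed
    obtain K c where K: "c > x" "\<And>y. x < y \<Longrightarrow> y < c \<Longrightarrow> \<bar>f y\<bar> \<le> K"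
      using loc[OF piecewise_continuousD(2)[OF f]] local unfolding eventually_at_right_field by blast
    \<comment> \<open>At 0 no left limit is available, but there is nothing to bound either, because
      only nonnegative arguments count.\<close>
    obtain L a where L: "a < x" "\<And>y. 0 \<le> y \<Longrightarrow> a < y \<Longrightarrow> y < x \<Longrightarrow> \<bar>f y\<bar> \<le> L"
    proof (cases "x = 0")
      case True
      then show ?thesis using that[of "x - 1" 0] by auto
    next
      case False
      then show ?thesis using that local loc[OF piecewise_continuousD(3)[OF f]]
        unfolding eventually_at_left_field by (metis order_le_less)
    qed
    show "\<exists>d>0. \<forall>u v. u \<le> x \<and> x \<le> v \<and> v - u < d \<longrightarrow> ?P u v"
    proof (rule exI[of _ "min (c - x) (x - a)"], intro conjI allI impI)
      show "0 < min (c - x) (x - a)" using K L by simp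
      fix u v assume uv: "u \<le> x \<and> x \<le> v \<and> v - u < min (c - x) (x - a)"
      \<comment> \<open>The value at \<open>x\<close> is listed separately, since the one-sided
        limits say nothing about it.\<close>
      have "\<bar>f t\<bar> \<le> max (max K L) \<bar>f x\<bar>" if "t \<in> {u..v} \<inter> {0..}" for t
        using that uv K(2)[of t] L(2)[of t] by (cases t x rule: linorder_cases) auto
      then show "\<exists>K. \<forall>t\<in>{u..v} \<inter> {0..}. \<bar>f t\<bar> \<le> K" by blast
    qed
  qed
  then obtain K where K: "\<forall>t\<in>{0..b} \<inter> {0..}. \<bar>f t\<bar> \<le> K" by blast
  show ?thesis
  proof (rule that[of "max K 0"])
    show "\<bar>f t\<bar> \<le> max K 0" if "0 \<le> t" "t \<le> b" for t
      using K that by (simp add: le_max_iff_disj)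
  qed simp
next
  case False
  then show ?thesis using that[of 0] by auto
qed

text \<open>Off finitely many points \<open>f\<close> is continuous, hence measurable, and it is
  dominated by a constant; the removed points form a null set.\<close>

lemma piecewise_continuous_integrable:
  assumes f: "piecewise_continuous f" and "0 \<le> a"
  shows "f integrable_on {a..b}"
proof -
  let ?D = "discontinuities f b"
  have fin: "finite ?D" using piecewise_continuousD(1)[OF f] .
  obtain K where K: "\<And>t. 0 \<le> t \<Longrightarrow> t \<le> b \<Longrightarrow> \<bar>f t\<bar> \<le> K"
    using piecewise_continuous_bounded[OF f] by metis
  let ?S = "{a..b} - ?D"
  have neg: "negligible ?D" using fin by (rule negligible_finite)
  have S: "?S \<in> sets lebesgue" by (intro sets.Diff negligible_imp_sets[OF neg]) auto
  have "continuous_on ?S f"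
    unfolding continuous_on_eq_continuous_within
    using \<open>0 \<le> a\<close> by (auto intro: continuous_within_subset)
  then have "f \<in> borel_measurable (lebesgue_on ?S)"
    using S by (rule continuous_imp_measurable_on_sets_lebesgue)
  moreover have "(\<lambda>_. K) integrable_on ?S"
    by (rule integrable_spike_set[of _ "{a..b}"])
      (auto intro: negligible_subset[OF neg] negligible_subset[OF negligible_empty])
  moreover have "norm (f t) \<le> K" if "t \<in> ?S" for t using K[of t] that \<open>0 \<le> a\<close> by simp
  ultimately have "f integrable_on ?S"
    using S by (rule measurable_bounded_by_integrable_imp_integrable)
  then show ?thesis
    by (rule integrable_spike_set)
      (rule negligible_subset[OF negligible_empty], blast, rule negligible_subset[OF neg], blast)
qed

section \<open>Absolute continuity\<close>

lemma absolutely_continuous_onI: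
  assumes "\<And>\<epsilon>. \<epsilon> > 0 \<Longrightarrow> \<exists>\<delta>>0. \<forall>I. finite I \<longrightarrow> (\<forall>(r, s)\<in>I. a \<le> r \<and> r \<le> s \<and> s \<le> b) \<longrightarrow>
        disjoint_family_on (\<lambda>(r, s). {r<..<s}) I \<longrightarrow> (\<Sum>(r, s)\<in>I. s - r) < \<delta>
        \<longrightarrow> (\<Sum>(r, s)\<in>I. \<bar>f s - f r\<bar>) < \<epsilon>"
  shows "absolutely_continuous_on a b f"
  unfolding absolutely_continuous_on_def imp_conjL by (rule allI, rule impI, rule assms)

lemma absolutely_continuous_onE:
  assumes "absolutely_continuous_on a b f" "\<epsilon> > 0"
  obtains \<delta> where "\<delta> > 0" "\<And>I. finite I \<Longrightarrow> (\<And>r s. (r, s) \<in> I \<Longrightarrow> a \<le> r \<and> r \<le> s \<and> s \<le> b) \<Longrightarrow>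
        disjoint_family_on (\<lambda>(r, s). {r<..<s}) I \<Longrightarrow> (\<Sum>(r, s)\<in>I. s - r) < \<delta>
        \<Longrightarrow> (\<Sum>(r, s)\<in>I. \<bar>f s - f r\<bar>) < \<epsilon>"
proof -
  from assms obtain \<delta> where "\<delta> > 0" and *: "\<forall>I. finite I \<and> (\<forall>(r, s)\<in>I. a \<le> r \<and> r \<le> s \<and> s \<le> b) \<and>
        disjoint_family_on (\<lambda>(r, s). {r<..<s}) I \<and> (\<Sum>(r, s)\<in>I. s - r) < \<delta>
        \<longrightarrow> (\<Sum>(r, s)\<in>I. \<bar>f s - f r\<bar>) < \<epsilon>"
    unfolding absolutely_continuous_on_def by blast
  show ?thesis
    by (rule that[OF \<open>\<delta> > 0\<close>], rule *[rule_format]) auto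
qed

lemma absolutely_continuous_on_imp_continuous_on:
  assumes "absolutely_continuous_on a b f"
  shows "continuous_on {a..b} f"
  unfolding continuous_on_iff
proof (intro ballI allI impI)
  fix x \<epsilon> :: real assume x: "x \<in> {a..b}" and "\<epsilon> > 0"
  then obtain \<delta> where \<delta>: "\<delta> > 0" "\<And>I. finite I \<Longrightarrow> (\<And>r s. (r, s) \<in> I \<Longrightarrow> a \<le> r \<and> r \<le> s \<and> s \<le> b) \<Longrightarrow>
        disjoint_family_on (\<lambda>(r, s). {r<..<s}) I \<Longrightarrow> (\<Sum>(r, s)\<in>I. s - r) < \<delta>
        \<Longrightarrow> (\<Sum>(r, s)\<in>I. \<bar>f s - f r\<bar>) < \<epsilon>"
    using absolutely_continuous_onE[OF assms] by blast
  have *: "\<bar>f s - f r\<bar> < \<epsilon>" if "a \<le> r" "r \<le> s" "s \<le> b" "s - r < \<delta>" for r s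
    using \<delta>(2)[of "{(r, s)}"] that by (simp add: disjoint_family_on_def)
  have "dist (f y) (f x) < \<epsilon>" if "y \<in> {a..b}" "dist y x < \<delta>" for y
    using *[of x y] *[of y x] x that by (cases "x \<le> y") (auto simp: dist_real_def)
  then show "\<exists>d>0. \<forall>x'\<in>{a..b}. dist x' x < d \<longrightarrow> dist (f x') (f x) < \<epsilon>"
    using \<delta>(1) by blast
qed

lemma Lipschitz_imp_absolutely_continuous_on:
  assumes K: "\<And>r s. a \<le> r \<Longrightarrow> r \<le> s \<Longrightarrow> s \<le> b \<Longrightarrow> \<bar>f s - f r\<bar> \<le> K * (s - r)" and "K \<ge> 0"
  shows "absolutely_continuous_on a b f"
proof (rule absolutely_continuous_onI)
  fix \<epsilon> :: real assume \<epsilon>: "\<epsilon> > 0"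
  show "\<exists>\<delta>>0. \<forall>I. finite I \<longrightarrow> (\<forall>(r, s)\<in>I. a \<le> r \<and> r \<le> s \<and> s \<le> b) \<longrightarrow>
        disjoint_family_on (\<lambda>(r, s). {r<..<s}) I \<longrightarrow> (\<Sum>(r, s)\<in>I. s - r) < \<delta>
        \<longrightarrow> (\<Sum>(r, s)\<in>I. \<bar>f s - f r\<bar>) < \<epsilon>"
  \<comment> \<open>\<open>K + 1\<close> keeps the denominator positive when
    \<open>K = 0\<close>.\<close>
  proof (intro exI[of _ "\<epsilon> / (K + 1)"] conjI allI impI)
    show "0 < \<epsilon> / (K + 1)" using \<epsilon> \<open>K \<ge> 0\<close> by simp
    fix I :: "(real \<times> real) set"
    assume I: "\<forall>(r, s)\<in>I. a \<le> r \<and> r \<le> s \<and> s \<le> b" "(\<Sum>(r, s)\<in>I. s - r) < \<epsilon> / (K + 1)"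
    have "(\<Sum>(r, s)\<in>I. \<bar>f s - f r\<bar>) \<le> (\<Sum>(r, s)\<in>I. (K + 1) * (s - r))"
    proof (rule sum_mono, clarify)
      fix r s assume "(r, s) \<in> I"
      then have rs: "a \<le> r" "r \<le> s" "s \<le> b" using I by auto
      have "K * (s - r) \<le> (K + 1) * (s - r)" using rs by (intro mult_right_mono) auto
      then show "\<bar>f s - f r\<bar> \<le> (K + 1) * (s - r)" using K[OF rs] by linarith
    qed
    also have "\<dots> = (K + 1) * (\<Sum>(r, s)\<in>I. s - r)"
      by (simp add: sum_distrib_left case_prod_beta)
    also have "\<dots> < \<epsilon>" using I(2) \<open>K \<ge> 0\<close> by (simp add: pos_less_divide_eq mult.commute)
    finally show "(\<Sum>(r, s)\<in>I. \<bar>f s - f r\<bar>) < \<epsilon>" .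
  qed
qed

lemma absolutely_continuous_on_diff:
  assumes f: "absolutely_continuous_on a b f" and g: "absolutely_continuous_on a b g"
  shows "absolutely_continuous_on a b (\<lambda>t. f t - g t)"
proof (rule absolutely_continuous_onI)
  fix \<epsilon> :: real assume "\<epsilon> > 0"
  then have e2: "\<epsilon> / 2 > 0" by simp
  obtain d1 where d1: "d1 > 0" "\<And>I. finite I \<Longrightarrow> (\<And>r s. (r, s) \<in> I \<Longrightarrow> a \<le> r \<and> r \<le> s \<and> s \<le> b) \<Longrightarrow>
        disjoint_family_on (\<lambda>(r, s). {r<..<s}) I \<Longrightarrow> (\<Sum>(r, s)\<in>I. s - r) < d1
        \<Longrightarrow> (\<Sum>(r, s)\<in>I. \<bar>f s - f r\<bar>) < \<epsilon> / 2"
    using absolutely_continuous_onE[OF f e2] by blast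
  obtain d2 where d2: "d2 > 0" "\<And>I. finite I \<Longrightarrow> (\<And>r s. (r, s) \<in> I \<Longrightarrow> a \<le> r \<and> r \<le> s \<and> s \<le> b) \<Longrightarrow>
        disjoint_family_on (\<lambda>(r, s). {r<..<s}) I \<Longrightarrow> (\<Sum>(r, s)\<in>I. s - r) < d2
        \<Longrightarrow> (\<Sum>(r, s)\<in>I. \<bar>g s - g r\<bar>) < \<epsilon> / 2"
    using absolutely_continuous_onE[OF g e2] by blast
  show "\<exists>\<delta>>0. \<forall>I. finite I \<longrightarrow> (\<forall>(r, s)\<in>I. a \<le> r \<and> r \<le> s \<and> s \<le> b) \<longrightarrow>
        disjoint_family_on (\<lambda>(r, s). {r<..<s}) I \<longrightarrow> (\<Sum>(r, s)\<in>I. s - r) < \<delta>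
        \<longrightarrow> (\<Sum>(r, s)\<in>I. \<bar>f s - g s - (f r - g r)\<bar>) < \<epsilon>"
  proof (intro exI[of _ "min d1 d2"] conjI allI impI)
    show "0 < min d1 d2" using d1 d2 by simp
    fix I :: "(real \<times> real) set"
    assume I: "finite I" "\<forall>(r, s)\<in>I. a \<le> r \<and> r \<le> s \<and> s \<le> b"
      "disjoint_family_on (\<lambda>(r, s). {r<..<s}) I" "(\<Sum>(r, s)\<in>I. s - r) < min d1 d2"
    have "(\<Sum>(r, s)\<in>I. \<bar>f s - g s - (f r - g r)\<bar>)
        \<le> (\<Sum>(r, s)\<in>I. \<bar>f s - f r\<bar> + \<bar>g s - g r\<bar>)"
      by (rule sum_mono) auto
    also have "\<dots> = (\<Sum>(r, s)\<in>I. \<bar>f s - f r\<bar>) + (\<Sum>(r, s)\<in>I. \<bar>g s - g r\<bar>)"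
      by (simp add: sum.distrib case_prod_beta)
    also have "\<dots> < \<epsilon> / 2 + \<epsilon> / 2"
      using I by (intro add_strict_mono d1(2) d2(2)) auto
    finally show "(\<Sum>(r, s)\<in>I. \<bar>f s - g s - (f r - g r)\<bar>) < \<epsilon>" by simp
  qed
qed

text \<open>A gauge controls the increments at tags outside the exceptional set by the derivative and
  keeps the subintervals tagged inside it within an open set of small measure.\<close>

lemma absolutely_continuous_on_zero_derivative:
  assumes f: "absolutely_continuous_on a b f" and ab: "a \<le> b" and N: "negligible N"
    and der: "\<And>t. t \<in> {a..b} - N \<Longrightarrow> (f has_real_derivative 0) (at t within {a..b})"
  shows "f b = f a"
proof -
  have bound: "\<bar>f b - f a\<bar> \<le> \<epsilon> * (b - a) + \<epsilon>" if \<epsilon>: "\<epsilon> > 0" for \<epsilon>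
  proof -
    obtain \<delta> where \<delta>: "\<delta> > 0" "\<And>I. finite I \<Longrightarrow> (\<And>r s. (r, s) \<in> I \<Longrightarrow> a \<le> r \<and> r \<le> s \<and> s \<le> b) \<Longrightarrow>
        disjoint_family_on (\<lambda>(r, s). {r<..<s}) I \<Longrightarrow> (\<Sum>(r, s)\<in>I. s - r) < \<delta>
        \<Longrightarrow> (\<Sum>(r, s)\<in>I. \<bar>f s - f r\<bar>) < \<epsilon>"
      using absolutely_continuous_onE[OF f \<epsilon>] by blast
    have Ns: "N \<in> sets lebesgue" using N by (rule negligible_imp_sets)
    \<comment> \<open>The cover of the null set has to be small compared with the \<delta> that
      absolute continuity assigns to \<epsilon>, so that the subintervals tagged in \<open>N\<close>
      contribute less than \<epsilon>.\<close>
    obtain U where U: "open U" "N \<subseteq> U" "U - N \<in> lmeasurable" "emeasure lebesgue (U - N) < ennreal \<delta>"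
      using sets_lebesgue_outer_open[OF Ns \<delta>(1)] by blast
    have UN: "U = (U - N) \<union> N" using U(2) by blast
    have Um: "U \<in> lmeasurable"
      using U(3) negligible_imp_measurable[OF N] UN by (metis fmeasurable.Un)
    have "measure lebesgue (U - N) < \<delta>"
      using U(3,4) \<delta>(1) by (simp add: emeasure_eq_measure2 ennreal_less_iff)
    then have mU: "measure lebesgue U < \<delta>"
      using measure_Un_le[of "U - N" lebesgue N] U(3) Ns negligible_imp_measure0[OF N] UN by auto
    have "\<exists>d>0. \<forall>s\<in>{a..b}. \<bar>s - t\<bar> < d \<longrightarrow> \<bar>f s - f t\<bar> \<le> \<epsilon> * \<bar>s - t\<bar>" if t: "t \<in> {a..b} - N" for t
    proof -
      have "(f has_derivative (\<lambda>h. 0)) (at t within {a..b})"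
        using der[OF t] by (simp add: has_field_derivative_def lambda_zero)
      then have "\<forall>e>0. \<exists>d>0. \<forall>s\<in>{a..b}. norm (s - t) < d \<longrightarrow> norm (f s - f t - 0) \<le> e * norm (s - t)"
        unfolding has_derivative_within_alt by blast
      from this[rule_format, OF \<epsilon>] show ?thesis by simp
    qed
    then obtain d where d: "\<And>t. t \<in> {a..b} - N \<Longrightarrow> d t > 0"
      "\<And>t s. t \<in> {a..b} - N \<Longrightarrow> s \<in> {a..b} \<Longrightarrow> \<bar>s - t\<bar> < d t \<Longrightarrow> \<bar>f s - f t\<bar> \<le> \<epsilon> * \<bar>s - t\<bar>"
      by metis
    define g where "g t = (if t \<in> N then U else if t \<in> {a..b} then ball t (d t) else ball t 1)" for t
    have "gauge g" using U d by (auto simp: gauge_def g_def)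
    then obtain p where p: "p tagged_division_of {a..b}" "g fine p"
      using fine_division_exists_real by blast
    have fin: "finite p" using p(1) by (rule tagged_division_of_finite)
    have K: "\<exists>r s. K = {r..s} \<and> a \<le> r \<and> r \<le> x \<and> x \<le> s \<and> s \<le> b" if "(x, K) \<in> p" for x K
    proof -
      have xK: "x \<in> K" "K \<subseteq> {a..b}" "\<exists>u v. K = cbox u v" using tagged_division_ofD[OF p(1)] that by blast+
      then obtain u v where uv: "K = {u..v}" by (auto simp: cbox_interval)
      then have "u \<in> {a..b}" "v \<in> {a..b}" using xK(1,2) by auto
      then show ?thesis using uv xK(1) by (intro exI[of _ u] exI[of _ v]) auto
    qed
    let ?\<phi> = "\<lambda>(x, K). (Inf K, Sup K) :: real \<times> real"
    let ?D = "\<lambda>(x :: real, K). \<bar>f (Sup K) - f (Inf K)\<bar>"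
    define q where "q = {xK \<in> p. fst xK \<in> N}"
    \<comment> \<open>Degenerate subintervals contribute no increment. On the remaining ones
      disjointness of the interiors makes \<open>?\<phi>\<close> injective, so the sum can be
      rewritten over endpoint pairs.\<close>
    define q' where "q' = {(x, K) \<in> q. Inf K < Sup K}"
    have qfin: "finite q" "finite q'" "q \<subseteq> p" "q' \<subseteq> q"
      using fin by (auto simp: q_def q'_def intro: finite_subset)
    have disj: "{Inf K<..<Sup K} \<inter> {Inf L<..<Sup L} = {}"
      if KL: "(x, K) \<in> p" "(y, L) \<in> p" "(x, K) \<noteq> (y, L)" for x K y L
    proof -
      have "interior K \<inter> interior L = {}" using tagged_division_ofD(5)[OF p(1)] KL by blast
      moreover obtain r s where "K = {r..s}" "r \<le> s" using K[OF KL(1)] by fastforce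
      moreover obtain r' s' where "L = {r'..s'}" "r' \<le> s'" using K[OF KL(2)] by fastforce
      ultimately show ?thesis by (simp add: interior_atLeastAtMost_real)
    qed
    have inj: "inj_on ?\<phi> q'"
    proof (rule inj_onI, clarify, rule ccontr)
      fix x K y L assume *: "(x, K) \<in> q'" "(y, L) \<in> q'" "Inf K = Inf L" "Sup K = Sup L" "\<not> (x = y \<and> K = L)"
      then have "{Inf K<..<Sup K} = {}" using disj[of x K y L] qfin by auto
      then show False using * by (auto simp: q'_def)
    qed
    have small: "(\<Sum>xK\<in>q'. ?D xK) < \<epsilon>"
    proof -
      let ?I = "?\<phi> ` q'"
      have "(\<Sum>(r, s)\<in>?I. \<bar>f s - f r\<bar>) < \<epsilon>"
      proof (rule \<delta>(2))
        show "finite ?I" using qfin by simp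
        show "a \<le> r \<and> r \<le> s \<and> s \<le> b" if rs: "(r, s) \<in> ?I" for r s
        proof -
          obtain x L where L: "(x, L) \<in> q'" "r = Inf L" "s = Sup L" using rs by auto
          then have "(x, L) \<in> p" using qfin by blast
          from K[OF this] show ?thesis using L by auto
        qed
        show dis: "disjoint_family_on (\<lambda>(r, s). {r<..<s}) ?I"
          unfolding disjoint_family_on_def
        proof (intro ballI impI)
          fix i j assume i: "i \<in> ?I" and j: "j \<in> ?I" and ij: "i \<noteq> j"
          obtain x L where L: "(x, L) \<in> q'" "i = (Inf L, Sup L)" using i by auto
          obtain y M where M: "(y, M) \<in> q'" "j = (Inf M, Sup M)" using j by auto
          have "(x, L) \<in> p" "(y, M) \<in> p" "(x, L) \<noteq> (y, M)" using L M ij qfin by blast+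
          from disj[OF this] show "(case i of (r, s) \<Rightarrow> {r<..<s}) \<inter> (case j of (r, s) \<Rightarrow> {r<..<s}) = {}"
            using L M by simp
        qed
        have "(\<Sum>(r, s)\<in>?I. s - r) = (\<Sum>i\<in>?I. measure lebesgue ((\<lambda>(r, s). {r<..<s}) i))"
          by (rule sum.cong) (auto simp: q'_def)
        also have "\<dots> = measure lebesgue (\<Union>i\<in>?I. (\<lambda>(r, s). {r<..<s}) i)"
        proof (rule measure_finite_Union[symmetric])
          have "emeasure lebesgue {r<..<s::real} \<noteq> \<infinity>" for r s
            using fmeasurableD2[OF lmeasurable_interval(2)[of r s]]
            unfolding box_real infinity_ennreal_def by blast
          then show "emeasure lebesgue ((\<lambda>(r, s). {r<..<s}) i) \<noteq> \<infinity>" for i :: "real \<times> real"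
            by (cases i) simp
          show "finite ?I" using qfin(2) by simp
          show "(\<lambda>(r, s). {r<..<s}) ` ?I \<subseteq> sets lebesgue" by auto
          show "disjoint_family_on (\<lambda>(r, s). {r<..<s}) ?I" by (rule dis)
        qed
        also have "\<dots> \<le> measure lebesgue U"
        proof (rule measure_mono_fmeasurable)
          show "(\<Union>i\<in>?I. (\<lambda>(r, s). {r<..<s}) i) \<subseteq> U"
          proof clarify
            fix t x K assume t: "(x, K) \<in> q'" "t \<in> {Inf K<..<Sup K}"
            then have xK: "(x, K) \<in> p" "x \<in> N" by (auto simp: q'_def q_def)
            then have "K \<subseteq> g x" using p(2) by (auto simp: fine_def)
            then have "K \<subseteq> U" using xK(2) by (simp add: g_def)
            then show "t \<in> U" using K[OF xK(1)] t(2) by auto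
          qed
          show "(\<Union>i\<in>?I. (\<lambda>(r, s). {r<..<s}) i) \<in> sets lebesgue"
            by (intro sets.finite_UN finite_imageI qfin(2)) auto
          show "U \<in> lmeasurable" by (rule Um)
        qed
        finally show "(\<Sum>(r, s)\<in>?I. s - r) < \<delta>" using mU by simp
      qed
      then show ?thesis unfolding sum.reindex[OF inj] by (simp add: case_prod_beta comp_def)
    qed
    have "(\<Sum>xK\<in>q. ?D xK) = (\<Sum>xK\<in>q'. ?D xK)"
    proof (rule sum.mono_neutral_right)
      show "\<forall>xK\<in>q - q'. ?D xK = 0"
      proof clarify
        fix x K assume *: "(x, K) \<in> q" "(x, K) \<notin> q'"
        then have "Sup K \<le> Inf K" "\<exists>r s. K = {r..s} \<and> r \<le> s"
          using K[of x K] by (auto simp: q'_def q_def)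
        then show "\<bar>f (Sup K) - f (Inf K)\<bar> = 0" by auto
      qed
      show "finite q" "q' \<subseteq> q" by (rule qfin(1), rule qfin(4))
    qed
    with small have sq: "(\<Sum>xK\<in>q. ?D xK) \<le> \<epsilon>" by simp
    have "(\<Sum>xK\<in>p - q. ?D xK) \<le> (\<Sum>(x, K)\<in>p - q. \<epsilon> * measure lborel K)"
    proof (rule sum_mono, clarify)
      fix x K assume *: "(x, K) \<in> p" "(x, K) \<notin> q"
      obtain r s where rs: "K = {r..s}" "a \<le> r" "r \<le> x" "x \<le> s" "s \<le> b" using K[OF *(1)] by blast
      have x: "x \<in> {a..b} - N" using * rs by (auto simp: q_def)
      have "K \<subseteq> g x" using p(2) *(1) by (auto simp: fine_def)
      then have "K \<subseteq> ball x (d x)" using x by (simp add: g_def)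
      moreover have "r \<in> K" "s \<in> K" using rs by auto
      ultimately have "r \<in> ball x (d x)" "s \<in> ball x (d x)" by blast+
      then have rx: "\<bar>r - x\<bar> < d x" "\<bar>s - x\<bar> < d x" by (auto simp: dist_real_def)
      \<comment> \<open>The increment is split at the tag, where the derivative estimate is centred;
        the two lengths add up to that of the subinterval.\<close>
      have "\<bar>f r - f x\<bar> \<le> \<epsilon> * \<bar>r - x\<bar>" by (rule d(2)[OF x _ rx(1)]) (use rs in auto)
      moreover have "\<bar>f s - f x\<bar> \<le> \<epsilon> * \<bar>s - x\<bar>" by (rule d(2)[OF x _ rx(2)]) (use rs in auto)
      ultimately have "\<bar>f s - f r\<bar> \<le> \<epsilon> * (x - r) + \<epsilon> * (s - x)" using rs by auto
      then show "\<bar>f (Sup K) - f (Inf K)\<bar> \<le> \<epsilon> * measure lborel K" using rs by (simp add: algebra_simps)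
    qed
    also have "\<dots> \<le> (\<Sum>(x, K)\<in>p. \<epsilon> * measure lborel K)"
      using fin \<epsilon> by (intro sum_mono2) auto
    also have "\<dots> = \<epsilon> * (b - a)"
      using additive_content_tagged_division[of p a b] p(1) ab
      by (simp add: sum_distrib_left[symmetric] case_prod_beta)
    finally have spq: "(\<Sum>xK\<in>p - q. ?D xK) \<le> \<epsilon> * (b - a)" .
    have "\<bar>f b - f a\<bar> = \<bar>\<Sum>(x, K)\<in>p. f (Sup K) - f (Inf K)\<bar>"
      using additive_tagged_division_1[OF ab p(1), of f] by simp
    also have "\<dots> \<le> (\<Sum>xK\<in>p. ?D xK)"
      by (rule order_trans[OF sum_abs]) (simp add: case_prod_beta)
    also have "\<dots> = (\<Sum>xK\<in>p - q. ?D xK) + (\<Sum>xK\<in>q. ?D xK)"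
      using fin qfin(3) by (rule sum.subset_diff[rotated])
    finally show ?thesis using sq spq by linarith
  qed
  show ?thesis
  proof (rule ccontr)
    assume "f b \<noteq> f a"
    then have d: "\<bar>f b - f a\<bar> > 0" by simp
    \<comment> \<open>The summand 1 keeps \<open>c\<close> positive for \<open>a = b\<close> and
      turns the bound at \<open>e\<close> into \<open>e * c\<close>, which is half the
      increment.\<close>
    define c where "c = b - a + 1"
    define e where "e = \<bar>f b - f a\<bar> / (2 * c)"
    have c: "c > 0" using ab by (simp add: c_def)
    then have "e > 0" using d by (simp add: e_def)
    from bound[OF this] have "\<bar>f b - f a\<bar> \<le> e * c" by (simp add: algebra_simps c_def)
    also have "\<dots> = \<bar>f b - f a\<bar> / 2" using c by (simp add: e_def)
    finally show False using d by simp
  qed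
qed

section \<open>Linear differential equations\<close>

text \<open>The integral form of \<open>x' = F\<close>. It is insensitive to finitely many jumps of
  \<open>F\<close>, survives shifts and concatenation, and passes to limits.\<close>

definition primitive :: "(real \<Rightarrow> real) \<Rightarrow> (real \<Rightarrow> real) \<Rightarrow> bool" where
  "primitive F x \<longleftrightarrow> (\<forall>t\<ge>0. (F has_integral (x t - x 0)) {0..t})"

lemma primitiveD: "primitive F x \<Longrightarrow> t \<ge> 0 \<Longrightarrow> (F has_integral (x t - x 0)) {0..t}"
  by (simp add: primitive_def)

lemma primitive_integrable: "primitive F x \<Longrightarrow> 0 \<le> t \<Longrightarrow> F integrable_on {0..t}"
  by (blast dest: primitiveD)

lemma primitive_integral: "primitive F x \<Longrightarrow> 0 \<le> t \<Longrightarrow> integral {0..t} F = x t - x 0"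
  by (blast dest: primitiveD)

lemma primitive_integral_between:
  assumes "primitive F x" "0 \<le> r" "r \<le> s"
  shows "(F has_integral (x s - x r)) {r..s}"
proof -
  have s: "F integrable_on {0..s}" using primitive_integrable assms by simp
  then have "F integrable_on {r..s}" by (rule integrable_on_subinterval) (use assms in auto)
  moreover have "integral {0..r} F + integral {r..s} F = integral {0..s} F"
    by (rule Henstock_Kurzweil_Integration.integral_combine) (use assms s in auto)
  ultimately show ?thesis
    using primitive_integral[of F x] assms by (auto simp: has_integral_iff)
qed

lemma continuous_on_atLeastI:
  assumes "\<And>b. continuous_on {0..b::real} f"
  shows "continuous_on {0..} f"
  unfolding continuous_on_eq_continuous_within
proof
  fix t :: real assume "t \<in> {0..}"
  then have "continuous (at t within {0..t+1}) f"
    using assms[of "t+1"] by (simp add: continuous_on_eq_continuous_within)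
  moreover have "at t within {0..t+1} = at t within {0..}"
    by (rule at_within_nhd[of _ "{..<t+1}"]) auto
  ultimately show "continuous (at t within {0..}) f" by simp
qed

lemma primitive_continuous:
  assumes "primitive F x"
  shows "continuous_on {0..} x"
proof -
  have b: "continuous_on {0..b} x" for b :: real
  proof (cases "b \<ge> 0")
    case True
    have "continuous_on {0..b} (\<lambda>t. x 0 + integral {0..t} F)"
      by (intro continuous_intros indefinite_integral_continuous_1 primitive_integrable[OF assms True])
    then show ?thesis
      by (rule continuous_on_eq) (use primitive_integral[OF assms] in auto)
  qed simp
  then show ?thesis by (rule continuous_on_atLeastI)
qed

lemma primitive_derivative:
  assumes x: "primitive F x" and t: "t \<ge> 0" and c: "continuous (at t within {0..}) F"
  shows "(x has_real_derivative F t) (at t within {0..})"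
proof -
  have e: "at t within {0..t+1} = at t within {0..}"
    by (rule at_within_nhd[of _ "{..<t+1}"]) auto
  have "((\<lambda>u. integral {0..u} F) has_vector_derivative F t) (at t within ({0..t+1} - {}))"
    by (rule integral_has_vector_derivative_continuous_at)
      (use t primitive_integrable[OF x, of "t+1"] continuous_within_subset[OF c] in auto)
  then have "((\<lambda>u. integral {0..u} F) has_real_derivative F t) (at t within {0..})"
    by (simp add: e has_real_derivative_iff_has_vector_derivative)
  then have "((\<lambda>u. x 0 + integral {0..u} F) has_real_derivative F t) (at t within {0..})"
    by (auto intro!: derivative_eq_intros)
  then show ?thesis
    by (rule has_field_derivative_transform_within[of _ _ _ _ 1])
      (use t primitive_integral[OF x] in auto)
qed

text \<open>A piecewise continuous integrand is bounded on bounded intervals, so its primitive is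
  Lipschitz there.\<close>

lemma primitive_absolutely_continuous_on:
  assumes x: "primitive F x" and F: "piecewise_continuous F"
  shows "absolutely_continuous_on 0 b x"
proof -
  obtain K where K: "K \<ge> 0" "\<And>t. 0 \<le> t \<Longrightarrow> t \<le> b \<Longrightarrow> \<bar>F t\<bar> \<le> K"
    using piecewise_continuous_bounded[OF F] by blast
  show ?thesis
  proof (rule Lipschitz_imp_absolutely_continuous_on[OF _ K(1)])
    fix r s :: real assume rs: "0 \<le> r" "r \<le> s" "s \<le> b"
    have "norm (x s - x r) \<le> K * measure lborel (cbox r s)"
      using primitive_integral_between[OF x rs(1,2)] rs K
      by (intro has_integral_bound[where f=F]) auto
    then show "\<bar>x s - x r\<bar> \<le> K * (s - r)" using rs by simp
  qed
qed

lemma primitiveI_integral: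
  assumes F: "piecewise_continuous F"
  shows "primitive F (\<lambda>t. c + integral {0..t} F)"
  unfolding primitive_def
  using piecewise_continuous_integrable[OF F, of 0] by (auto simp: has_integral_iff)

text \<open>\<open>x\<close> is compared with the indefinite integral \<open>G\<close> of
  \<open>F\<close>: the difference is absolutely continuous with zero derivative almost everywhere,
  hence constant.\<close>

lemma absolutely_continuous_on_imp_primitive:
  assumes x: "\<And>b. absolutely_continuous_on 0 b x" and F: "piecewise_continuous F"
    and N: "negligible N"
    and der: "\<And>t. t \<ge> 0 \<Longrightarrow> t \<notin> N \<Longrightarrow> (x has_real_derivative F t) (at t within {0..})"
  shows "primitive F x"
  unfolding primitive_def
proof (intro allI impI)
  fix b :: real assume b: "b \<ge> 0"
  define G where "G t = integral {0..t} F" for t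
  have G: "primitive F G" using primitiveI_integral[OF F, of 0] by (simp add: G_def[abs_def])
  \<comment> \<open>Jumps of \<open>F\<close> are added because \<open>G\<close> is differentiated
    only where \<open>F\<close> is continuous.\<close>
  let ?N = "N \<union> discontinuities F b"
  have "x b - G b = x 0 - G 0"
  proof (rule absolutely_continuous_on_zero_derivative[of 0 b "\<lambda>t. x t - G t" ?N])
    show "absolutely_continuous_on 0 b (\<lambda>t. x t - G t)"
      by (intro absolutely_continuous_on_diff x primitive_absolutely_continuous_on[OF G F])
    show "negligible ?N"
      by (intro negligible_Un N negligible_finite piecewise_continuousD(1)[OF F])
    fix t assume t: "t \<in> {0..b} - ?N"
    have "(x has_real_derivative F t) (at t within {0..})" using der t by auto
    moreover have "(G has_real_derivative F t) (at t within {0..})"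
      using t by (intro primitive_derivative[OF G]) auto
    ultimately have "((\<lambda>t. x t - G t) has_real_derivative 0) (at t within {0..})"
      by (auto intro!: derivative_eq_intros)
    then show "((\<lambda>t. x t - G t) has_real_derivative 0) (at t within {0..b})"
      by (rule DERIV_subset) auto
  qed (use b in auto)
  then have "x b - x 0 = G b - G 0" by simp
  then show "(F has_integral (x b - x 0)) {0..b}" using primitiveD[OF G b] by simp
qed

section \<open>Uniqueness and existence for linear systems with piecewise continuous
  coefficients\<close>

definition lin_rhs :: "nat \<Rightarrow> (nat \<Rightarrow> nat \<Rightarrow> real \<Rightarrow> real) \<Rightarrow> (nat \<Rightarrow> real \<Rightarrow> real) \<Rightarrow>
    (nat \<Rightarrow> real \<Rightarrow> real) \<Rightarrow> nat \<Rightarrow> real \<Rightarrow> real" where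
  "lin_rhs n M g x i t = (\<Sum>j<n. M i j t * x j t) + g i t"

lemma lin_rhs_piecewise_continuous:
  assumes "\<And>j. j < n \<Longrightarrow> piecewise_continuous (M i j)" "piecewise_continuous (g i)"
    and "\<And>j. j < n \<Longrightarrow> continuous_on {0..} (x j)"
  shows "piecewise_continuous (lin_rhs n M g x i)"
  unfolding lin_rhs_def[abs_def]
  using assms by (intro piecewise_continuous_add piecewise_continuous_sum piecewise_continuous_mult)
    (auto intro: continuous_on_imp_piecewise_continuous)

lemma finite_common_bound:
  assumes "finite I" "\<And>i. i \<in> I \<Longrightarrow> piecewise_continuous (f i)"
  shows "\<exists>K\<ge>0. \<forall>i\<in>I. \<forall>t. 0 \<le> t \<longrightarrow> t \<le> b \<longrightarrow> \<bar>f i t\<bar> \<le> K"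
proof -
  have "\<exists>K\<ge>0. \<forall>t. 0 \<le> t \<longrightarrow> t \<le> b \<longrightarrow> \<bar>f i t\<bar> \<le> K" if "i \<in> I" for i
    using piecewise_continuous_bounded[OF assms(2)[OF that], of b] by metis
  then obtain K where K: "\<And>i. i \<in> I \<Longrightarrow> K i \<ge> 0" "\<And>i t. i \<in> I \<Longrightarrow> 0 \<le> t \<Longrightarrow> t \<le> b \<Longrightarrow> \<bar>f i t\<bar> \<le> K i"
    by metis
  show ?thesis
  proof (rule exI[of _ "sum K I"], intro conjI ballI allI impI)
    show "sum K I \<ge> 0" using K(1) by (rule sum_nonneg)
    fix i t assume i: "i \<in> I" "0 \<le> t" "t \<le> b"
    have "K i \<le> sum K I" using K(1) assms(1) i(1) by (intro member_le_sum) auto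
    then show "\<bar>f i t\<bar> \<le> sum K I" using K(2)[OF i] by simp
  qed
qed

text \<open>The fundamental theorem tolerates finitely many exceptional points of a continuous
  function; the integrand is set to 0 there.\<close>

lemma nondecreasing_of_deriv_finite:
  fixes f :: "real \<Rightarrow> real"
  assumes S: "finite S" and ab: "a \<le> b" and cont: "continuous_on {a..b} f"
    and der: "\<And>t. a < t \<Longrightarrow> t < b \<Longrightarrow> t \<notin> S \<Longrightarrow> (f has_real_derivative f' t) (at t)"
    and nonneg: "\<And>t. a < t \<Longrightarrow> t < b \<Longrightarrow> t \<notin> S \<Longrightarrow> f' t \<ge> 0"
  shows "f a \<le> f b"
proof -
  let ?g = "\<lambda>t. if a < t \<and> t < b \<and> t \<notin> S then f' t else 0"
  have "(?g has_integral (f b - f a)) {a..b}"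
  proof (rule fundamental_theorem_of_calculus_interior_strong[OF S ab _ cont])
    fix t assume "t \<in> {a<..<b} - S"
    then show "(f has_vector_derivative ?g t) (at t)"
      using der by (auto simp: has_real_derivative_iff_has_vector_derivative[symmetric])
  qed
  then have "0 \<le> f b - f a" by (rule has_integral_nonneg) (use nonneg in auto)
  then show ?thesis by simp
qed

text \<open>With \<open>V = \<Sum> d\<^sub>i\<^sup>2\<close> one has \<open>\<bar>V'\<bar> \<le> L V\<close>, so \<open>e\<^sup>L\<^sup>t V\<close> increases and \<open>e\<^sup>-\<^sup>L\<^sup>t V\<close> decreases: this gives
  uniqueness in both time directions.\<close>

lemma lin_ode_zero:
  assumes M: "\<And>i j. i < n \<Longrightarrow> j < n \<Longrightarrow> piecewise_continuous (M i j)"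
    and d: "\<And>i. i < n \<Longrightarrow> primitive (lin_rhs n M (\<lambda>_ _. 0) d i) (d i)"
    and s: "s \<ge> 0" "\<And>i. i < n \<Longrightarrow> d i s = 0" and t: "t \<ge> 0" and i: "i < n"
  shows "d i t = 0"
proof -
  \<comment> \<open>\<open>t\<close> may lie on either side of \<open>s\<close>, so the coefficients
    are bounded up to the later of the two.\<close>
  define b where "b = max s t"
  have "piecewise_continuous ((\<lambda>(i, j). M i j) p)" if "p \<in> {..<n} \<times> {..<n}" for p
    using that M by auto
  then obtain K where K: "K \<ge> 0"
    "\<forall>p\<in>{..<n} \<times> {..<n}. \<forall>t. 0 \<le> t \<longrightarrow> t \<le> b \<longrightarrow> \<bar>(\<lambda>(i, j). M i j) p t\<bar> \<le> K"
    using finite_common_bound[of "{..<n} \<times> {..<n}" "\<lambda>(i, j). M i j" b] by blast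
  have K': "\<bar>M i j u\<bar> \<le> K" if "i < n" "j < n" "0 \<le> u" "u \<le> b" for i j u
    using K(2)[rule_format, of "(i, j)" u] that by simp
  let ?F = "lin_rhs n M (\<lambda>_ _. 0) d"
  have cont: "continuous_on {0..} (d i)" if "i < n" for i by (rule primitive_continuous[OF d[OF that]])
  have F: "piecewise_continuous (?F i)" if "i < n" for i
    using that M cont by (intro lin_rhs_piecewise_continuous piecewise_continuous_const) auto
  define S where "S = (\<Union>i<n. discontinuities (?F i) b)"
  have S: "finite S" using piecewise_continuousD(1)[OF F] by (auto simp: S_def)
  define V where "V u = (\<Sum>i<n. (d i u)\<^sup>2)" for u
  define V' where "V' u = (\<Sum>i<n. 2 * d i u * ?F i u)" for u
  \<comment> \<open>Each pair of coordinates contributes at most \<open>K\<close> times the sum of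
    their squares to \<open>V'\<close>; over \<open>n * n\<close> pairs this adds up to
    \<open>2 * K * n\<close> times \<open>V\<close>.\<close>
  define L where "L = 2 * K * n"
  have V0: "V u \<ge> 0" for u by (simp add: V_def sum_nonneg)
  have contV: "continuous_on {0..b} V"
    unfolding V_def[abs_def] by (intro continuous_intros continuous_on_subset[OF cont]) auto
  have derV: "(V has_real_derivative V' u) (at u)" if u: "0 < u" "u < b" "u \<notin> S" for u
  proof -
    have "at u within {0..} = at u" using u by (intro at_within_interior) (simp add: interior_real_atLeast)
    then have "(d i has_real_derivative ?F i u) (at u)" if "i < n" for i
      using primitive_derivative[OF d[OF that], of u] u that by (auto simp: S_def)
    then show ?thesis unfolding V_def[abs_def] V'_def
      by (auto intro!: derivative_eq_intros sum.cong)
  qed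
  have bound: "\<bar>V' u\<bar> \<le> L * V u" if u: "0 \<le> u" "u \<le> b" for u
  proof -
    have "\<bar>V' u\<bar> \<le> (\<Sum>i<n. \<bar>2 * d i u * ?F i u\<bar>)" unfolding V'_def by (rule sum_abs)
    also have "\<dots> \<le> (\<Sum>i<n. \<Sum>j<n. K * ((d i u)\<^sup>2 + (d j u)\<^sup>2))"
    proof (rule sum_mono)
      fix i assume i: "i \<in> {..<n}"
      have "\<bar>2 * d i u * ?F i u\<bar> = \<bar>\<Sum>j<n. 2 * d i u * (M i j u * d j u)\<bar>"
        by (simp add: lin_rhs_def sum_distrib_left)
      also have "\<dots> \<le> (\<Sum>j<n. \<bar>2 * d i u * (M i j u * d j u)\<bar>)" by (rule sum_abs)
      also have "\<dots> \<le> (\<Sum>j<n. K * ((d i u)\<^sup>2 + (d j u)\<^sup>2))"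
      proof (rule sum_mono)
        fix j assume j: "j \<in> {..<n}"
        have "\<bar>2 * d i u * (M i j u * d j u)\<bar> = \<bar>M i j u\<bar> * (2 * \<bar>d i u\<bar> * \<bar>d j u\<bar>)" by (simp add: abs_mult)
        also have "\<dots> \<le> K * ((d i u)\<^sup>2 + (d j u)\<^sup>2)"
          using K'[of i j u] i j u K(1) sum_squares_bound[of "\<bar>d i u\<bar>" "\<bar>d j u\<bar>"]
          by (intro mult_mono) auto
        finally show "\<bar>2 * d i u * (M i j u * d j u)\<bar> \<le> K * ((d i u)\<^sup>2 + (d j u)\<^sup>2)" .
      qed
      finally show "\<bar>2 * d i u * ?F i u\<bar> \<le> (\<Sum>j<n. K * ((d i u)\<^sup>2 + (d j u)\<^sup>2))" .
    qed
    also have "\<dots> = L * V u"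
      by (simp add: L_def V_def sum.distrib distrib_left sum_distrib_left[symmetric] algebra_simps)
    finally show ?thesis .
  qed
  have "V t \<le> 0"
  proof (cases "s \<le> t")
    case True
    have "- (exp (- L * s) * V s) \<le> - (exp (- L * t) * V t)"
    proof (rule nondecreasing_of_deriv_finite[OF S True])
      show "continuous_on {s..t} (\<lambda>u. - (exp (- L * u) * V u))"
        using s True by (intro continuous_intros continuous_on_subset[OF contV]) (auto simp: b_def)
      fix u assume u: "s < u" "u < t" "u \<notin> S"
      then have u': "0 < u" "u < b" using s by (auto simp: b_def)
      show "((\<lambda>u. - (exp (- L * u) * V u)) has_real_derivative exp (- L * u) * (L * V u - V' u)) (at u)"
        by (auto intro!: derivative_eq_intros derV u' u simp: algebra_simps)
      show "0 \<le> exp (- L * u) * (L * V u - V' u)" using bound[of u] u' by simp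
    qed
    moreover have "V s = 0" using s by (simp add: V_def)
    ultimately show ?thesis by (simp add: mult_le_0_iff)
  next
    case False
    then have st: "t \<le> s" by simp
    have "exp (L * t) * V t \<le> exp (L * s) * V s"
    proof (rule nondecreasing_of_deriv_finite[OF S st])
      show "continuous_on {t..s} (\<lambda>u. exp (L * u) * V u)"
        using t st by (intro continuous_intros continuous_on_subset[OF contV]) (auto simp: b_def)
      fix u assume u: "t < u" "u < s" "u \<notin> S"
      then have u': "0 < u" "u < b" using t by (auto simp: b_def)
      show "((\<lambda>u. exp (L * u) * V u) has_real_derivative exp (L * u) * (L * V u + V' u)) (at u)"
        by (auto intro!: derivative_eq_intros derV u' u simp: algebra_simps)
      show "0 \<le> exp (L * u) * (L * V u + V' u)" using bound[of u] u' by simp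
    qed
    moreover have "V s = 0" using s by (simp add: V_def)
    ultimately show ?thesis by (simp add: mult_le_0_iff)
  qed
  then have "V t = 0" using V0[of t] by simp
  then have "(d i t)\<^sup>2 = 0" using i by (simp add: V_def sum_nonneg_eq_0_iff)
  then show ?thesis by simp
qed

primrec picard :: "nat \<Rightarrow> (nat \<Rightarrow> nat \<Rightarrow> real \<Rightarrow> real) \<Rightarrow> (nat \<Rightarrow> real \<Rightarrow> real) \<Rightarrow>
    (nat \<Rightarrow> real) \<Rightarrow> nat \<Rightarrow> nat \<Rightarrow> real \<Rightarrow> real" where
  "picard n M g c 0 = (\<lambda>i t. c i)"
| "picard n M g c (Suc k) = (\<lambda>i t. c i + integral {0..t} (lin_rhs n M g (picard n M g c k) i))"

text \<open>\<open>L\<close> times the bound for one Picard increment integrates to the bound for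
  the next. The bounds are the terms of the series of \<open>C * exp (L * t)\<close>.\<close>

lemma has_integral_exp_term:
  assumes "t \<ge> 0"
  shows "((\<lambda>s. L * (C * (L * s) ^ k / fact k)) has_integral C * (L * t) ^ Suc k / fact (Suc k)) {0..t::real}"
proof -
  have "((\<lambda>s. L * (C * (L * s) ^ k / fact k)) has_integral
      C * (L * t) ^ Suc k / fact (Suc k) - C * (L * 0) ^ Suc k / fact (Suc k)) {0..t}"
  proof (rule fundamental_theorem_of_calculus[OF assms])
    fix s assume "s \<in> {0..t}"
    have "((\<lambda>s. C * (L * s) ^ Suc k / fact (Suc k)) has_real_derivative
        C * (of_nat (Suc k) * (L * s) ^ k * L) / fact (Suc k)) (at s within {0..t})"
      by (rule derivative_eq_intros refl | simp)+
    moreover have "C * (of_nat (Suc k) * (L * s) ^ k * L) / fact (Suc k) = L * (C * (L * s) ^ k / fact k)"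
      by (simp add: field_simps del: of_nat_Suc)
    ultimately show "((\<lambda>s. C * (L * s) ^ Suc k / fact (Suc k)) has_vector_derivative
        L * (C * (L * s) ^ k / fact k)) (at s within {0..t})"
      unfolding has_real_derivative_iff_has_vector_derivative[symmetric] by (simp only:)
  qed
  then show ?thesis by simp
qed

text \<open>Picard iteration. Pointwise convergence and a bound uniform in the iteration index on
  each bounded interval are enough, since dominated convergence carries the integral equation to the
  limit.\<close>

lemma lin_ode_exists:
  assumes M: "\<And>i j. i < n \<Longrightarrow> j < n \<Longrightarrow> piecewise_continuous (M i j)"
    and g: "\<And>i. i < n \<Longrightarrow> piecewise_continuous (g i)"
  shows "\<exists>x. \<forall>i<n. x i 0 = c i \<and> primitive (lin_rhs n M g x i) (x i)"
proof -
  define X where "X = picard n M g c"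
  let ?R = "\<lambda>k. lin_rhs n M g (X k)"
  have X_Suc: "X (Suc k) i t = c i + integral {0..t} (?R k i)" for k i t by (simp add: X_def)
  have contX: "continuous_on {0..} (X k i)" if "i < n" for k i
    using that
  proof (induction k arbitrary: i)
    case 0
    then show ?case by (simp add: X_def)
  next
    case (Suc k)
    then have "piecewise_continuous (?R k i)"
      using M g by (intro lin_rhs_piecewise_continuous) auto
    from primitive_continuous[OF primitiveI_integral[OF this, of "c i"]]
    show ?case by (simp add: X_Suc[abs_def])
  qed
  have pcR: "piecewise_continuous (?R k i)" if "i < n" for k i
    using that M g contX by (intro lin_rhs_piecewise_continuous) auto
  have intR: "?R k i integrable_on {0..t}" if "i < n" for k i t
    using piecewise_continuous_integrable[OF pcR[OF that]] by simp
  have X0: "X k i 0 = c i" for k i by (cases k) (simp_all add: X_def)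
  \<comment> \<open>The end time is fixed first, as the coefficients are bounded only on bounded
    intervals.\<close>
  have *: "\<exists>l. (\<lambda>k. X k i t) \<longlonglongrightarrow> l" and
    **: "\<exists>H. \<forall>k. \<forall>i<n. \<forall>s\<in>{0..t}. \<bar>?R k i s\<bar> \<le> H" if t: "t \<ge> 0" and i: "i < n" for i t
  proof -
    have "piecewise_continuous ((\<lambda>(i, j). M i j) p)" if "p \<in> {..<n} \<times> {..<n}" for p
      using that M by auto
    then obtain K where K: "K \<ge> 0"
      "\<forall>p\<in>{..<n} \<times> {..<n}. \<forall>s. 0 \<le> s \<longrightarrow> s \<le> t \<longrightarrow> \<bar>(\<lambda>(i, j). M i j) p s\<bar> \<le> K"
      using finite_common_bound[of "{..<n} \<times> {..<n}" "\<lambda>(i, j). M i j" t] by blast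
    have K': "\<bar>M i j s\<bar> \<le> K" if "i < n" "j < n" "0 \<le> s" "s \<le> t" for i j s
      using K(2)[rule_format, of "(i, j)" s] that by simp
    obtain G where G: "G \<ge> 0" "\<forall>i\<in>{..<n}. \<forall>s. 0 \<le> s \<longrightarrow> s \<le> t \<longrightarrow> \<bar>g i s\<bar> \<le> G"
      using finite_common_bound[of "{..<n}" g t] g by blast
    have "piecewise_continuous (\<lambda>s. X 1 i s + (-1) * X 0 i s)" if "i \<in> {..<n}" for i
      using that contX
      by (intro piecewise_continuous_add piecewise_continuous_mult piecewise_continuous_const
          continuous_on_imp_piecewise_continuous) auto
    then obtain C where C: "C \<ge> 0"
      "\<forall>i\<in>{..<n}. \<forall>s. 0 \<le> s \<longrightarrow> s \<le> t \<longrightarrow> \<bar>X 1 i s + (-1) * X 0 i s\<bar> \<le> C"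
      using finite_common_bound[of "{..<n}" "\<lambda>i s. X 1 i s + (-1) * X 0 i s" t] by blast
    \<comment> \<open>\<open>L\<close> bounds the absolute row sums of the coefficient matrix and
      \<open>C\<close> the first increment; together they give the factorial estimate
      \<open>step\<close>.\<close>
    define L where "L = K * n"
    have L: "L \<ge> 0" using K by (simp add: L_def)
    have step: "\<bar>X (Suc k) i s - X k i s\<bar> \<le> C * (L * s) ^ k / fact k"
      if "i < n" "0 \<le> s" "s \<le> t" for k i s
      using that
    proof (induction k arbitrary: i s)
      case 0
      then show ?case using C(2)[rule_format, of i s] by simp
    next
      case (Suc k)
      have "X (Suc (Suc k)) i s - X (Suc k) i s = integral {0..s} (\<lambda>u. ?R (Suc k) i u - ?R k i u)"
        using intR[OF Suc.prems(1)] by (simp add: X_Suc Henstock_Kurzweil_Integration.integral_diff)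
      moreover have "norm (integral {0..s} (\<lambda>u. ?R (Suc k) i u - ?R k i u))
          \<le> integral {0..s} (\<lambda>u. L * (C * (L * u) ^ k / fact k))"
      proof (rule Henstock_Kurzweil_Integration.integral_norm_bound_integral)
        show "(\<lambda>u. ?R (Suc k) i u - ?R k i u) integrable_on {0..s}"
          using intR[OF Suc.prems(1)] by (intro integrable_diff) auto
        show "(\<lambda>u. L * (C * (L * u) ^ k / fact k)) integrable_on {0..s}"
          using has_integral_exp_term[OF Suc.prems(2)] by blast
        fix u assume u: "u \<in> {0..s}"
        have "norm (?R (Suc k) i u - ?R k i u) = \<bar>\<Sum>j<n. M i j u * (X (Suc k) j u - X k j u)\<bar>"
          by (simp add: lin_rhs_def sum_subtractf right_diff_distrib)
        also have "\<dots> \<le> (\<Sum>j<n. \<bar>M i j u * (X (Suc k) j u - X k j u)\<bar>)" by (rule sum_abs)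
        also have "\<dots> \<le> (\<Sum>j<n. K * (C * (L * u) ^ k / fact k))"
          unfolding abs_mult using Suc.IH K' u Suc.prems K by (intro sum_mono mult_mono) auto
        also have "\<dots> = L * (C * (L * u) ^ k / fact k)" by (simp add: L_def)
        finally show "norm (?R (Suc k) i u - ?R k i u) \<le> L * (C * (L * u) ^ k / fact k)" .
      qed
      ultimately show ?case
        using integral_unique[OF has_integral_exp_term[OF Suc.prems(2), of L C k]] by simp
    qed
    have summ: "summable (\<lambda>k. C * (L * t) ^ k / fact k)"
      using summable_mult[OF summable_exp[of "L * t"], of C] by (simp add: field_simps)
    \<comment> \<open>Iterates are partial sums of increments dominated by an exponential series,
      which gives both the limit and a bound that does not depend on \<open>k\<close>.\<close>
    have tel: "X k i s = X 0 i s + (\<Sum>m<k. X (Suc m) i s - X m i s)" for k i s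
      using sum_lessThan_telescope[of "\<lambda>m. X m i s" k] by simp
    have "summable (\<lambda>m. X (Suc m) i t - X m i t)"
      by (rule summable_comparison_test'[OF summ, of 0]) (use step[OF i t] in auto)
    then have "(\<lambda>k. X 0 i t + (\<Sum>m<k. X (Suc m) i t - X m i t)) \<longlonglongrightarrow>
        X 0 i t + (\<Sum>m. X (Suc m) i t - X m i t)"
      by (intro tendsto_add tendsto_const summable_LIMSEQ)
    then show "\<exists>l. (\<lambda>k. X k i t) \<longlonglongrightarrow> l" using tel by (metis (no_types, lifting) LIMSEQ_unique tendsto_cong ext)
    let ?B = "\<Sum>k. C * (L * t) ^ k / fact k"
    have XB: "\<bar>X k j s\<bar> \<le> \<bar>c j\<bar> + ?B" if "j < n" "0 \<le> s" "s \<le> t" for k j s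
    proof -
      have "\<bar>\<Sum>m<k. X (Suc m) j s - X m j s\<bar> \<le> (\<Sum>m<k. \<bar>X (Suc m) j s - X m j s\<bar>)" by (rule sum_abs)
      also have "\<dots> \<le> (\<Sum>m<k. C * (L * t) ^ m / fact m)"
      proof (rule sum_mono)
        fix m
        have "C * (L * s) ^ m / fact m \<le> C * (L * t) ^ m / fact m"
          using C L that by (intro divide_right_mono mult_left_mono power_mono) auto
        then show "\<bar>X (Suc m) j s - X m j s\<bar> \<le> C * (L * t) ^ m / fact m" using step[OF that, of m] by linarith
      qed
      also have "\<dots> \<le> ?B" using C L t by (intro sum_le_suminf[OF summ]) auto
      finally show ?thesis using tel[of k j s] by (simp add: X_def)
    qed
    have B0: "?B \<ge> 0" using C L t by (intro suminf_nonneg[OF summ]) auto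
    have "\<bar>?R k i s\<bar> \<le> (\<Sum>j<n. K * (\<bar>c j\<bar> + ?B)) + G" if "i < n" "s \<in> {0..t}" for k i s
    proof -
      have "\<bar>?R k i s\<bar> \<le> \<bar>\<Sum>j<n. M i j s * X k j s\<bar> + \<bar>g i s\<bar>" by (simp add: lin_rhs_def)
      also have "\<bar>\<Sum>j<n. M i j s * X k j s\<bar> \<le> (\<Sum>j<n. \<bar>M i j s * X k j s\<bar>)" by (rule sum_abs)
      also have "\<dots> \<le> (\<Sum>j<n. K * (\<bar>c j\<bar> + ?B))"
        unfolding abs_mult using K' XB that K by (intro sum_mono mult_mono) auto
      finally show ?thesis using G(2)[rule_format, of i s] that by simp
    qed
    then show "\<exists>H. \<forall>k. \<forall>i<n. \<forall>s\<in>{0..t}. \<bar>?R k i s\<bar> \<le> H" by blast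
  qed
  define x where "x i t = lim (\<lambda>k. X k i t)" for i t
  have lim: "(\<lambda>k. X k i t) \<longlonglongrightarrow> x i t" if "t \<ge> 0" "i < n" for i t
    using *[OF that] by (simp add: x_def convergent_LIMSEQ_iff[symmetric] convergent_def)
  have x0: "x i 0 = c i" if "i < n" for i
    using lim[of 0 i] that by (simp add: X0 LIMSEQ_const_iff)
  have "primitive (lin_rhs n M g x i) (x i)" if i: "i < n" for i
    unfolding primitive_def
  proof (intro allI impI)
    fix t :: real assume t: "t \<ge> 0"
    obtain H where H: "\<And>k s. s \<in> {0..t} \<Longrightarrow> \<bar>?R k i s\<bar> \<le> H" using **[OF t i] i by blast
    have conv: "(\<lambda>k. ?R k i s) \<longlonglongrightarrow> lin_rhs n M g x i s" if "s \<in> {0..t}" for s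
      unfolding lin_rhs_def using that by (intro tendsto_intros lim) auto
    have h: "(\<lambda>_. H) integrable_on {0..t}" by (rule integrable_const_ivl)
    have dom: "lin_rhs n M g x i integrable_on {0..t}"
      "(\<lambda>k. integral {0..t} (?R k i)) \<longlonglongrightarrow> integral {0..t} (lin_rhs n M g x i)"
      using dominated_convergence[of "\<lambda>k. ?R k i" "{0..t}" "\<lambda>_. H" "lin_rhs n M g x i", OF intR[OF i] h _ conv] H
      by auto
    have "(\<lambda>k. X (Suc k) i t) \<longlonglongrightarrow> c i + integral {0..t} (lin_rhs n M g x i)"
      unfolding X_Suc by (intro tendsto_add tendsto_const dom)
    moreover have "(\<lambda>k. X (Suc k) i t) \<longlonglongrightarrow> x i t" using lim[OF t i] by (rule LIMSEQ_Suc)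
    ultimately have "x i t = c i + integral {0..t} (lin_rhs n M g x i)" by (rule LIMSEQ_unique[rotated])
    then show "(lin_rhs n M g x i has_integral (x i t - x i 0)) {0..t}"
      using dom(1) x0[OF i] by (simp add: has_integral_iff)
  qed
  then show ?thesis using x0 by blast
qed

section \<open>Continuous time\<close>

lemma primitive_cong:
  assumes "primitive F x" "\<And>t. t \<ge> 0 \<Longrightarrow> F t = G t" "\<And>t. t \<ge> 0 \<Longrightarrow> x t = z t"
  shows "primitive G z"
  unfolding primitive_def
proof (intro allI impI)
  fix t :: real assume t: "t \<ge> 0"
  have "(G has_integral (x t - x 0)) {0..t}"
    by (rule has_integral_eq[OF _ primitiveD[OF assms(1) t]]) (use assms(2) in auto)
  then show "(G has_integral (z t - z 0)) {0..t}" using assms(3) t by simp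
qed

lemma primitive_zero: "primitive (\<lambda>_. 0) (\<lambda>_. 0)"
  by (simp add: primitive_def)

lemma primitive_lincomb:
  assumes "primitive F x" "primitive G z"
  shows "primitive (\<lambda>t. a * F t + b * G t) (\<lambda>t. a * x t + b * z t)"
  unfolding primitive_def
proof (intro allI impI)
  fix t :: real assume t: "t \<ge> 0"
  have "((\<lambda>t. a * F t + b * G t) has_integral (a * (x t - x 0) + b * (z t - z 0))) {0..t}"
    using primitiveD[OF assms(1) t] primitiveD[OF assms(2) t]
    by (intro has_integral_add has_integral_mult_right)
  then show "((\<lambda>t. a * F t + b * G t) has_integral (a * x t + b * z t - (a * x 0 + b * z 0))) {0..t}"
    by (simp add: algebra_simps)
qed

lemma primitive_sum:
  "(\<And>j. j \<in> J \<Longrightarrow> primitive (F j) (x j)) \<Longrightarrow>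
    primitive (\<lambda>t. \<Sum>j\<in>J. c j * F j t) (\<lambda>t. \<Sum>j\<in>J. c j * x j t)"
proof (induction J rule: infinite_finite_induct)
  case (insert j J)
  then have "primitive (\<lambda>t. c j * F j t + 1 * (\<Sum>j\<in>J. c j * F j t)) (\<lambda>t. c j * x j t + 1 * (\<Sum>j\<in>J. c j * x j t))"
    by (intro primitive_lincomb) auto
  then show ?case using insert by simp
qed (simp_all add: primitive_zero)

lemma primitive_shift:
  assumes "primitive F x" "s \<ge> 0"
  shows "primitive (\<lambda>t. F (t + s)) (\<lambda>t. x (t + s))"
  unfolding primitive_def
proof (intro allI impI)
  fix t :: real assume t: "t \<ge> 0"
  have "(F has_integral (x (t + s) - x s)) {s..t + s}"
    using primitive_integral_between[OF assms(1), of s "t + s"] assms(2) t by simp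
  from has_integral_shift_real_ivl[OF this, of s]
  show "((\<lambda>t. F (t + s)) has_integral (x (t + s) - x (0 + s))) {0..t}" by simp
qed

lemma primitive_concat:
  assumes F: "primitive F x" and G: "primitive G z" and s: "s \<ge> 0" and eq: "z 0 = x s"
  shows "primitive (\<lambda>t. if t < s then F t else G (t - s)) (\<lambda>t. if t < s then x t else z (t - s))"
    (is "primitive ?H ?h")
proof -
  \<comment> \<open>At the right end \<open>t = s\<close> the integrand already takes its value from
    \<open>G\<close>, a change at a single point.\<close>
  have le: "(?H has_integral (x t - x 0)) {0..t}" if t: "0 \<le> t" "t \<le> s" for t
    by (rule has_integral_spike_finite[of "{s}", OF _ _ primitiveD[OF F t(1)]]) (use t in auto)
  have h0: "?h 0 = x 0" using s eq by auto
  show ?thesis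
    unfolding primitive_def h0
  proof (intro allI impI)
    fix t :: real assume t: "t \<ge> 0"
    show "(?H has_integral (?h t - x 0)) {0..t}"
    proof (cases "t < s")
      case True
      then show ?thesis using le[OF t] by simp
    next
      case False
      have "((\<lambda>t. G (t + - s)) has_integral (z (t - s) - z 0)) {0 - - s..(t - s) - - s}"
        by (rule has_integral_shift_real_ivl) (use primitiveD[OF G, of "t - s"] False in simp)
      then have "((\<lambda>t. G (t - s)) has_integral (z (t - s) - x s)) {s..t}" by (simp add: eq)
      then have "(?H has_integral (z (t - s) - x s)) {s..t}"
        by (rule has_integral_eq[rotated]) auto
      from has_integral_combine[OF s _ le[OF s order_refl] this] False
      show ?thesis by simp
    qed
  qed
qed

section \<open>Null sets and continuous-time signals\<close>

lemma ae_iff_negligible: "(AE t in lebesgue. P t) \<longleftrightarrow> (\<exists>N. negligible N \<and> (\<forall>t. t \<notin> N \<longrightarrow> P (t::real)))"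
proof
  assume "AE t in lebesgue. P t"
  then obtain N where "N \<in> null_sets lebesgue" "{t \<in> space lebesgue. \<not> P t} \<subseteq> N"
    unfolding eventually_ae_filter by blast
  then show "\<exists>N. negligible N \<and> (\<forall>t. t \<notin> N \<longrightarrow> P t)" by (auto simp: negligible_iff_null_sets)
next
  assume "\<exists>N. negligible N \<and> (\<forall>t. t \<notin> N \<longrightarrow> P t)"
  then show "AE t in lebesgue. P t"
    unfolding eventually_ae_filter by (auto simp: negligible_iff_null_sets)
qed

lemma ae_translate:
  assumes "AE t in lebesgue. P t"
  shows "AE t in lebesgue. P (t + s :: real)"
proof -
  obtain N where N: "negligible N" "\<And>t. t \<notin> N \<Longrightarrow> P t" using assms unfolding ae_iff_negligible by blast
  have "t + s \<notin> N" if "t \<notin> (+) (- s) ` N" for t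
  proof
    assume "t + s \<in> N"
    then have "- s + (t + s) \<in> (+) (- s) ` N" by (rule imageI)
    then show False using that by simp
  qed
  then show ?thesis
    unfolding ae_iff_negligible using negligible_translation[OF N(1), of "- s"] N(2) by blast
qed

lemma ct_signalsD:
  assumes "w \<in> ct_signals n V"
  shows "ext w = w" and "t \<ge> 0 \<Longrightarrow> w t \<in> V" and "i < n \<Longrightarrow> piecewise_continuous (\<lambda>t. w t $ i)"
  using assms by (auto simp: ct_signals_def PiE_def extensional_restrict)

lemma ct_signalsI:
  assumes "\<And>t. t \<ge> 0 \<Longrightarrow> f t \<in> V" and "\<And>i. i < n \<Longrightarrow> piecewise_continuous (\<lambda>t. f t $ i)"
  shows "ext f \<in> ct_signals n V"
proof -
  have "piecewise_continuous (\<lambda>t. ext f t $ i)" if "i < n" for i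
    by (rule piecewise_continuous_cong[OF assms(2)[OF that]]) simp
  then show ?thesis using assms(1) by (auto simp: ct_signals_def)
qed

lemma ct_signals_concat:
  assumes w: "w \<in> ct_signals n V" "w' \<in> ct_signals n V" and s: "s \<ge> 0"
  shows "concat_at s w w' \<in> ct_signals n V"
  unfolding concat_at_def
proof (rule ct_signalsI)
  show "(if t < s then w t else w' (t - s)) \<in> V" if "t \<ge> 0" for t
    using ct_signalsD(2)[OF w(1)] ct_signalsD(2)[OF w(2)] that by auto
  fix i assume i: "i < n"
  have "piecewise_continuous (\<lambda>t. if t < s then w t $ i else w' (t - s) $ i)"
    by (rule piecewise_continuous_concat[OF ct_signalsD(3)[OF w(1) i] ct_signalsD(3)[OF w(2) i] s])
  then show "piecewise_continuous (\<lambda>t. (if t < s then w t else w' (t - s)) $ i)"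
    by (rule piecewise_continuous_cong) simp
qed

lemma ct_signals_shift:
  assumes w: "w \<in> ct_signals n V" and s: "s \<ge> 0"
  shows "shift s w \<in> ct_signals n V"
  unfolding shift_def
  using ct_signalsD(2)[OF w] s piecewise_continuous_shift[OF ct_signalsD(3)[OF w] s]
  by (intro ct_signalsI) auto

lemma ct_signals_lincomb:
  assumes w: "w \<in> ct_signals n (carrier_vec n)" "w' \<in> ct_signals n (carrier_vec n)"
  shows "lincomb_signal a w b w' \<in> ct_signals n (carrier_vec n)"
  unfolding lincomb_signal_def
proof (rule ct_signalsI)
  show c: "a \<cdot>\<^sub>v w t + b \<cdot>\<^sub>v w' t \<in> carrier_vec n" if "t \<ge> 0" for t
    using ct_signalsD(2)[OF w(1) that] ct_signalsD(2)[OF w(2) that] by simp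
  fix i assume i: "i < n"
  have "piecewise_continuous (\<lambda>t. a * w t $ i + b * w' t $ i)"
    by (intro piecewise_continuous_add piecewise_continuous_mult piecewise_continuous_const
        ct_signalsD(3)[OF w(1) i] ct_signalsD(3)[OF w(2) i])
  then show "piecewise_continuous (\<lambda>t. (a \<cdot>\<^sub>v w t + b \<cdot>\<^sub>v w' t) $ i)"
  proof (rule piecewise_continuous_cong)
    fix t :: real assume "t \<ge> 0"
    then have "w t \<in> carrier_vec n" "w' t \<in> carrier_vec n"
      using ct_signalsD(2)[OF w(1)] ct_signalsD(2)[OF w(2)] by blast+
    then show "a * w t $ i + b * w' t $ i = (a \<cdot>\<^sub>v w t + b \<cdot>\<^sub>v w' t) $ i" using i by simp
  qed
qed

lemma affine_mat_piecewise_continuous: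
  assumes p: "p \<in> ct_signals k P" and "i < r" "j < c"
  shows "piecewise_continuous (\<lambda>t. affine_mat r c k M (p t) $$ (i, j))"
proof -
  have "piecewise_continuous (\<lambda>t. M 0 $$ (i, j) + (\<Sum>l=1..k. p t $ (l - 1) * M l $$ (i, j)))"
    using ct_signalsD(3)[OF p]
    by (intro piecewise_continuous_add piecewise_continuous_sum piecewise_continuous_mult piecewise_continuous_const) auto
  then show ?thesis using assms by (simp add: affine_mat_def)
qed

lemma mult_affine_mat_entry:
  assumes "i < r" "v \<in> carrier_vec c"
  shows "(affine_mat r c k M q *\<^sub>v v) $ i = (\<Sum>j<c. affine_mat r c k M q $$ (i, j) * v $ j)"
  using assms by (auto simp: affine_mat_def scalar_prod_def lessThan_atLeast0 intro!: sum.cong)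

section \<open>The state equation in integral form\<close>

abbreviation sys_matrix :: "lpv_ssa \<Rightarrow> real signal \<Rightarrow> nat \<Rightarrow> nat \<Rightarrow> real \<Rightarrow> real" where
  "sys_matrix \<Sigma> p \<equiv> \<lambda>i j t. Aof \<Sigma> (p t) $$ (i, j)"

abbreviation sys_input :: "lpv_ssa \<Rightarrow> real signal \<Rightarrow> real signal \<Rightarrow> nat \<Rightarrow> real \<Rightarrow> real" where
  "sys_input \<Sigma> p u \<equiv> \<lambda>i t. \<Sum>j<nu \<Sigma>. Bof \<Sigma> (p t) $$ (i, j) * u t $ j"

abbreviation sys_rhs :: "lpv_ssa \<Rightarrow> real signal \<Rightarrow> real signal \<Rightarrow> real signal \<Rightarrow> nat \<Rightarrow> real \<Rightarrow> real" where
  "sys_rhs \<Sigma> p u x \<equiv> lin_rhs (nx \<Sigma>) (sys_matrix \<Sigma> p) (sys_input \<Sigma> p u) (\<lambda>i t. x t $ i)"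

lemma sys_matrix_piecewise_continuous:
  assumes p: "p \<in> ct_signals (np \<Sigma>) P" and "i < nx \<Sigma>" "j < nx \<Sigma>"
  shows "piecewise_continuous (sys_matrix \<Sigma> p i j)"
  unfolding Aof_def by (rule affine_mat_piecewise_continuous[OF assms])

lemma sys_input_piecewise_continuous:
  assumes p: "p \<in> ct_signals (np \<Sigma>) P" and u: "u \<in> ct_signals (nu \<Sigma>) (carrier_vec (nu \<Sigma>))" and i: "i < nx \<Sigma>"
  shows "piecewise_continuous (sys_input \<Sigma> p u i)"
  unfolding Bof_def
  by (intro piecewise_continuous_sum piecewise_continuous_mult affine_mat_piecewise_continuous[OF p i]
      ct_signalsD(3)[OF u]) auto

lemma sys_rhs_eq:
  assumes "x t \<in> carrier_vec (nx \<Sigma>)" "u t \<in> carrier_vec (nu \<Sigma>)" "i < nx \<Sigma>"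
  shows "(Aof \<Sigma> (p t) *\<^sub>v x t + Bof \<Sigma> (p t) *\<^sub>v u t) $ i = sys_rhs \<Sigma> p u x i t"
proof -
  have "(Aof \<Sigma> (p t) *\<^sub>v x t + Bof \<Sigma> (p t) *\<^sub>v u t) $ i = (Aof \<Sigma> (p t) *\<^sub>v x t) $ i + (Bof \<Sigma> (p t) *\<^sub>v u t) $ i"
    using assms Bof_carrier[of \<Sigma> "p t"] by (intro index_add_vec) auto
  then show ?thesis
    using mult_affine_mat_entry[OF assms(3,1), of "np \<Sigma>" "Amat \<Sigma>" "p t"]
      mult_affine_mat_entry[OF assms(3,2), of "np \<Sigma>" "Bmat \<Sigma>" "p t"]
    by (simp add: lin_rhs_def Aof_def Bof_def)
qed

text \<open>The part of a solution that does not involve the output. In integral form it has no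
  exceptional null set to keep track of.\<close>

definition ct_dynamics :: "lpv_ssa \<Rightarrow> real signal \<Rightarrow> real signal \<Rightarrow> real signal \<Rightarrow> bool" where
  "ct_dynamics \<Sigma> x u p \<longleftrightarrow> x \<in> {0..} \<rightarrow>\<^sub>E carrier_vec (nx \<Sigma>) \<and>
     u \<in> ct_signals (nu \<Sigma>) (carrier_vec (nu \<Sigma>)) \<and> p \<in> ct_signals (np \<Sigma>) (sched \<Sigma>) \<and>
     (\<forall>i<nx \<Sigma>. primitive (sys_rhs \<Sigma> p u x i) (\<lambda>t. x t $ i))"

lemma sys_rhs_piecewise_continuous:
  assumes "p \<in> ct_signals (np \<Sigma>) P" "u \<in> ct_signals (nu \<Sigma>) (carrier_vec (nu \<Sigma>))"
    and "\<And>j. j < nx \<Sigma> \<Longrightarrow> continuous_on {0..} (\<lambda>t. x t $ j)" and "i < nx \<Sigma>"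
  shows "piecewise_continuous (sys_rhs \<Sigma> p u x i)"
  using assms by (intro lin_rhs_piecewise_continuous sys_matrix_piecewise_continuous sys_input_piecewise_continuous) auto

text \<open>From left to right, an absolutely continuous state is the integral of its almost
  everywhere derivative. From right to left, the integral is differentiable wherever the right-hand
  side is continuous, that is, off a countable set.\<close>

lemma ct_solutions_iff:
  "(x, y, u, p) \<in> ct_solutions \<Sigma> \<longleftrightarrow> ct_dynamics \<Sigma> x u p \<and> y \<in> ct_signals (ny \<Sigma>) (carrier_vec (ny \<Sigma>)) \<and>
     (AE t in lebesgue. t \<ge> 0 \<longrightarrow> y t = Cof \<Sigma> (p t) *\<^sub>v x t + Dof \<Sigma> (p t) *\<^sub>v u t)"
proof
  assume s: "(x, y, u, p) \<in> ct_solutions \<Sigma>"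
  then have x: "x \<in> {0..} \<rightarrow>\<^sub>E carrier_vec (nx \<Sigma>)" "\<And>i b. i < nx \<Sigma> \<Longrightarrow> absolutely_continuous_on 0 b (\<lambda>t. x t $ i)"
    and y: "y \<in> ct_signals (ny \<Sigma>) (carrier_vec (ny \<Sigma>))" and u: "u \<in> ct_signals (nu \<Sigma>) (carrier_vec (nu \<Sigma>))"
    and p: "p \<in> ct_signals (np \<Sigma>) (sched \<Sigma>)"
    and ae: "AE t in lebesgue. t \<ge> 0 \<longrightarrow>
          (\<forall>i<nx \<Sigma>. ((\<lambda>s. x s $ i) has_real_derivative
             (Aof \<Sigma> (p t) *\<^sub>v x t + Bof \<Sigma> (p t) *\<^sub>v u t) $ i) (at t within {0..})) \<and>
          y t = Cof \<Sigma> (p t) *\<^sub>v x t + Dof \<Sigma> (p t) *\<^sub>v u t"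
    by (auto simp: ct_solutions_def ct_state_signals_def)
  obtain N where N: "negligible N" "\<And>t i. t \<notin> N \<Longrightarrow> t \<ge> 0 \<Longrightarrow> i < nx \<Sigma> \<Longrightarrow> ((\<lambda>s. x s $ i) has_real_derivative
             (Aof \<Sigma> (p t) *\<^sub>v x t + Bof \<Sigma> (p t) *\<^sub>v u t) $ i) (at t within {0..})"
    using ae unfolding ae_iff_negligible by blast
  have xc: "x t \<in> carrier_vec (nx \<Sigma>)" if "t \<ge> 0" for t using x(1) that by auto
  have cont: "continuous_on {0..} (\<lambda>t. x t $ j)" if "j < nx \<Sigma>" for j
    by (intro continuous_on_atLeastI absolutely_continuous_on_imp_continuous_on x(2) that)
  have "primitive (sys_rhs \<Sigma> p u x i) (\<lambda>t. x t $ i)" if i: "i < nx \<Sigma>" for i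
  proof (rule absolutely_continuous_on_imp_primitive[OF x(2)[OF i] _ N(1)])
    show "piecewise_continuous (sys_rhs \<Sigma> p u x i)" by (rule sys_rhs_piecewise_continuous[OF p u cont i])
    fix t :: real assume t: "t \<ge> 0" "t \<notin> N"
    show "((\<lambda>t. x t $ i) has_real_derivative sys_rhs \<Sigma> p u x i t) (at t within {0..})"
      using N(2)[OF t(2,1) i] sys_rhs_eq[of x t \<Sigma> u i p, OF xc[OF t(1)] ct_signalsD(2)[OF u t(1)] i] by simp
  qed
  moreover have "AE t in lebesgue. t \<ge> 0 \<longrightarrow> y t = Cof \<Sigma> (p t) *\<^sub>v x t + Dof \<Sigma> (p t) *\<^sub>v u t"
    using ae by (rule eventually_mono) blast
  ultimately show "ct_dynamics \<Sigma> x u p \<and> y \<in> ct_signals (ny \<Sigma>) (carrier_vec (ny \<Sigma>)) \<and>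
     (AE t in lebesgue. t \<ge> 0 \<longrightarrow> y t = Cof \<Sigma> (p t) *\<^sub>v x t + Dof \<Sigma> (p t) *\<^sub>v u t)"
    using x(1) y u p by (simp add: ct_dynamics_def)
next
  assume s: "ct_dynamics \<Sigma> x u p \<and> y \<in> ct_signals (ny \<Sigma>) (carrier_vec (ny \<Sigma>)) \<and>
     (AE t in lebesgue. t \<ge> 0 \<longrightarrow> y t = Cof \<Sigma> (p t) *\<^sub>v x t + Dof \<Sigma> (p t) *\<^sub>v u t)"
  then have x: "x \<in> {0..} \<rightarrow>\<^sub>E carrier_vec (nx \<Sigma>)" and u: "u \<in> ct_signals (nu \<Sigma>) (carrier_vec (nu \<Sigma>))"
    and p: "p \<in> ct_signals (np \<Sigma>) (sched \<Sigma>)"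
    and prim: "\<And>i. i < nx \<Sigma> \<Longrightarrow> primitive (sys_rhs \<Sigma> p u x i) (\<lambda>t. x t $ i)"
    by (auto simp: ct_dynamics_def)
  have xc: "x t \<in> carrier_vec (nx \<Sigma>)" if "t \<ge> 0" for t using x that by auto
  have pc: "piecewise_continuous (sys_rhs \<Sigma> p u x i)" if "i < nx \<Sigma>" for i
    by (rule sys_rhs_piecewise_continuous[OF p u primitive_continuous[OF prim] that])
  \<comment> \<open>Discontinuities are finite in number only on bounded intervals, hence the union
    over natural \<open>b\<close>.\<close>
  define N where "N = (\<Union>i<nx \<Sigma>. \<Union>b::nat. discontinuities (sys_rhs \<Sigma> p u x i) b)"
  have "countable N"
    unfolding N_def by (intro countable_UN countable_finite[OF piecewise_continuousD(1)[OF pc]]) auto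
  then have "negligible N"
    unfolding negligible_iff_null_sets by (intro null_sets_completionI countable_imp_null_set_lborel)
  moreover have "((\<lambda>s. x s $ i) has_real_derivative
             (Aof \<Sigma> (p t) *\<^sub>v x t + Bof \<Sigma> (p t) *\<^sub>v u t) $ i) (at t within {0..})"
    if "t \<notin> N" "t \<ge> 0" "i < nx \<Sigma>" for t i
  proof -
    obtain b :: nat where "t \<le> b" using real_arch_simple by blast
    then have "continuous (at t within {0..}) (sys_rhs \<Sigma> p u x i)" using that by (auto simp: N_def)
    then show ?thesis
      using primitive_derivative[OF prim[OF that(3)] that(2)]
        sys_rhs_eq[of x t \<Sigma> u i p, OF xc[OF that(2)] ct_signalsD(2)[OF u that(2)] that(3)] by simp
  qed
  ultimately have "AE t in lebesgue. t \<ge> 0 \<longrightarrow> (\<forall>i<nx \<Sigma>. ((\<lambda>s. x s $ i) has_real_derivative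
             (Aof \<Sigma> (p t) *\<^sub>v x t + Bof \<Sigma> (p t) *\<^sub>v u t) $ i) (at t within {0..}))"
    unfolding ae_iff_negligible by blast
  moreover have "AE t in lebesgue. t \<ge> 0 \<longrightarrow> y t = Cof \<Sigma> (p t) *\<^sub>v x t + Dof \<Sigma> (p t) *\<^sub>v u t"
    using s by blast
  ultimately have "AE t in lebesgue. t \<ge> 0 \<longrightarrow> (\<forall>i<nx \<Sigma>. ((\<lambda>s. x s $ i) has_real_derivative
             (Aof \<Sigma> (p t) *\<^sub>v x t + Bof \<Sigma> (p t) *\<^sub>v u t) $ i) (at t within {0..})) \<and>
          y t = Cof \<Sigma> (p t) *\<^sub>v x t + Dof \<Sigma> (p t) *\<^sub>v u t"
    by eventually_elim blast
  moreover have "x \<in> ct_state_signals (nx \<Sigma>)"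
    using x primitive_absolutely_continuous_on[OF prim pc] by (auto simp: ct_state_signals_def)
  ultimately show "(x, y, u, p) \<in> ct_solutions \<Sigma>" using s u p by (simp add: ct_solutions_def)
qed

lemma ct_dynamicsD:
  assumes "ct_dynamics \<Sigma> x u p"
  shows "ext x = x" and "t \<ge> 0 \<Longrightarrow> x t \<in> carrier_vec (nx \<Sigma>)"
    and "u \<in> ct_signals (nu \<Sigma>) (carrier_vec (nu \<Sigma>))" and "p \<in> ct_signals (np \<Sigma>) (sched \<Sigma>)"
    and "i < nx \<Sigma> \<Longrightarrow> primitive (sys_rhs \<Sigma> p u x i) (\<lambda>t. x t $ i)"
    and "i < nx \<Sigma> \<Longrightarrow> continuous_on {0..} (\<lambda>t. x t $ i)"
  using assms by (auto simp: ct_dynamics_def PiE_def extensional_restrict intro: primitive_continuous)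

text \<open>The integrand \<open>G\<close> is free, so each construction on signals can present the
  one that its rule for \<open>primitive\<close> produces.\<close>

lemma ct_dynamicsI:
  assumes "\<And>t. t \<ge> 0 \<Longrightarrow> x t \<in> carrier_vec (nx \<Sigma>)"
    and "u \<in> ct_signals (nu \<Sigma>) (carrier_vec (nu \<Sigma>))" and "p \<in> ct_signals (np \<Sigma>) (sched \<Sigma>)"
    and z: "\<And>i. i < nx \<Sigma> \<Longrightarrow> primitive (G i) (\<lambda>t. x t $ i)"
    and G: "\<And>i t. i < nx \<Sigma> \<Longrightarrow> t \<ge> 0 \<Longrightarrow> G i t = (Aof \<Sigma> (p t) *\<^sub>v x t + Bof \<Sigma> (p t) *\<^sub>v u t) $ i"
  shows "ct_dynamics \<Sigma> (ext x) u p"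
  unfolding ct_dynamics_def
proof (intro conjI allI impI assms(2,3))
  show "ext x \<in> {0..} \<rightarrow>\<^sub>E carrier_vec (nx \<Sigma>)" using assms(1) by auto
  fix i assume i: "i < nx \<Sigma>"
  show "primitive (sys_rhs \<Sigma> p u (ext x) i) (\<lambda>t. ext x t $ i)"
  proof (rule primitive_cong[OF z[OF i]])
    fix t :: real assume t: "t \<ge> 0"
    have "ext x t \<in> carrier_vec (nx \<Sigma>)" using assms(1) t by simp
    from sys_rhs_eq[of "ext x" t \<Sigma> u i p, OF this ct_signalsD(2)[OF assms(2) t] i]
    show "G i t = sys_rhs \<Sigma> p u (ext x) i t" using G[OF i t] t by simp
  qed simp
qed

lemma ct_dynamics_primitive:
  assumes d: "ct_dynamics \<Sigma> x u p" and i: "i < nx \<Sigma>"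
  shows "primitive (\<lambda>t. (Aof \<Sigma> (p t) *\<^sub>v x t + Bof \<Sigma> (p t) *\<^sub>v u t) $ i) (\<lambda>t. x t $ i)"
proof (rule primitive_cong[OF ct_dynamicsD(5)[OF d i]])
  fix t :: real assume t: "t \<ge> 0"
  show "sys_rhs \<Sigma> p u x i t = (Aof \<Sigma> (p t) *\<^sub>v x t + Bof \<Sigma> (p t) *\<^sub>v u t) $ i"
    by (rule sys_rhs_eq[of x t \<Sigma> u i p, OF ct_dynamicsD(2)[OF d t] ct_signalsD(2)[OF ct_dynamicsD(3)[OF d] t] i, symmetric])
qed simp

lemma output_carrier:
  assumes "x \<in> carrier_vec (nx \<Sigma>)" "u \<in> carrier_vec (nu \<Sigma>)"
  shows "Cof \<Sigma> q *\<^sub>v x + Dof \<Sigma> q *\<^sub>v u \<in> carrier_vec (ny \<Sigma>)"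
    and "Aof \<Sigma> q *\<^sub>v x + Bof \<Sigma> q *\<^sub>v u \<in> carrier_vec (nx \<Sigma>)"
  using mult_mat_vec_carrier[OF Cof_carrier assms(1)] mult_mat_vec_carrier[OF Dof_carrier assms(2)]
    mult_mat_vec_carrier[OF Aof_carrier assms(1)] mult_mat_vec_carrier[OF Bof_carrier assms(2)] by simp_all

lemma ct_output_signal:
  assumes d: "ct_dynamics \<Sigma> x u p"
  shows "ext (\<lambda>t. Cof \<Sigma> (p t) *\<^sub>v x t + Dof \<Sigma> (p t) *\<^sub>v u t) \<in> ct_signals (ny \<Sigma>) (carrier_vec (ny \<Sigma>))"
proof (rule ct_signalsI)
  note u = ct_dynamicsD(3)[OF d] and p = ct_dynamicsD(4)[OF d]
  show "Cof \<Sigma> (p t) *\<^sub>v x t + Dof \<Sigma> (p t) *\<^sub>v u t \<in> carrier_vec (ny \<Sigma>)" if "t \<ge> 0" for t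
    by (rule output_carrier(1)[OF ct_dynamicsD(2)[OF d that] ct_signalsD(2)[OF u that]])
  fix i assume i: "i < ny \<Sigma>"
  have "piecewise_continuous (\<lambda>t. (\<Sum>j<nx \<Sigma>. Cof \<Sigma> (p t) $$ (i, j) * x t $ j) + (\<Sum>j<nu \<Sigma>. Dof \<Sigma> (p t) $$ (i, j) * u t $ j))"
    unfolding Cof_def Dof_def
    by (intro piecewise_continuous_add piecewise_continuous_sum piecewise_continuous_mult
        affine_mat_piecewise_continuous[OF p i] ct_signalsD(3)[OF u]
        continuous_on_imp_piecewise_continuous ct_dynamicsD(6)[OF d]) auto
  then show "piecewise_continuous (\<lambda>t. (Cof \<Sigma> (p t) *\<^sub>v x t + Dof \<Sigma> (p t) *\<^sub>v u t) $ i)"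
  proof (rule piecewise_continuous_cong)
    fix t :: real assume t: "t \<ge> 0"
    have "(Cof \<Sigma> (p t) *\<^sub>v x t + Dof \<Sigma> (p t) *\<^sub>v u t) $ i = (Cof \<Sigma> (p t) *\<^sub>v x t) $ i + (Dof \<Sigma> (p t) *\<^sub>v u t) $ i"
      using i Dof_carrier[of \<Sigma> "p t"] by (intro index_add_vec) auto
    then show "(\<Sum>j<nx \<Sigma>. Cof \<Sigma> (p t) $$ (i, j) * x t $ j) + (\<Sum>j<nu \<Sigma>. Dof \<Sigma> (p t) $$ (i, j) * u t $ j) =
        (Cof \<Sigma> (p t) *\<^sub>v x t + Dof \<Sigma> (p t) *\<^sub>v u t) $ i"
      using mult_affine_mat_entry[OF i ct_dynamicsD(2)[OF d t], of "np \<Sigma>" "Cmat \<Sigma>" "p t"]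
        mult_affine_mat_entry[OF i ct_signalsD(2)[OF u t], of "np \<Sigma>" "Dmat \<Sigma>" "p t"]
      by (simp add: Cof_def Dof_def)
  qed
qed

lemma ct_sol_exists:
  assumes u: "u \<in> ct_signals (nu \<Sigma>) (carrier_vec (nu \<Sigma>))" and p: "p \<in> ct_signals (np \<Sigma>) (sched \<Sigma>)"
    and x0: "x0 \<in> carrier_vec (nx \<Sigma>)"
  shows "\<exists>x y. (x, y, u, p) \<in> ct_solutions \<Sigma> \<and> x 0 = x0"
proof -
  let ?n = "nx \<Sigma>"
  obtain X where X: "\<And>i. i < ?n \<Longrightarrow> X i 0 = x0 $ i"
    "\<And>i. i < ?n \<Longrightarrow> primitive (lin_rhs ?n (sys_matrix \<Sigma> p) (sys_input \<Sigma> p u) X i) (X i)"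
    using lin_ode_exists[of ?n "sys_matrix \<Sigma> p" "sys_input \<Sigma> p u" "\<lambda>i. x0 $ i"]
      sys_matrix_piecewise_continuous[OF p] sys_input_piecewise_continuous[OF p u] by blast
  let ?x = "\<lambda>t. vec ?n (\<lambda>i. X i t)"
  have d: "ct_dynamics \<Sigma> (ext ?x) u p"
  proof (rule ct_dynamicsI[OF _ u p])
    fix i assume i: "i < ?n"
    show "primitive (lin_rhs ?n (sys_matrix \<Sigma> p) (sys_input \<Sigma> p u) X i) (\<lambda>t. ?x t $ i)"
      using X(2)[OF i] i by simp
    fix t :: real assume t: "t \<ge> 0"
    have "(Aof \<Sigma> (p t) *\<^sub>v ?x t + Bof \<Sigma> (p t) *\<^sub>v u t) $ i = sys_rhs \<Sigma> p u ?x i t"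
      by (rule sys_rhs_eq[of ?x t \<Sigma> u i p]) (use ct_signalsD(2)[OF u t] i in auto)
    then show "lin_rhs ?n (sys_matrix \<Sigma> p) (sys_input \<Sigma> p u) X i t = (Aof \<Sigma> (p t) *\<^sub>v ?x t + Bof \<Sigma> (p t) *\<^sub>v u t) $ i"
      by (simp add: lin_rhs_def)
  qed simp
  have "(ext ?x, ext (\<lambda>t. Cof \<Sigma> (p t) *\<^sub>v ext ?x t + Dof \<Sigma> (p t) *\<^sub>v u t), u, p) \<in> ct_solutions \<Sigma>"
    unfolding ct_solutions_iff using d ct_output_signal[OF d] by auto
  moreover have "ext ?x 0 = x0" using X(1) x0 by auto
  ultimately show ?thesis by blast
qed

text \<open>The difference of two solutions solves the homogeneous equation, as the input terms
  cancel. Agreement at any one time \<open>s\<close> suffices, so this yields uniqueness from time 0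
  as well as determinism backward in time.\<close>

lemma ct_dynamics_unique:
  assumes 1: "ct_dynamics \<Sigma> x u p" and 2: "ct_dynamics \<Sigma> x' u p" and s: "s \<ge> 0" "x s = x' s" and t: "t \<ge> 0"
  shows "x t = x' t"
proof (rule eq_vecI)
  let ?n = "nx \<Sigma>" and ?d = "\<lambda>i t. x t $ i - x' t $ i"
  have p: "p \<in> ct_signals (np \<Sigma>) (sched \<Sigma>)" by (rule ct_dynamicsD(4)[OF 1])
  show "dim_vec (x t) = dim_vec (x' t)" using ct_dynamicsD(2)[OF 1 t] ct_dynamicsD(2)[OF 2 t] by simp
  fix i assume "i < dim_vec (x' t)"
  then have i: "i < ?n" using ct_dynamicsD(2)[OF 2 t] by simp
  have "?d i t = 0"
  proof (rule lin_ode_zero[where d = ?d and n = ?n and M = "sys_matrix \<Sigma> p" and s = s and t = t and i = i, OF _ _ s(1) _ t i])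
    show "piecewise_continuous (sys_matrix \<Sigma> p i j)" if "i < ?n" "j < ?n" for i j
      by (rule sys_matrix_piecewise_continuous[OF p that])
    show "primitive (lin_rhs ?n (sys_matrix \<Sigma> p) (\<lambda>_ _. 0) ?d i) (?d i)" if i: "i < ?n" for i
    proof (rule primitive_cong[OF primitive_lincomb[OF ct_dynamicsD(5)[OF 1 i] ct_dynamicsD(5)[OF 2 i], of 1 "-1"]])
      fix t :: real
      show "1 * sys_rhs \<Sigma> p u x i t + - 1 * sys_rhs \<Sigma> p u x' i t = lin_rhs ?n (sys_matrix \<Sigma> p) (\<lambda>_ _. 0) ?d i t"
        by (simp add: lin_rhs_def right_diff_distrib sum_subtractf)
    qed simp
  qed (use s in simp)
  then show "x t $ i = x' t $ i" by simp
qed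

lemma ct_dynamics_lincomb:
  assumes 1: "ct_dynamics \<Sigma> x u p" and 2: "ct_dynamics \<Sigma> x' u' p"
  shows "ct_dynamics \<Sigma> (lincomb_signal a x b x') (lincomb_signal a u b u') p"
  unfolding lincomb_signal_def[of a x]
proof (rule ct_dynamicsI)
  note x = ct_dynamicsD(2)[OF 1] ct_dynamicsD(2)[OF 2]
  note u = ct_signalsD(2)[OF ct_dynamicsD(3)[OF 1]] ct_signalsD(2)[OF ct_dynamicsD(3)[OF 2]]
  show "a \<cdot>\<^sub>v x t + b \<cdot>\<^sub>v x' t \<in> carrier_vec (nx \<Sigma>)" if "t \<ge> 0" for t using x that by simp
  show "lincomb_signal a u b u' \<in> ct_signals (nu \<Sigma>) (carrier_vec (nu \<Sigma>))"
    by (rule ct_signals_lincomb[OF ct_dynamicsD(3)[OF 1] ct_dynamicsD(3)[OF 2]])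
  show "p \<in> ct_signals (np \<Sigma>) (sched \<Sigma>)" by (rule ct_dynamicsD(4)[OF 1])
  fix i assume i: "i < nx \<Sigma>"
  let ?r = "\<lambda>x u t. Aof \<Sigma> (p t) *\<^sub>v x t + Bof \<Sigma> (p t) *\<^sub>v u t"
  show "primitive (\<lambda>t. a * ?r x u t $ i + b * ?r x' u' t $ i) (\<lambda>t. (a \<cdot>\<^sub>v x t + b \<cdot>\<^sub>v x' t) $ i)"
    by (rule primitive_cong[OF primitive_lincomb[OF ct_dynamics_primitive[OF 1 i] ct_dynamics_primitive[OF 2 i]]])
      (use carrier_vecD[OF x(1)] carrier_vecD[OF x(2)] i in auto)
  fix t :: real assume t: "t \<ge> 0"
  have "Aof \<Sigma> (p t) *\<^sub>v (a \<cdot>\<^sub>v x t + b \<cdot>\<^sub>v x' t) + Bof \<Sigma> (p t) *\<^sub>v lincomb_signal a u b u' t =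
      a \<cdot>\<^sub>v ?r x u t + b \<cdot>\<^sub>v ?r x' u' t"
    unfolding lincomb_signal_apply[OF t]
    by (rule output_eq_lincomb[OF Aof_carrier Bof_carrier x(1)[OF t] x(2)[OF t] u(1)[OF t] u(2)[OF t]])
  moreover have "(a \<cdot>\<^sub>v ?r x u t + b \<cdot>\<^sub>v ?r x' u' t) $ i = a * ?r x u t $ i + b * ?r x' u' t $ i"
    using output_carrier(2)[OF x(1)[OF t] u(1)[OF t], of "p t"] output_carrier(2)[OF x(2)[OF t] u(2)[OF t], of "p t"] i
    by (metis carrier_vecD index_add_vec(1) index_smult_vec)
  ultimately show "a * ?r x u t $ i + b * ?r x' u' t $ i =
      (Aof \<Sigma> (p t) *\<^sub>v (a \<cdot>\<^sub>v x t + b \<cdot>\<^sub>v x' t) + Bof \<Sigma> (p t) *\<^sub>v lincomb_signal a u b u' t) $ i" by simp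
qed

lemma ct_dynamics_shift:
  assumes d: "ct_dynamics \<Sigma> x u p" and s: "s \<ge> 0"
  shows "ct_dynamics \<Sigma> (shift s x) (shift s u) (shift s p)"
  unfolding shift_def[of s x]
proof (rule ct_dynamicsI)
  show "shift s u \<in> ct_signals (nu \<Sigma>) (carrier_vec (nu \<Sigma>))" "shift s p \<in> ct_signals (np \<Sigma>) (sched \<Sigma>)"
    by (rule ct_signals_shift[OF ct_dynamicsD(3)[OF d] s], rule ct_signals_shift[OF ct_dynamicsD(4)[OF d] s])
  show "x (t + s) \<in> carrier_vec (nx \<Sigma>)" if "t \<ge> 0" for t using ct_dynamicsD(2)[OF d] that s by simp
  fix i assume i: "i < nx \<Sigma>"
  show "primitive (\<lambda>t. (Aof \<Sigma> (p (t + s)) *\<^sub>v x (t + s) + Bof \<Sigma> (p (t + s)) *\<^sub>v u (t + s)) $ i) (\<lambda>t. x (t + s) $ i)"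
    by (rule primitive_shift[OF ct_dynamics_primitive[OF d i] s])
qed (simp add: shift_apply)

lemma ct_dynamics_concat:
  assumes 1: "ct_dynamics \<Sigma> x u p" and 2: "ct_dynamics \<Sigma> x' u' p'" and s: "s \<ge> 0" and eq: "x' 0 = x s"
  shows "ct_dynamics \<Sigma> (concat_at s x x') (concat_at s u u') (concat_at s p p')"
  unfolding concat_at_def[of s x]
proof (rule ct_dynamicsI)
  show "concat_at s u u' \<in> ct_signals (nu \<Sigma>) (carrier_vec (nu \<Sigma>))" "concat_at s p p' \<in> ct_signals (np \<Sigma>) (sched \<Sigma>)"
    by (rule ct_signals_concat[OF ct_dynamicsD(3)[OF 1] ct_dynamicsD(3)[OF 2] s],
        rule ct_signals_concat[OF ct_dynamicsD(4)[OF 1] ct_dynamicsD(4)[OF 2] s])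
  show "(if t < s then x t else x' (t - s)) \<in> carrier_vec (nx \<Sigma>)" if "t \<ge> 0" for t
    using ct_dynamicsD(2)[OF 1] ct_dynamicsD(2)[OF 2] that by simp
  fix i assume i: "i < nx \<Sigma>"
  let ?r = "\<lambda>x u p t. (Aof \<Sigma> (p t) *\<^sub>v x t + Bof \<Sigma> (p t) *\<^sub>v u t) $ i"
  have "primitive (\<lambda>t. if t < s then ?r x u p t else ?r x' u' p' (t - s)) (\<lambda>t. if t < s then x t $ i else x' (t - s) $ i)"
    by (rule primitive_concat[OF ct_dynamics_primitive[OF 1 i] ct_dynamics_primitive[OF 2 i] s]) (simp add: eq)
  then show "primitive (\<lambda>t. if t < s then ?r x u p t else ?r x' u' p' (t - s)) (\<lambda>t. (if t < s then x t else x' (t - s)) $ i)"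
    by (rule primitive_cong) simp_all
  fix t :: real assume "t \<ge> 0"
  then show "(if t < s then ?r x u p t else ?r x' u' p' (t - s)) =
      (Aof \<Sigma> (concat_at s p p' t) *\<^sub>v (if t < s then x t else x' (t - s)) + Bof \<Sigma> (concat_at s p p' t) *\<^sub>v concat_at s u u' t) $ i"
    by (simp add: concat_at_def)
qed

lemma ct_dynamics_intertwine:
  assumes T: "T \<in> carrier_mat (nx \<Sigma>') (nx \<Sigma>)" and dims: "nu \<Sigma>' = nu \<Sigma>" "np \<Sigma>' = np \<Sigma>" "sched \<Sigma>' = sched \<Sigma>"
    and int: "\<And>q. q \<in> sched \<Sigma> \<Longrightarrow> Aof \<Sigma>' q * T = T * Aof \<Sigma> q \<and> Bof \<Sigma>' q = T * Bof \<Sigma> q"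
    and d: "ct_dynamics \<Sigma> x u p"
  shows "ct_dynamics \<Sigma>' (ext (\<lambda>t. T *\<^sub>v x t)) u p"
proof (rule ct_dynamicsI)
  note x = ct_dynamicsD(2)[OF d]
  note u = ct_signalsD(2)[OF ct_dynamicsD(3)[OF d]]
  note p = ct_signalsD(2)[OF ct_dynamicsD(4)[OF d]]
  show "T *\<^sub>v x t \<in> carrier_vec (nx \<Sigma>')" if "t \<ge> 0" for t using mult_mat_vec_carrier[OF T x[OF that]] .
  show "u \<in> ct_signals (nu \<Sigma>') (carrier_vec (nu \<Sigma>'))" "p \<in> ct_signals (np \<Sigma>') (sched \<Sigma>')"
    using ct_dynamicsD(3,4)[OF d] dims by simp_all
  fix i assume i: "i < nx \<Sigma>'"
  let ?r = "\<lambda>t. Aof \<Sigma> (p t) *\<^sub>v x t + Bof \<Sigma> (p t) *\<^sub>v u t"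
  have entry: "(T *\<^sub>v v) $ i = (\<Sum>j<nx \<Sigma>. T $$ (i, j) * v $ j)" if "v \<in> carrier_vec (nx \<Sigma>)" for v
    using T that i by (auto simp: scalar_prod_def lessThan_atLeast0 intro!: sum.cong)
  have "primitive (\<lambda>t. \<Sum>j<nx \<Sigma>. T $$ (i, j) * ?r t $ j) (\<lambda>t. \<Sum>j<nx \<Sigma>. T $$ (i, j) * x t $ j)"
    by (rule primitive_sum) (use ct_dynamics_primitive[OF d] in auto)
  then show "primitive (\<lambda>t. \<Sum>j<nx \<Sigma>. T $$ (i, j) * ?r t $ j) (\<lambda>t. (T *\<^sub>v x t) $ i)"
    by (rule primitive_cong) (use entry[OF x] in auto)
  fix t :: real assume t: "t \<ge> 0"
  have "Aof \<Sigma>' (p t) *\<^sub>v (T *\<^sub>v x t) + Bof \<Sigma>' (p t) *\<^sub>v u t = T *\<^sub>v ?r t"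
    using intertwine_state[OF Aof_carrier Bof_carrier Aof_carrier T x[OF t] u[OF t]] int[OF p[OF t]] by blast
  then show "(\<Sum>j<nx \<Sigma>. T $$ (i, j) * ?r t $ j) = (Aof \<Sigma>' (p t) *\<^sub>v (T *\<^sub>v x t) + Bof \<Sigma>' (p t) *\<^sub>v u t) $ i"
    using entry[OF output_carrier(2)[OF x[OF t] u[OF t], of "p t"]] by simp
qed

text \<open>With constant input and schedule the right-hand side is continuous, so the state has a
  one-sided derivative at 0. Membership in \<open>W\<close> amounts to linear equations with
  constant coefficients, and these can be differentiated.\<close>

lemma ct_const_generator:
  assumes W: "vec_subspace (nx \<Sigma>) W" and d: "ct_dynamics \<Sigma> x (const_signal v) (const_signal q)"
    and xW: "\<And>t. t \<ge> 0 \<Longrightarrow> x t \<in> W"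
  shows "Aof \<Sigma> q *\<^sub>v x 0 + Bof \<Sigma> q *\<^sub>v v \<in> W"
proof -
  let ?n = "nx \<Sigma>" and ?r = "\<lambda>t. Aof \<Sigma> q *\<^sub>v x t + Bof \<Sigma> q *\<^sub>v v"
  obtain k Q R where Q: "Q \<in> carrier_mat k ?n"
    and ker: "\<And>x. x \<in> carrier_vec ?n \<Longrightarrow> Q *\<^sub>v x = 0\<^sub>v k \<longleftrightarrow> x \<in> W"
    using vec_subspace_kernel[OF W] by metis
  have v: "v \<in> carrier_vec (nu \<Sigma>)" using ct_signalsD(2)[OF ct_dynamicsD(3)[OF d] order_refl] by simp
  note x = ct_dynamicsD(2)[OF d]
  have rc: "?r 0 \<in> carrier_vec ?n" by (rule output_carrier(2)[OF x[OF order_refl] v])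
  have entry: "(Q *\<^sub>v z) $ i = (\<Sum>j<?n. Q $$ (i, j) * z $ j)" if "z \<in> carrier_vec ?n" "i < k" for z i
    using Q that by (auto simp: scalar_prod_def lessThan_atLeast0 intro!: sum.cong)
  have "((\<lambda>t. x t $ j) has_real_derivative ?r 0 $ j) (at 0 within {0..})" if j: "j < ?n" for j
  proof -
    have rhs: "sys_rhs \<Sigma> (const_signal q) (const_signal v) x j t =
        (\<Sum>l<?n. Aof \<Sigma> q $$ (j, l) * x t $ l) + (\<Sum>l<nu \<Sigma>. Bof \<Sigma> q $$ (j, l) * v $ l)" if "t \<ge> 0" for t
      using that by (simp add: lin_rhs_def)
    have "continuous_on {0..} (\<lambda>t. (\<Sum>l<?n. Aof \<Sigma> q $$ (j, l) * x t $ l) + (\<Sum>l<nu \<Sigma>. Bof \<Sigma> q $$ (j, l) * v $ l))"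
      by (intro continuous_intros ct_dynamicsD(6)[OF d]) auto
    then have "continuous_on {0..} (sys_rhs \<Sigma> (const_signal q) (const_signal v) x j)"
      by (rule continuous_on_eq) (use rhs in auto)
    then have "continuous (at 0 within {0..}) (sys_rhs \<Sigma> (const_signal q) (const_signal v) x j)"
      by (simp add: continuous_on_eq_continuous_within)
    from primitive_derivative[OF ct_dynamicsD(5)[OF d j] order_refl this]
    show ?thesis
      using sys_rhs_eq[of x 0 \<Sigma> "const_signal v" j "const_signal q"] x[OF order_refl] v j by simp
  qed
  then have der: "((\<lambda>t. \<Sum>j<?n. Q $$ (i, j) * x t $ j) has_real_derivative (\<Sum>j<?n. Q $$ (i, j) * ?r 0 $ j)) (at 0 within {0..})" for i
    by (intro DERIV_sum DERIV_cmult) auto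
  have "(Q *\<^sub>v ?r 0) $ i = 0" if i: "i < k" for i
  proof -
    have z: "(\<Sum>j<?n. Q $$ (i, j) * x t $ j) = 0" if t: "t \<ge> 0" for t
      using entry[OF x[OF t] i] ker[OF x[OF t]] xW[OF t] i by simp
    have "((\<lambda>t. 0) has_real_derivative (\<Sum>j<?n. Q $$ (i, j) * ?r 0 $ j)) (at (0::real) within {0..})"
      by (rule has_field_derivative_transform_within[OF der[of i], of 1]) (use z in auto)
    moreover have "((\<lambda>t. 0) has_real_derivative 0) (at (0::real) within {0..})" by simp
    \<comment> \<open>The one-sided derivative at the boundary point is unique because 0 is not
      isolated in the half-line.\<close>
    moreover have "at (0::real) within {0..} \<noteq> bot" by (simp add: at_within_Ici_at_right)
    ultimately have "(\<Sum>j<?n. Q $$ (i, j) * ?r 0 $ j) = 0"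
      unfolding has_real_derivative_iff_has_vector_derivative
      using vector_derivative_unique_within by blast
    then show ?thesis using entry[OF rc i] by simp
  qed
  then have "Q *\<^sub>v ?r 0 = 0\<^sub>v k" using Q by (intro eq_vecI) (auto simp del: index_mult_mat_vec)
  then show ?thesis using ker[OF rc] by simp
qed

text \<open>By continuity a nonzero value at 0 persists on an interval to its right, which is not a
  null set. This makes an output known almost everywhere speak about the initial state.\<close>

lemma continuous_ae_zero_at_0:
  fixes h :: "real \<Rightarrow> real"
  assumes h: "continuous_on {0..} h" and ae: "AE t in lebesgue. t \<ge> 0 \<longrightarrow> h t = 0"
  shows "h 0 = 0"
proof (rule ccontr)
  assume ne: "h 0 \<noteq> 0"
  obtain N where N: "negligible N" "\<And>t. t \<notin> N \<Longrightarrow> t \<ge> 0 \<Longrightarrow> h t = 0"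
    using ae unfolding ae_iff_negligible by blast
  obtain d where d: "d > 0" "\<And>t. t \<ge> 0 \<Longrightarrow> dist t 0 < d \<Longrightarrow> dist (h t) (h 0) < \<bar>h 0\<bar>"
    using h ne unfolding continuous_on_iff by (metis atLeast_iff order_refl zero_less_abs_iff)
  have "box 0 d \<subseteq> N"
  proof
    fix t assume "t \<in> box 0 d"
    then have t: "0 < t" "t < d" by (auto simp: box_real)
    then have "h t \<noteq> 0" using d(2)[of t] by (auto simp: dist_real_def)
    then show "t \<in> N" using N(2)[of t] t by auto
  qed
  then have "negligible (box 0 d)" using N(1) negligible_subset by blast
  then have "box 0 d = {}" using negligible_interval(2) by blast
  then show False using d(1) by (simp add: box_real)
qed

text \<open>Exceptional null sets remain only in the output equation; everything about states
  reduces to facts on \<open>ct_dynamics\<close>.\<close>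

interpretation ct: lpv_axis ct_solutions "ae_filter lebesgue" ct_signals ct_RC
proof (unfold_locales, goal_cases)
  case (1 \<Sigma> x y u p)
  then show ?case using ct_dynamicsD(2-4) unfolding ct_solutions_iff by blast
next
  case (2 w n V)
  then show ?case by (rule ct_signalsD(1))
next
  case (3 w n V t)
  then show ?case by (rule ct_signalsD(2))
next
  case (4 v V n)
  then show ?case unfolding const_signal_def by (intro ct_signalsI piecewise_continuous_const)
next
  case (5 w n V w' s)
  then show ?case by (rule ct_signals_concat)
next
  case (6 \<Sigma> u p x0)
  then show ?case by (intro ct_sol_exists)
next
  case (7 \<Sigma> x y u p x' y')
  have d: "ct_dynamics \<Sigma> x u p" "ct_dynamics \<Sigma> x' u p" using 7(2,3) by (simp_all add: ct_solutions_iff)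
  have eq: "x t = x' t" if "t \<ge> 0" for t by (rule ct_dynamics_unique[OF d order_refl 7(4) that])
  have "x = ext x" "ext x' = x'" using ct_dynamicsD(1)[OF d(1)] ct_dynamicsD(1)[OF d(2)] by simp_all
  moreover have "ext x = ext x'" using eq by (intro restrict_ext) auto
  ultimately have "x = x'" by simp
  moreover have "AE t in lebesgue. t \<ge> 0 \<longrightarrow> y t = y' t"
  proof -
    have "AE t in lebesgue. t \<ge> 0 \<longrightarrow> y t = Cof \<Sigma> (p t) *\<^sub>v x t + Dof \<Sigma> (p t) *\<^sub>v u t"
      "AE t in lebesgue. t \<ge> 0 \<longrightarrow> y' t = Cof \<Sigma> (p t) *\<^sub>v x' t + Dof \<Sigma> (p t) *\<^sub>v u t"
      using 7(2,3) unfolding ct_solutions_iff by blast+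
    then show ?thesis by eventually_elim (use eq in simp)
  qed
  ultimately show ?case by simp
next
  case (8 \<Sigma> x y u p y')
  have "AE t in lebesgue. t \<ge> 0 \<longrightarrow> y t = Cof \<Sigma> (p t) *\<^sub>v x t + Dof \<Sigma> (p t) *\<^sub>v u t"
    using 8(2) unfolding ct_solutions_iff by blast
  with 8(4) have "AE t in lebesgue. t \<ge> 0 \<longrightarrow> y' t = Cof \<Sigma> (p t) *\<^sub>v x t + Dof \<Sigma> (p t) *\<^sub>v u t"
    by eventually_elim simp
  then show ?case using 8(2,3) unfolding ct_solutions_iff by blast
next
  case (9 \<Sigma> x y u p x' y' u' a b)
  have d: "ct_dynamics \<Sigma> x u p" "ct_dynamics \<Sigma> x' u' p"
    and y: "y \<in> ct_signals (ny \<Sigma>) (carrier_vec (ny \<Sigma>))" "y' \<in> ct_signals (ny \<Sigma>) (carrier_vec (ny \<Sigma>))"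
    and ae: "AE t in lebesgue. t \<ge> 0 \<longrightarrow> y t = Cof \<Sigma> (p t) *\<^sub>v x t + Dof \<Sigma> (p t) *\<^sub>v u t"
      "AE t in lebesgue. t \<ge> 0 \<longrightarrow> y' t = Cof \<Sigma> (p t) *\<^sub>v x' t + Dof \<Sigma> (p t) *\<^sub>v u' t"
    using 9(2,3) unfolding ct_solutions_iff by blast+
  have E: "Cof \<Sigma> (p t) *\<^sub>v lincomb_signal a x b x' t + Dof \<Sigma> (p t) *\<^sub>v lincomb_signal a u b u' t =
      a \<cdot>\<^sub>v (Cof \<Sigma> (p t) *\<^sub>v x t + Dof \<Sigma> (p t) *\<^sub>v u t) + b \<cdot>\<^sub>v (Cof \<Sigma> (p t) *\<^sub>v x' t + Dof \<Sigma> (p t) *\<^sub>v u' t)"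
    if t: "t \<ge> 0" for t
    unfolding lincomb_signal_apply[OF t]
    by (rule output_eq_lincomb[OF Cof_carrier Dof_carrier ct_dynamicsD(2)[OF d(1) t] ct_dynamicsD(2)[OF d(2) t]
        ct_signalsD(2)[OF ct_dynamicsD(3)[OF d(1)] t] ct_signalsD(2)[OF ct_dynamicsD(3)[OF d(2)] t]])
  have "AE t in lebesgue. t \<ge> 0 \<longrightarrow> lincomb_signal a y b y' t =
      Cof \<Sigma> (p t) *\<^sub>v lincomb_signal a x b x' t + Dof \<Sigma> (p t) *\<^sub>v lincomb_signal a u b u' t"
    using ae by eventually_elim (simp add: E lincomb_signal_apply[of _ a y b y'])
  then show ?case
    unfolding ct_solutions_iff using ct_dynamics_lincomb[OF d] ct_signals_lincomb[OF y] by blast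
next
  case (10 \<Sigma> x y u p s)
  have d: "ct_dynamics \<Sigma> x u p" and y: "y \<in> ct_signals (ny \<Sigma>) (carrier_vec (ny \<Sigma>))"
    and ae: "AE t in lebesgue. t \<ge> 0 \<longrightarrow> y t = Cof \<Sigma> (p t) *\<^sub>v x t + Dof \<Sigma> (p t) *\<^sub>v u t"
    using 10(2) unfolding ct_solutions_iff by blast+
  have "AE t in lebesgue. t \<ge> 0 \<longrightarrow> shift s y t = Cof \<Sigma> (shift s p t) *\<^sub>v shift s x t + Dof \<Sigma> (shift s p t) *\<^sub>v shift s u t"
    using ae_translate[OF ae, of s] by (rule eventually_mono) (use 10(3) in \<open>auto simp: shift_apply\<close>)
  then show ?case
    unfolding ct_solutions_iff using ct_dynamics_shift[OF d 10(3)] ct_signals_shift[OF y 10(3)] by blast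
next
  case (11 \<Sigma> x y u p x' y' u' p' s)
  have d: "ct_dynamics \<Sigma> x u p" "ct_dynamics \<Sigma> x' u' p'"
    and y: "y \<in> ct_signals (ny \<Sigma>) (carrier_vec (ny \<Sigma>))" "y' \<in> ct_signals (ny \<Sigma>) (carrier_vec (ny \<Sigma>))"
    and ae: "AE t in lebesgue. t \<ge> 0 \<longrightarrow> y t = Cof \<Sigma> (p t) *\<^sub>v x t + Dof \<Sigma> (p t) *\<^sub>v u t"
      "AE t in lebesgue. t \<ge> 0 \<longrightarrow> y' t = Cof \<Sigma> (p' t) *\<^sub>v x' t + Dof \<Sigma> (p' t) *\<^sub>v u' t"
    using 11(2,3) unfolding ct_solutions_iff by blast+
  have "AE t in lebesgue. t \<ge> 0 \<longrightarrow> concat_at s y y' t =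
      Cof \<Sigma> (concat_at s p p' t) *\<^sub>v concat_at s x x' t + Dof \<Sigma> (concat_at s p p' t) *\<^sub>v concat_at s u u' t"
    using ae(1) ae_translate[OF ae(2), of "- s"]
    by eventually_elim (auto simp: concat_at_def)
  then show ?case
    unfolding ct_solutions_iff using ct_dynamics_concat[OF d 11(4,5)] ct_signals_concat[OF y 11(4)] by blast
next
  case (12 \<Sigma> \<Sigma>' T x y u p)
  have d: "ct_dynamics \<Sigma> x u p" and y: "y \<in> ct_signals (ny \<Sigma>) (carrier_vec (ny \<Sigma>))"
    and ae: "AE t in lebesgue. t \<ge> 0 \<longrightarrow> y t = Cof \<Sigma> (p t) *\<^sub>v x t + Dof \<Sigma> (p t) *\<^sub>v u t"
    using 12(9) unfolding ct_solutions_iff by blast+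
  have "ct_dynamics \<Sigma>' (ext (\<lambda>t. T *\<^sub>v x t)) u p"
    by (rule ct_dynamics_intertwine[OF 12(7,3,5,6) _ d]) (use 12(8) in blast)
  moreover have "AE t in lebesgue. t \<ge> 0 \<longrightarrow> y t = Cof \<Sigma>' (p t) *\<^sub>v ext (\<lambda>t. T *\<^sub>v x t) t + Dof \<Sigma>' (p t) *\<^sub>v u t"
    using ae
  proof (rule eventually_mono, intro impI)
    fix t :: real assume h: "t \<ge> 0 \<longrightarrow> y t = Cof \<Sigma> (p t) *\<^sub>v x t + Dof \<Sigma> (p t) *\<^sub>v u t" and t: "t \<ge> 0"
    have "p t \<in> sched \<Sigma>" by (rule ct_signalsD(2)[OF ct_dynamicsD(4)[OF d] t])
    then have "Cof \<Sigma>' (p t) * T = Cof \<Sigma> (p t)" "Dof \<Sigma>' (p t) = Dof \<Sigma> (p t)" using 12(8) by blast+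
    then show "y t = Cof \<Sigma>' (p t) *\<^sub>v ext (\<lambda>t. T *\<^sub>v x t) t + Dof \<Sigma>' (p t) *\<^sub>v u t"
      using h t assoc_mult_mat_vec[OF Cof_carrier 12(7) ct_dynamicsD(2)[OF d t], of "p t"] by simp
  qed
  ultimately show ?case unfolding ct_solutions_iff using y 12(4) by simp
next
  case (13 \<Sigma> x y u p x' y' s)
  \<comment> \<open>Agreement at time \<open>s\<close> is propagated back to time 0, linear flows
    being reversible.\<close>
  then show ?case unfolding ct_solutions_iff using ct_dynamics_unique[of \<Sigma> x u p x' s 0] by blast
next
  case (14 \<Sigma> W x y v q)
  then show ?case unfolding ct_solutions_iff using ct_const_generator by blast
next
  case (15 \<Sigma> x y q)
  have d: "ct_dynamics \<Sigma> x (const_signal (0\<^sub>v (nu \<Sigma>))) (const_signal q)"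
    and ae: "AE t in lebesgue. t \<ge> 0 \<longrightarrow> y t = Cof \<Sigma> (const_signal q t) *\<^sub>v x t + Dof \<Sigma> (const_signal q t) *\<^sub>v const_signal (0\<^sub>v (nu \<Sigma>)) t"
    using 15(2) unfolding ct_solutions_iff by blast+
  note x = ct_dynamicsD(2)[OF d]
  have Cx: "Cof \<Sigma> q *\<^sub>v x t \<in> carrier_vec (ny \<Sigma>)" if "t \<ge> 0" for t
    by (rule mult_mat_vec_carrier[OF Cof_carrier x[OF that]])
  have aez: "AE t in lebesgue. t \<ge> 0 \<longrightarrow> Cof \<Sigma> q *\<^sub>v x t = 0\<^sub>v (ny \<Sigma>)"
    using ae 15(3)
  proof eventually_elim
    case (elim t)
    then show ?case using Cx[of t] by (auto simp: mult_mat_zero_vec[OF Dof_carrier])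
  qed
  have "(Cof \<Sigma> q *\<^sub>v x 0) $ i = 0" if i: "i < ny \<Sigma>" for i
  proof -
    have entry: "(Cof \<Sigma> q *\<^sub>v x t) $ i = (\<Sum>j<nx \<Sigma>. Cof \<Sigma> q $$ (i, j) * x t $ j)" if "t \<ge> 0" for t
      using mult_affine_mat_entry[OF i x[OF that]] by (simp add: Cof_def)
    have "(\<Sum>j<nx \<Sigma>. Cof \<Sigma> q $$ (i, j) * x 0 $ j) = 0"
    proof (rule continuous_ae_zero_at_0)
      show "continuous_on {0..} (\<lambda>t. \<Sum>j<nx \<Sigma>. Cof \<Sigma> q $$ (i, j) * x t $ j)"
        by (intro continuous_intros ct_dynamicsD(6)[OF d]) auto
      show "AE t in lebesgue. t \<ge> 0 \<longrightarrow> (\<Sum>j<nx \<Sigma>. Cof \<Sigma> q $$ (i, j) * x t $ j) = 0"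
        using aez by (rule eventually_mono) (use i in \<open>auto simp: entry[symmetric] simp del: index_mult_mat_vec\<close>)
    qed
    then show ?thesis using entry by simp
  qed
  then show ?case using Cof_carrier[of \<Sigma> q] by (intro eq_vecI) (auto simp del: index_mult_mat_vec)
next
  case (16 \<Sigma>)
  then show ?case by (auto simp: ct_RC_def dest: regular_schedule_nonempty)
next
  case (17 s P)
  show ?case
    using ae_translate[OF 17(2), of s] by (rule eventually_mono) (use 17(1) in auto)
next
  case (18 P)
  \<comment> \<open>Windows of integer length exhaust the axis, and countably many null sets can be
    collected into one.\<close>
  have "\<forall>m::nat. AE t in lebesgue. 0 \<le> t \<and> t < real m \<longrightarrow> P t" using 18 by blast
  then have "AE t in lebesgue. \<forall>m::nat. 0 \<le> t \<and> t < real m \<longrightarrow> P t"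
    by (rule AE_all_countable[THEN iffD2])
  then show ?case
  proof (rule eventually_mono, intro impI)
    fix t :: real assume h: "\<forall>m::nat. 0 \<le> t \<and> t < real m \<longrightarrow> P t" and t: "t \<ge> 0"
    obtain m :: nat where "t < real m" using reals_Archimedean2 by blast
    then show "P t" using h t by blast
  qed
qed

theorem theorem3:
  fixes \<Sigma> :: lpv_ssa and \<B>c :: "real behavior" and \<B>d :: "nat behavior"
  assumes "is_lpv_ssa \<Sigma>"
  shows
    "(is_ct_behavior (ny \<Sigma>) (nu \<Sigma>) (np \<Sigma>) (sched \<Sigma>) \<B>c \<and> ct_RC \<Sigma> \<and>
        realization ct_solutions \<Sigma> \<B>c \<and> controllable ct_almost_all \<B>c \<longrightarrow>
        (minimal_realization ct_solutions \<Sigma> \<B>c \<longleftrightarrow>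
           span_reachable ct_solutions \<Sigma> (0\<^sub>v (nx \<Sigma>)) \<and> observable ct_solutions \<Sigma>)) \<and>
     (is_dt_behavior (ny \<Sigma>) (nu \<Sigma>) (sched \<Sigma>) \<B>d \<and> dt_RC \<Sigma> \<and>
        realization dt_solutions \<Sigma> \<B>d \<and> controllable All \<B>d \<longrightarrow>
        (minimal_realization dt_solutions \<Sigma> \<B>d \<longleftrightarrow>
           span_reachable dt_solutions \<Sigma> (0\<^sub>v (nx \<Sigma>)) \<and> observable dt_solutions \<Sigma>)) \<and>
     (ct_RC \<Sigma> \<and> span_reachable ct_solutions \<Sigma> (0\<^sub>v (nx \<Sigma>)) \<longrightarrow>
        controllable ct_almost_all (manifest_behavior ct_solutions \<Sigma>)) \<and>
     (dt_RC \<Sigma> \<and> span_reachable dt_solutions \<Sigma> (0\<^sub>v (nx \<Sigma>)) \<longrightarrow>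
        controllable All (manifest_behavior dt_solutions \<Sigma>))"
proof -
  interpret c: lpv_axis_system ct_solutions "ae_filter lebesgue" ct_signals ct_RC \<Sigma>
    by unfold_locales (rule assms)
  interpret d: lpv_axis_system dt_solutions "top_class.top :: nat filter" "\<lambda>_ V. UNIV \<rightarrow> V" dt_RC \<Sigma>
    by unfold_locales (rule assms)
  \<comment> \<open>The quantifier \<open>All\<close> in the discrete-time claims is eventuality in
    the top filter; in continuous time both forms coincide by definition.\<close>
  have top: "(\<lambda>Q. eventually Q (top_class.top :: nat filter)) = All"
    by (simp add: fun_eq_iff eventually_top)
  note c = c.minimal_realization_iff c.span_reachable_imp_controllable
  note d = d.minimal_realization_iff[unfolded top] d.span_reachable_imp_controllable[unfolded top]
  show ?thesis
    by (intro conjI impI) (use c d in blast)+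
qed

end
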